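(* Let $(\mathbf A_n)_{n\in\mathbb N}$ be a local convergent sequence of finite base structures satisfying $\lim_{n\to\infty}\langle R,\mathbf A_n\rangle>0$, and let $(\mathbf G_n)_{n\in\mathbb N}$ be a constant-local convergent sequence of finite gadgets. Then the sequence $(\mathbf A_n*\mathbf G_n)_n$ is local convergent. Moreover, if $|V(\mathbf A_n)|\to\infty$, then the same conclusion holds when $(\mathbf G_n)_n$ is only assumed to be $\mathrm{FO}^{\text{c-loc}}_1$-convergent.
   Context: Fix a finite purely relational first-order language $L$ (with equality, positive arities) and a relation symbol $R\notin L$ of arity $\mathrm{ar}(R)\ge1$. All structures are finite and nonempty; $V(\mathbf A)$ is the universe of $\mathbf A$. Base structures and gadgets. $L_R=L\cup\{R\}$; a base structure is an $L_R$-structure. $L_G$ is $L$ extended by constants $z_1,\dots,z_{\mathrm{ar}(R)}$; a gadget is an $L_G$-structure $\mathbf G$ in which the vertices $z_i^{\mathbf G}$ (the roots) are pairwise distinct. Gadget construction. $\mathbf A*\mathbf G$ is the $L$-structure with universe $\big(V(\mathbf A)\sqcup(R^{\mathbf A}\times V(\mathbf G))\big)/\!\sim$, where $\sim$ is generated by $e_i\sim(\boldsymbol e,z_i^{\mathbf G})$ for $\boldsymbol e\in R^{\mathbf A}$, $1\le i\le\mathrm{ar}(R)$. For $S\in L$ of arity $s$, $S^{\mathbf A*\mathbf G}=\{([a_1],\dots,[a_s]):(a_1,\dots,a_s)\in S^{\mathbf A}\}\cup\{([(\boldsymbol e,v_1)],\dots,[(\boldsymbol e,v_s)]):\boldsymbol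 e\in R^{\mathbf A},(v_1,\dots,v_s)\in S^{\mathbf G}\}$. Locality and convergence. Distances are in the Gaifman graph. A formula is local if for some $r\in\mathbb N_0$ its satisfaction by a tuple depends only on the substructure induced by the $r$-neighborhood of the free variables; it is constant-local if for some $r$ its satisfaction depends only on the substructure induced by the $r$-neighborhood of the free variables and the constants (constant-local sentences are allowed). $\mathrm{FO}^{\text{c-loc}}_p$ is the set of constant-local formulas with free variables among $x_1,\dots,x_p$. For a formula $\phi$ with $p\ge1$ free variables, $\langle\phi,\mathbf A\rangle$ is the probability that a uniformly random $p$-tuple of vertices of $\mathbf A$ satisfies $\phi$; for sentences it is $1$ or $0$ according to truth. In particular $\langle R,\mathbf A\rangle=|R^{\mathbf A}|/|V(\mathbf A)|^{\mathrm{ar}(R)}$. A sequence $(\mathbf A_n)$ is $X$-convergent if $\langle\phi,\mathbf A_n\rangle$ converges for every $\phi\in X$; local (constant-local) convergent means $X$-convergent for $X$ the set of all local (constant-local) formulas of the language. *)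

theory Defs
  imports Complex_Main "HOL-Library.FuncSet"
begin

record 'l language =
  rel_syms :: "'l set"
  arity :: "'l \<Rightarrow> nat"
  const_syms :: "nat set"

definition finite_relational_language :: "'l language \<Rightarrow> bool" where
  "finite_relational_language L \<longleftrightarrow>
     finite (rel_syms L) \<and> (\<forall>S\<in>rel_syms L. 1 \<le> arity L S) \<and> const_syms L = {}"

text \<open>The arity of a symbol \<open>R\<close> outside the language \<open>L\<close> is also read off from the total
  function \<^term>\<open>arity L\<close>. The constant \<open>i\<close> of the gadget language is the root \<open>z\<^sub>i\<close>.\<close>

definition base_language :: "'l language \<Rightarrow> 'l \<Rightarrow> 'l language" where
  "base_language L R = L\<lparr>rel_syms := insert R (rel_syms L)\<rparr>"

definition gadget_language :: "'l language \<Rightarrow> 'l \<Rightarrow> 'l language" where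
  "gadget_language L R = L\<lparr>const_syms := {1..arity L R}\<rparr>"

text \<open>Interpretations of symbols that do not belong to the language under consideration are
  junk: no definition below looks at them.\<close>

record ('l, 'a) fo_struct =
  verts :: "'a set"
  rel :: "'l \<Rightarrow> 'a list set"
  cst :: "nat \<Rightarrow> 'a"

definition is_struct :: "'l language \<Rightarrow> ('l, 'a) fo_struct \<Rightarrow> bool" where
  "is_struct L A \<longleftrightarrow> finite (verts A) \<and> verts A \<noteq> {} \<and>
     (\<forall>S\<in>rel_syms L. rel A S \<subseteq> {t \<in> lists (verts A). length t = arity L S}) \<and>
     (\<forall>c\<in>const_syms L. cst A c \<in> verts A)"

definition is_gadget :: "'l language \<Rightarrow> 'l \<Rightarrow> ('l, 'a) fo_struct \<Rightarrow> bool" where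
  "is_gadget L R G \<longleftrightarrow> is_struct (gadget_language L R) G \<and> inj_on (cst G) {1..arity L R}"

definition same_struct :: "'l language \<Rightarrow> ('l, 'a) fo_struct \<Rightarrow> ('l, 'a) fo_struct \<Rightarrow> bool" where
  "same_struct L A B \<longleftrightarrow> verts A = verts B \<and> (\<forall>S\<in>rel_syms L. rel A S = rel B S) \<and>
     (\<forall>c\<in>const_syms L. cst A c = cst B c)"

definition induced :: "('l, 'a) fo_struct \<Rightarrow> 'a set \<Rightarrow> ('l, 'a) fo_struct" where
  "induced A X = A\<lparr>verts := X, rel := (\<lambda>S. rel A S \<inter> lists X)\<rparr>"

definition glue :: "'l language \<Rightarrow> 'l \<Rightarrow> ('l, 'a) fo_struct \<Rightarrow> ('l, 'b) fo_struct \<Rightarrow>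
    'a + 'a list \<times> 'b \<Rightarrow> 'a + 'a list \<times> 'b \<Rightarrow> bool" where
  "glue L R A G x y \<longleftrightarrow>
     (\<exists>e\<in>rel A R. \<exists>i\<in>{1..arity L R}. x = Inl (e ! (i - 1)) \<and> y = Inr (e, cst G i))"

definition glue_eq :: "'l language \<Rightarrow> 'l \<Rightarrow> ('l, 'a) fo_struct \<Rightarrow> ('l, 'b) fo_struct \<Rightarrow>
    (('a + 'a list \<times> 'b) \<times> ('a + 'a list \<times> 'b)) set" where
  "glue_eq L R A G = {(x, y). equivclp (glue L R A G) x y}"

definition glue_class :: "'l language \<Rightarrow> 'l \<Rightarrow> ('l, 'a) fo_struct \<Rightarrow> ('l, 'b) fo_struct \<Rightarrow>
    'a + 'a list \<times> 'b \<Rightarrow> ('a + 'a list \<times> 'b) set" where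
  "glue_class L R A G x = glue_eq L R A G `` {x}"

definition gadget_construction :: "'l language \<Rightarrow> 'l \<Rightarrow> ('l, 'a) fo_struct \<Rightarrow>
    ('l, 'b) fo_struct \<Rightarrow> ('l, ('a + 'a list \<times> 'b) set) fo_struct" where
  "gadget_construction L R A G =
    \<lparr>verts = (verts A <+> rel A R \<times> verts G) // glue_eq L R A G,
     rel = (\<lambda>S. {map (\<lambda>a. glue_class L R A G (Inl a)) t | t. t \<in> rel A S} \<union>
       {map (\<lambda>v. glue_class L R A G (Inr (e, v))) t | e t. e \<in> rel A R \<and> t \<in> rel G S}),
     cst = (\<lambda>_. undefined)\<rparr>"

datatype trm = Var nat | Cst nat

datatype 'l fm =
    Rel 'l "trm list"
  | Eq trm trm
  | Neg "'l fm"
  | Conj "'l fm" "'l fm"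
  | Exi nat "'l fm"

fun fv_trm :: "trm \<Rightarrow> nat set" where
  "fv_trm (Var x) = {x}"
| "fv_trm (Cst c) = {}"

fun fv :: "'l fm \<Rightarrow> nat set" where
  "fv (Rel S ts) = (\<Union>t\<in>set ts. fv_trm t)"
| "fv (Eq s t) = fv_trm s \<union> fv_trm t"
| "fv (Neg \<phi>) = fv \<phi>"
| "fv (Conj \<phi> \<psi>) = fv \<phi> \<union> fv \<psi>"
| "fv (Exi x \<phi>) = fv \<phi> - {x}"

fun wf_trm :: "'l language \<Rightarrow> trm \<Rightarrow> bool" where
  "wf_trm L (Var x) \<longleftrightarrow> True"
| "wf_trm L (Cst c) \<longleftrightarrow> c \<in> const_syms L"

fun wf_fm :: "'l language \<Rightarrow> 'l fm \<Rightarrow> bool" where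
  "wf_fm L (Rel S ts) \<longleftrightarrow> S \<in> rel_syms L \<and> length ts = arity L S \<and> (\<forall>t\<in>set ts. wf_trm L t)"
| "wf_fm L (Eq s t) \<longleftrightarrow> wf_trm L s \<and> wf_trm L t"
| "wf_fm L (Neg \<phi>) \<longleftrightarrow> wf_fm L \<phi>"
| "wf_fm L (Conj \<phi> \<psi>) \<longleftrightarrow> wf_fm L \<phi> \<and> wf_fm L \<psi>"
| "wf_fm L (Exi x \<phi>) \<longleftrightarrow> wf_fm L \<phi>"

fun eval_trm :: "('l, 'a) fo_struct \<Rightarrow> (nat \<Rightarrow> 'a) \<Rightarrow> trm \<Rightarrow> 'a" where
  "eval_trm A v (Var x) = v x"
| "eval_trm A v (Cst c) = cst A c"

fun sat :: "('l, 'a) fo_struct \<Rightarrow> (nat \<Rightarrow> 'a) \<Rightarrow> 'l fm \<Rightarrow> bool" where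
  "sat A v (Rel S ts) \<longleftrightarrow> map (eval_trm A v) ts \<in> rel A S"
| "sat A v (Eq s t) \<longleftrightarrow> eval_trm A v s = eval_trm A v t"
| "sat A v (Neg \<phi>) \<longleftrightarrow> \<not> sat A v \<phi>"
| "sat A v (Conj \<phi> \<psi>) \<longleftrightarrow> sat A v \<phi> \<and> sat A v \<psi>"
| "sat A v (Exi x \<phi>) \<longleftrightarrow> (\<exists>a\<in>verts A. sat A (v(x := a)) \<phi>)"

definition rel_atom :: "'l language \<Rightarrow> 'l \<Rightarrow> 'l fm" where
  "rel_atom L S = Rel S (map Var [1..<Suc (arity L S)])"

definition gaifman :: "'l language \<Rightarrow> ('l, 'a) fo_struct \<Rightarrow> ('a \<times> 'a) set" where
  "gaifman L A = {(a, b). a \<noteq> b \<and> (\<exists>S\<in>rel_syms L. \<exists>t\<in>rel A S. a \<in> set t \<and> b \<in> set t)}"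

text \<open>Gaifman distance at most \<open>r\<close> means being joined by a walk with at most \<open>r\<close> edges.\<close>

definition nbhd :: "'l language \<Rightarrow> ('l, 'a) fo_struct \<Rightarrow> nat \<Rightarrow> 'a set \<Rightarrow> 'a set" where
  "nbhd L A r X = {b. \<exists>a\<in>X. \<exists>i\<le>r. (a, b) \<in> gaifman L A ^^ i}"

text \<open>Satisfaction of \<open>\<phi>\<close> depends only on the substructure induced by the \<open>r\<close>-neighborhood of
  the free variables and of the constants in \<open>C\<close>. All structures being finite and satisfaction
  being invariant under isomorphism, it suffices to let them range over the structures whose
  vertices are natural numbers.\<close>

definition nbhd_determined :: "'l language \<Rightarrow> nat set \<Rightarrow> nat \<Rightarrow> 'l fm \<Rightarrow> bool" where
  "nbhd_determined L C r \<phi> \<longleftrightarrow>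
     (\<forall>(A :: ('l, nat) fo_struct) B v.
        is_struct L A \<longrightarrow> is_struct L B \<longrightarrow> v ` fv \<phi> \<subseteq> verts A \<inter> verts B \<longrightarrow>
        same_struct (L\<lparr>const_syms := C\<rparr>)
          (induced A (nbhd L A r (v ` fv \<phi> \<union> cst A ` C)))
          (induced B (nbhd L B r (v ` fv \<phi> \<union> cst B ` C))) \<longrightarrow>
        (sat A v \<phi> \<longleftrightarrow> sat B v \<phi>))"

definition local_fms :: "'l language \<Rightarrow> 'l fm set" where
  "local_fms L = {\<phi>. wf_fm L \<phi> \<and> (\<exists>r. nbhd_determined L {} r \<phi>)}"

definition constant_local_fms :: "'l language \<Rightarrow> 'l fm set" where
  "constant_local_fms L = {\<phi>. wf_fm L \<phi> \<and> (\<exists>r. nbhd_determined L (const_syms L) r \<phi>)}"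

definition constant_local_fms_upto :: "'l language \<Rightarrow> nat \<Rightarrow> 'l fm set" where
  "constant_local_fms_upto L p = {\<phi> \<in> constant_local_fms L. fv \<phi> \<subseteq> {1..p}}"

text \<open>Tuples of vertices are indexed by the free variables. For a sentence there is exactly one
  (empty) tuple, so the quotient is the truth value.\<close>

definition stone_pairing :: "'l fm \<Rightarrow> ('l, 'a) fo_struct \<Rightarrow> real" where
  "stone_pairing \<phi> A =
     real (card {v \<in> fv \<phi> \<rightarrow>\<^sub>E verts A. sat A v \<phi>}) / real (card (verts A)) ^ card (fv \<phi>)"

lemma sat_cong: "(\<And>x. x \<in> fv \<phi> \<Longrightarrow> v x = w x) \<Longrightarrow> sat A v \<phi> \<longleftrightarrow> sat A w \<phi>"
proof (induction \<phi> arbitrary: v w)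
  have t: "eval_trm A v t = eval_trm A w t" if "\<And>x. x \<in> fv_trm t \<Longrightarrow> v x = w x" for t v w
    using that by (cases t) auto
  {
    case (Rel S ts)
    have "map (eval_trm A v) ts = map (eval_trm A w) ts"
      using Rel by (auto intro!: t)
    then show ?case by (simp only: sat.simps)
  next
    case (Eq a b)
    then show ?case using t[of a v w] t[of b v w] by auto
  next
    case (Neg \<phi>)
    have "sat A v \<phi> = sat A w \<phi>" using Neg.prems by (intro Neg.IH) simp
    then show ?case by simp
  next
    case (Conj \<phi> \<psi>)
    have "sat A v \<phi> = sat A w \<phi>" using Conj.prems by (intro Conj.IH(1)) simp
    moreover have "sat A v \<psi> = sat A w \<psi>" using Conj.prems by (intro Conj.IH(2)) simp
    ultimately show ?case by simp
  next
    case (Exi x \<phi>)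
    have "sat A (v(x := a)) \<phi> = sat A (w(x := a)) \<phi>" for a
      using Exi.prems by (intro Exi.IH) auto
    then show ?case by simp
  }
qed

lemma stone_pairing_sentence:
  "fv \<phi> = {} \<Longrightarrow> stone_pairing \<phi> A = (if sat A v \<phi> then 1 else 0)"
proof -
  assume s: "fv \<phi> = {}"
  then have "sat A (\<lambda>_. undefined) \<phi> = sat A v \<phi>" by (intro sat_cong) simp
  moreover from this have "{w. w = (\<lambda>_. undefined) \<and> sat A w \<phi>} =
      (if sat A v \<phi> then {\<lambda>_. undefined} else {})" by auto
  ultimately show ?thesis using s by (simp add: stone_pairing_def)
qed

lemma stone_pairing_rel_atom:
  assumes A: "is_struct L A" and S: "S \<in> rel_syms L"
  shows "stone_pairing (rel_atom L S) A = real (card (rel A S)) / real (card (verts A)) ^ arity L S"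
proof -
  let ?k = "arity L S" and ?m = "\<lambda>v. map v [1..<Suc (arity L S)]"
  let ?X = "{v \<in> {1..?k} \<rightarrow>\<^sub>E verts A. sat A v (rel_atom L S)}"
  have fv: "fv (rel_atom L S) = {1..?k}"
    by (auto simp: rel_atom_def)
  have sat: "sat A v (rel_atom L S) \<longleftrightarrow> ?m v \<in> rel A S" for v
    by (simp add: rel_atom_def comp_def del: upt_Suc)
  have inj: "inj_on ?m ?X"
  proof (rule inj_onI)
    fix v w assume v: "v \<in> ?X" and w: "w \<in> ?X" and eq: "?m v = ?m w"
    have "v x = w x" if "x \<in> {1..?k}" for x
      using eq that by (auto simp del: upt_Suc)
    then show "v = w" using v w PiE_ext[of v "{1..?k}" "\<lambda>_. verts A" w] by simp
  qed
  have "?m ` ?X = rel A S"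
  proof
    show "?m ` ?X \<subseteq> rel A S" using sat by auto
    show "rel A S \<subseteq> ?m ` ?X"
    proof
      fix t assume t: "t \<in> rel A S"
      then have l: "length t = ?k" "set t \<subseteq> verts A"
        using A S by (auto simp: is_struct_def)
      let ?v = "\<lambda>i\<in>{1..?k}. t ! (i - 1)"
      have m: "?m ?v = t"
        using l by (intro nth_equalityI) (auto simp del: upt_Suc)
      have "?v \<in> {1..?k} \<rightarrow>\<^sub>E verts A"
        using l by (intro restrict_PiE_iff[THEN iffD2] ballI) (auto intro!: subsetD[OF l(2)] nth_mem)
      moreover have "sat A ?v (rel_atom L S)" using sat[of ?v] m t by (simp only:)
      ultimately have "?v \<in> ?X" by blast
      then have "?m ?v \<in> ?m ` ?X" by (rule imageI)
      then show "t \<in> ?m ` ?X" by (simp only: m)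
    qed
  qed
  then have "card ?X = card (rel A S)" using card_image[OF inj] by simp
  then show ?thesis by (simp add: stone_pairing_def fv)
qed

definition fms_convergent :: "'l fm set \<Rightarrow> (nat \<Rightarrow> ('l, 'a) fo_struct) \<Rightarrow> bool" where
  "fms_convergent X A \<longleftrightarrow> (\<forall>\<phi>\<in>X. convergent (\<lambda>n. stone_pairing \<phi> (A n)))"

definition local_convergent :: "'l language \<Rightarrow> (nat \<Rightarrow> ('l, 'a) fo_struct) \<Rightarrow> bool" where
  "local_convergent L = fms_convergent (local_fms L)"

definition constant_local_convergent :: "'l language \<Rightarrow> (nat \<Rightarrow> ('l, 'a) fo_struct) \<Rightarrow> bool" where
  "constant_local_convergent L = fms_convergent (constant_local_fms L)"

end

theory Submission
  imports Defs "HOL-Library.Nat_Bijection"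
begin

text \<open>A tuple of vertices of \<open>\<A> * \<G>\<close> consists of base vertices and of non-root vertices in copies of the
  gadget over edges of the base. By a Feferman--Vaught argument, whether it satisfies a formula depends
  only on the truth of finitely many formulas in the base, at the base vertices and the entries of the
  edges involved, and of finitely many formulas in the gadget, separately for each copy that is met.
  If the formula is local, base and gadget may be replaced beforehand by neighborhoods of the tuple and
  of the roots, so that the formulas become local and constant-local. Counting tuples by the set
  partition that records which entries lie in a common copy, the Stone pairing becomes a finite sum of
  products of Stone pairings in the base, Stone pairings in the gadget, and ratios of vertex counts; the
  ratios converge because \<open>\<langle>R, \<A>\<rangle>\<close> has a positive limit. If the base grows, partitions with two entries in one
  copy contribute nothing in the limit, and only formulas with one free variable are needed in the
  gadget.\<close>

text \<open>The obstacle in the Feferman-Vaught step is that a quantifier can enter any of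
  unboundedly many copies. All copies that the tuple does not meet carry the same
  \<open>default\<close> gadget, so entering one of them amounts to naming a new edge, which is a
  quantifier over the base, and to asking sentences of \<open>default\<close>. Hence the gadget
  formulas are of two sorts: families for the copies that are met, which enter the count through
  Stone pairings, and sentences \<open>\<Gamma>0\<close> for all other copies, whose truth values
  are eventually constant by convergence.

  Vertex counts decide which convergence is needed. With \<open>a\<close> and \<open>g\<close> the
  sizes of base and gadget and \<open>k\<close> the arity of \<open>R\<close>, the glued structure
  has size of order \<open>a^k * g\<close>, unless the gadget eventually consists of its roots
  alone. A copy that receives \<open>m\<close> entries of the tuple offers at most
  \<open>a^k\<close> edges and \<open>g^m\<close> choices inside, against \<open>(a^k * g)^m\<close>
  in the denominator: a factor of order at most \<open>a^(-k*(m-1))\<close>. It is bounded, and for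
  \<open>m \<ge> 2\<close> it vanishes as the base grows.\<close>

section \<open>Derived connectives\<close>

definition Truth :: "'l fm" where
  "Truth = Exi 0 (Eq (Var 0) (Var 0))"

definition Conjs :: "'l fm list \<Rightarrow> 'l fm" where
  "Conjs \<phi>s = foldr Conj \<phi>s Truth"

definition Disjs :: "'l fm list \<Rightarrow> 'l fm" where
  "Disjs \<phi>s = Neg (Conjs (map Neg \<phi>s))"

definition Exis :: "nat list \<Rightarrow> 'l fm \<Rightarrow> 'l fm" where
  "Exis xs \<phi> = foldr Exi xs \<phi>"

lemma wf_Conjs [simp]: "wf_fm L (Conjs \<phi>s) \<longleftrightarrow> (\<forall>\<phi>\<in>set \<phi>s. wf_fm L \<phi>)"
  by (induction \<phi>s) (auto simp: Conjs_def Truth_def)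

lemma fv_Conjs [simp]: "fv (Conjs \<phi>s) = (\<Union>\<phi>\<in>set \<phi>s. fv \<phi>)"
  by (induction \<phi>s) (auto simp: Conjs_def Truth_def)

text \<open>The empty conjunction \<open>Truth\<close> is closed, so it adds no free variable, but
  it asserts that a vertex exists; this is the source of the nonemptiness assumptions here and
  below.\<close>

lemma sat_Conjs:
  "verts A \<noteq> {} \<Longrightarrow> sat A v (Conjs \<phi>s) \<longleftrightarrow> (\<forall>\<phi>\<in>set \<phi>s. sat A v \<phi>)"
  by (induction \<phi>s) (auto simp: Conjs_def Truth_def)

lemma wf_Disjs [simp]: "wf_fm L (Disjs \<phi>s) \<longleftrightarrow> (\<forall>\<phi>\<in>set \<phi>s. wf_fm L \<phi>)"
  by (simp add: Disjs_def)

lemma fv_Disjs [simp]: "fv (Disjs \<phi>s) = (\<Union>\<phi>\<in>set \<phi>s. fv \<phi>)"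
  by (simp add: Disjs_def)

lemma sat_Disjs:
  "verts A \<noteq> {} \<Longrightarrow> sat A v (Disjs \<phi>s) \<longleftrightarrow> (\<exists>\<phi>\<in>set \<phi>s. sat A v \<phi>)"
  by (simp add: Disjs_def sat_Conjs)

lemma wf_Exis [simp]: "wf_fm L (Exis xs \<phi>) \<longleftrightarrow> wf_fm L \<phi>"
  by (induction xs) (auto simp: Exis_def)

lemma fv_Exis [simp]: "fv (Exis xs \<phi>) = fv \<phi> - set xs"
  by (induction xs) (auto simp: Exis_def)

text \<open>A block of quantifiers is read as one change of the valuation on \<open>set xs\<close>,
  so that whole tuples, such as the entries of an edge, can be chosen at once.\<close>

lemma sat_Exis:
  "sat A v (Exis xs \<phi>) \<longleftrightarrow>
     (\<exists>v'. (\<forall>x. x \<notin> set xs \<longrightarrow> v' x = v x) \<and> (\<forall>x\<in>set xs. v' x \<in> verts A) \<and> sat A v' \<phi>)"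
proof (induction xs arbitrary: v)
  case Nil
  have "v' = v" if "\<forall>x. v' x = v x" for v' using that by blast
  then show ?case by (auto simp: Exis_def)
next
  case (Cons y xs)
  have "sat A v (Exis (y # xs) \<phi>) \<longleftrightarrow> (\<exists>a\<in>verts A. sat A (v(y := a)) (Exis xs \<phi>))"
    by (simp add: Exis_def)
  also have "\<dots> \<longleftrightarrow> (\<exists>v'. (\<forall>x. x \<notin> set (y # xs) \<longrightarrow> v' x = v x) \<and>
      (\<forall>x\<in>set (y # xs). v' x \<in> verts A) \<and> sat A v' \<phi>)"
    (is "?l \<longleftrightarrow> ?r")
  proof
    assume ?l
    then obtain a v' where "a \<in> verts A" "\<forall>x. x \<notin> set xs \<longrightarrow> v' x = (v(y := a)) x"
      "\<forall>x\<in>set xs. v' x \<in> verts A" "sat A v' \<phi>"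
      unfolding Cons.IH by blast
    note v' = this
    \<comment> \<open>If \<open>y\<close> recurs in \<open>xs\<close>, an inner quantifier has
      overwritten the value \<open>a\<close>.\<close>
    have "v' y \<in> verts A" using v'(1-3) by (cases "y \<in> set xs") auto
    then have "\<forall>x\<in>set (y # xs). v' x \<in> verts A" using v'(3) by simp
    moreover have "\<forall>x. x \<notin> set (y # xs) \<longrightarrow> v' x = v x" using v'(2) by simp
    ultimately show ?r using v'(4) by blast
  next
    assume ?r
    then obtain v' where v': "\<forall>x. x \<notin> set (y # xs) \<longrightarrow> v' x = v x"
      "\<forall>x\<in>set (y # xs). v' x \<in> verts A" "sat A v' \<phi>" by blast
    have "\<forall>x. x \<notin> set xs \<longrightarrow> v' x = (v(y := v' y)) x" using v'(1) by simp
    moreover have "v' y \<in> verts A" "\<forall>x\<in>set xs. v' x \<in> verts A" using v'(2) by simp_all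
    ultimately show ?l unfolding Cons.IH using v'(3) by blast
  qed
  finally show ?case .
qed

lemma eval_trm_cong: "(\<And>x. x \<in> fv_trm t \<Longrightarrow> v x = w x) \<Longrightarrow> eval_trm A v t = eval_trm A w t"
  by (cases t) auto

lemma eval_trm_upd: "x \<notin> fv_trm t \<Longrightarrow> eval_trm A (v(x := a)) t = eval_trm A v t"
  by (cases t) auto

lemma finite_fv [simp]: "finite (fv \<phi>)"
proof (induction \<phi>)
  have t: "finite (fv_trm t)" for t by (cases t) auto
  { case (Rel S ts) then show ?case using t by simp
  next case (Eq s t) then show ?case using t by simp }
qed auto

lemma is_structD:
  assumes "is_struct L A" "S \<in> rel_syms L" "t \<in> rel A S"
  shows "set t \<subseteq> verts A" and "length t = arity L S"
  using assms by (auto simp: is_struct_def)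

subsection \<open>Relativization to neighborhoods\<close>

lemma nbhd_0 [simp]: "nbhd L A 0 X = X"
  by (auto simp: nbhd_def)

text \<open>Growth is stated by common tuples instead of Gaifman edges. The requirement
  \<open>a \<noteq> b\<close> of an edge disappears, because equal vertices already lie in the
  smaller neighborhood.\<close>

lemma nbhd_Suc:
  "b \<in> nbhd L A (Suc r) X \<longleftrightarrow> b \<in> nbhd L A r X \<or>
     (\<exists>a\<in>nbhd L A r X. \<exists>S\<in>rel_syms L. \<exists>t\<in>rel A S. a \<in> set t \<and> b \<in> set t)"
proof
  assume "b \<in> nbhd L A (Suc r) X"
  then obtain a i where a: "a \<in> X" "i \<le> Suc r" "(a, b) \<in> gaifman L A ^^ i"
    by (auto simp: nbhd_def)
  show "b \<in> nbhd L A r X \<or>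
     (\<exists>a\<in>nbhd L A r X. \<exists>S\<in>rel_syms L. \<exists>t\<in>rel A S. a \<in> set t \<and> b \<in> set t)"
  proof (cases "i = Suc r")
    case True
    then obtain c where "(a, c) \<in> gaifman L A ^^ r" "(c, b) \<in> gaifman L A" using a by auto
    then have "c \<in> nbhd L A r X" using a(1) by (auto simp: nbhd_def)
    then show ?thesis using \<open>(c, b) \<in> gaifman L A\<close> unfolding gaifman_def by blast
  next
    case False
    then have "i \<le> r" using a by simp
    then show ?thesis using a by (auto simp: nbhd_def)
  qed
next
  assume *: "b \<in> nbhd L A r X \<or>
     (\<exists>a\<in>nbhd L A r X. \<exists>S\<in>rel_syms L. \<exists>t\<in>rel A S. a \<in> set t \<and> b \<in> set t)"
  show "b \<in> nbhd L A (Suc r) X"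
  proof (cases "b \<in> nbhd L A r X")
    case True
    then show ?thesis using le_SucI unfolding nbhd_def by blast
  next
    case False
    then obtain c S t where c: "c \<in> nbhd L A r X" "S \<in> rel_syms L" "t \<in> rel A S" "c \<in> set t" "b \<in> set t"
      using * by blast
    then have "(c, b) \<in> gaifman L A" using False by (auto simp: gaifman_def)
    moreover obtain a i where "a \<in> X" "i \<le> r" "(a, c) \<in> gaifman L A ^^ i"
      using c(1) by (auto simp: nbhd_def)
    ultimately have "a \<in> X" "Suc i \<le> Suc r" "(a, b) \<in> gaifman L A ^^ Suc i" by auto
    then show ?thesis unfolding nbhd_def by blast
  qed
qed

lemma nbhd_Suc_tuple:
  "a \<in> nbhd L A r X \<Longrightarrow> S \<in> rel_syms L \<Longrightarrow> t \<in> rel A S \<Longrightarrow> a \<in> set t \<Longrightarrow> b \<in> set t \<Longrightarrow>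
    b \<in> nbhd L A (Suc r) X"
  by (auto simp: nbhd_Suc)

lemma nbhd_radius_mono: "r \<le> r' \<Longrightarrow> nbhd L A r X \<subseteq> nbhd L A r' X"
  unfolding nbhd_def using le_trans by blast

lemma nbhd_superset: "X \<subseteq> nbhd L A r X"
  using nbhd_radius_mono[of 0 r L A X] by simp

lemma nbhd_verts: "is_struct L A \<Longrightarrow> X \<subseteq> verts A \<Longrightarrow> nbhd L A r X \<subseteq> verts A"
proof (induction r)
  case (Suc r)
  have "b \<in> verts A" if "S \<in> rel_syms L" "t \<in> rel A S" "b \<in> set t" for b S t
    using that Suc.prems(1) by (auto simp: is_struct_def)
  then show ?case using Suc by (auto simp: nbhd_Suc)
qed simp

definition rel_list :: "'l language \<Rightarrow> 'l list" where
  "rel_list L = (SOME Ss. set Ss = rel_syms L)"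

lemma set_rel_list: "finite (rel_syms L) \<Longrightarrow> set (rel_list L) = rel_syms L"
  unfolding rel_list_def using finite_list by (rule someI_ex)

text \<open>In the formulas below, \<open>m\<close> is a bound above which all variables are fresh.\<close>

definition adj_fm :: "'l language \<Rightarrow> nat \<Rightarrow> trm \<Rightarrow> trm \<Rightarrow> 'l fm" where
  "adj_fm L m s t = Disjs (map (\<lambda>S. let zs = [m..<m + arity L S] in
     Exis zs (Conj (Rel S (map Var zs))
       (Conj (Disjs (map (\<lambda>z. Eq s (Var z)) zs)) (Disjs (map (\<lambda>z. Eq t (Var z)) zs)))))
     (rel_list L))"

fun near_fm :: "'l language \<Rightarrow> trm list \<Rightarrow> nat \<Rightarrow> nat \<Rightarrow> trm \<Rightarrow> 'l fm" where
  "near_fm L cs 0 m t = Disjs (map (Eq t) cs)"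
| "near_fm L cs (Suc r) m t = Disjs [near_fm L cs r m t,
     Exi m (Conj (near_fm L cs r (Suc m) (Var m)) (adj_fm L (Suc m) (Var m) t))]"

fun ren_trm :: "(nat \<Rightarrow> nat) \<Rightarrow> trm \<Rightarrow> trm" where
  "ren_trm \<rho> (Var x) = Var (\<rho> x)"
| "ren_trm \<rho> (Cst c) = Cst c"

text \<open>The terms \<open>cs\<close> are the centers of the neighborhood and must keep their
  values under every quantifier of the formula. Each bound variable is therefore replaced by the
  fresh name \<open>m\<close>, which grows with the depth, and \<open>\<rho>\<close> records the
  replacement.\<close>

fun relativize :: "'l language \<Rightarrow> trm list \<Rightarrow> nat \<Rightarrow> nat \<Rightarrow> (nat \<Rightarrow> nat) \<Rightarrow> 'l fm \<Rightarrow> 'l fm" where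
  "relativize L cs r m \<rho> (Rel S ts) = Rel S (map (ren_trm \<rho>) ts)"
| "relativize L cs r m \<rho> (Eq s t) = Eq (ren_trm \<rho> s) (ren_trm \<rho> t)"
| "relativize L cs r m \<rho> (Neg \<phi>) = Neg (relativize L cs r m \<rho> \<phi>)"
| "relativize L cs r m \<rho> (Conj \<phi> \<psi>) = Conj (relativize L cs r m \<rho> \<phi>) (relativize L cs r m \<rho> \<psi>)"
| "relativize L cs r m \<rho> (Exi x \<phi>) =
     Exi m (Conj (near_fm L cs r (Suc m) (Var m)) (relativize L cs r (Suc m) (\<rho>(x := m)) \<phi>))"

lemma wf_adj_fm:
  "finite (rel_syms L) \<Longrightarrow> wf_trm L s \<Longrightarrow> wf_trm L t \<Longrightarrow> wf_fm L (adj_fm L m s t)"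
  by (auto simp: adj_fm_def Let_def set_rel_list)

lemma fv_adj_fm: "fv (adj_fm L m s t) \<subseteq> fv_trm s \<union> fv_trm t"
  by (fastforce simp: adj_fm_def Let_def)

lemma sat_adj_fm:
  assumes fin: "finite (rel_syms L)" and A: "is_struct L A"
    and m: "fv_trm s \<subseteq> {..<m}" "fv_trm t \<subseteq> {..<m}"
  shows "sat A v (adj_fm L m s t) \<longleftrightarrow>
    (\<exists>S\<in>rel_syms L. \<exists>e\<in>rel A S. eval_trm A v s \<in> set e \<and> eval_trm A v t \<in> set e)"
proof -
  have ne: "verts A \<noteq> {}" using A by (simp add: is_struct_def)
  have ev: "eval_trm A v' u = eval_trm A v u"
    if "\<forall>x. x \<notin> set [m..<m + k] \<longrightarrow> v' x = v x" "fv_trm u \<subseteq> {..<m}" for v' u k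
    using that by (intro eval_trm_cong) auto
  have *: "sat A v (Exis [m..<m + arity L S] (Conj (Rel S (map Var [m..<m + arity L S]))
       (Conj (Disjs (map (\<lambda>z. Eq s (Var z)) [m..<m + arity L S]))
         (Disjs (map (\<lambda>z. Eq t (Var z)) [m..<m + arity L S])))))
     \<longleftrightarrow> (\<exists>e\<in>rel A S. eval_trm A v s \<in> set e \<and> eval_trm A v t \<in> set e)" (is "?l \<longleftrightarrow> ?r")
    if S: "S \<in> rel_syms L" for S
  proof
    assume ?l
    then obtain v' where v': "\<forall>x. x \<notin> set [m..<m + arity L S] \<longrightarrow> v' x = v x"
      "map v' [m..<m + arity L S] \<in> rel A S"
      "eval_trm A v' s \<in> v' ` {m..<m + arity L S}" "eval_trm A v' t \<in> v' ` {m..<m + arity L S}"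
      unfolding sat_Exis by (auto simp: sat_Disjs[OF ne] comp_def)
    then show ?r using ev[OF v'(1) m(1)] ev[OF v'(1) m(2)]
      by (intro bexI[OF _ v'(2)]) auto
  next
    assume ?r
    then obtain e where e: "e \<in> rel A S" "eval_trm A v s \<in> set e" "eval_trm A v t \<in> set e" by blast
    have l: "length e = arity L S" "set e \<subseteq> verts A" using e(1) A S by (auto simp: is_struct_def)
    define v' where "v' x = (if m \<le> x \<and> x < m + arity L S then e ! (x - m) else v x)" for x
    have e': "map v' [m..<m + arity L S] = e"
      using l by (intro nth_equalityI) (auto simp: v'_def)
    then have se: "v' ` {m..<m + arity L S} = set e" by (metis set_map set_upt)
    have v': "\<forall>x. x \<notin> set [m..<m + arity L S] \<longrightarrow> v' x = v x" by (simp add: v'_def)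
    show ?l unfolding sat_Exis
    proof (intro exI conjI)
      show "\<forall>x. x \<notin> set [m..<m + arity L S] \<longrightarrow> v' x = v x" by fact
      show "\<forall>x\<in>set [m..<m + arity L S]. v' x \<in> verts A" using se l(2) by auto
      show "sat A v' (Conj (Rel S (map Var [m..<m + arity L S]))
       (Conj (Disjs (map (\<lambda>z. Eq s (Var z)) [m..<m + arity L S]))
         (Disjs (map (\<lambda>z. Eq t (Var z)) [m..<m + arity L S]))))"
        using e e' se ev[OF v' m(1)] ev[OF v' m(2)]
        by (simp add: sat_Disjs[OF ne] comp_def) (auto simp: image_iff)
    qed
  qed
  show ?thesis unfolding adj_fm_def Let_def sat_Disjs[OF ne] using * fin
    by (auto simp: set_rel_list)
qed

lemma wf_near_fm:
  "finite (rel_syms L) \<Longrightarrow> \<forall>c\<in>set cs. wf_trm L c \<Longrightarrow> wf_trm L t \<Longrightarrow> wf_fm L (near_fm L cs r m t)"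
  by (induction r arbitrary: m t) (auto simp: wf_adj_fm)

lemma fv_near_fm: "fv (near_fm L cs r m t) \<subseteq> (\<Union>c\<in>set cs. fv_trm c) \<union> fv_trm t"
proof (induction r arbitrary: m t)
  case (Suc r)
  show ?case using Suc[of m t] Suc[of "Suc m" "Var m"] fv_adj_fm[of L "Suc m" "Var m" t] by auto
qed auto

lemma sat_near_fm:
  assumes fin: "finite (rel_syms L)" and A: "is_struct L A"
    and "(\<Union>c\<in>set cs. fv_trm c) \<subseteq> {..<m}" "fv_trm t \<subseteq> {..<m}"
    and "eval_trm A v ` set cs \<subseteq> verts A"
  shows "sat A v (near_fm L cs r m t) \<longleftrightarrow> eval_trm A v t \<in> nbhd L A r (eval_trm A v ` set cs)"
  using assms(3-)
proof (induction r arbitrary: m t v)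
  have ne: "verts A \<noteq> {}" using A by (simp add: is_struct_def)
  {
    case 0
    then show ?case by (auto simp: sat_Disjs[OF ne])
  next
    case (Suc r)
    have m: "m \<notin> fv_trm c" if "c \<in> insert t (set cs)" for c using that Suc.prems by auto
    have im: "eval_trm A (v(m := a)) ` set cs = eval_trm A v ` set cs" for a
      by (intro image_cong) (simp_all add: eval_trm_upd m)
    have sub: "nbhd L A r (eval_trm A v ` set cs) \<subseteq> verts A"
      by (rule nbhd_verts[OF A Suc.prems(3)])
    have 1: "sat A (v(m := a)) (near_fm L cs r (Suc m) (Var m)) \<longleftrightarrow>
        a \<in> nbhd L A r (eval_trm A v ` set cs)" for a
      using Suc.IH[of "Suc m" "Var m" "v(m := a)"] Suc.prems im by fastforce
    have 2: "sat A (v(m := a)) (adj_fm L (Suc m) (Var m) t) \<longleftrightarrow>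
        (\<exists>S\<in>rel_syms L. \<exists>e\<in>rel A S. a \<in> set e \<and> eval_trm A v t \<in> set e)" for a
      using Suc.prems(2) by (subst sat_adj_fm[OF fin A]) (auto simp: eval_trm_upd m less_Suc_eq)
    show ?case
      using sub by (auto simp: sat_Disjs[OF ne] nbhd_Suc Suc.IH[OF Suc.prems] 1 2 del: subsetI)
  }
qed

lemma fv_ren_trm [simp]: "fv_trm (ren_trm \<rho> t) = \<rho> ` fv_trm t"
  by (cases t) auto

lemma eval_ren_trm: "eval_trm A v (ren_trm \<rho> t) = eval_trm (induced A N) (v \<circ> \<rho>) t"
  by (cases t) (auto simp: induced_def)

lemma wf_relativize:
  "finite (rel_syms L) \<Longrightarrow> \<forall>c\<in>set cs. wf_trm L c \<Longrightarrow> wf_fm L \<phi> \<Longrightarrow>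
    wf_fm L (relativize L cs r m \<rho> \<phi>)"
proof (induction \<phi> arbitrary: m \<rho>)
  have t: "wf_trm L (ren_trm \<rho> t) = wf_trm L t" for \<rho> t by (cases t) auto
  { case Rel then show ?case by (simp add: t)
  next case Eq then show ?case by (simp add: t) }
qed (auto simp: wf_near_fm)

lemma fv_relativize:
  "fv (relativize L cs r m \<rho> \<phi>) \<subseteq> (\<Union>c\<in>set cs. fv_trm c) \<union> \<rho> ` fv \<phi>"
proof (induction \<phi> arbitrary: m \<rho>)
  case (Exi x \<phi>)
  have sub: "(N \<union> P) - M \<subseteq> U \<union> W" if "N - M \<subseteq> U" "P \<subseteq> U \<union> Q" "Q - M \<subseteq> W" for N M P Q U W :: "nat set"
    using that by blast
  show ?case unfolding relativize.simps fv.simps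
  proof (rule sub)
    show "fv (near_fm L cs r (Suc m) (Var m)) - {m} \<subseteq> (\<Union>c\<in>set cs. fv_trm c)"
      using fv_near_fm[of L cs r "Suc m" "Var m"] by auto
    show "(\<rho>(x := m)) ` fv \<phi> - {m} \<subseteq> \<rho> ` (fv \<phi> - {x})" by auto
  qed (rule Exi)
next
  case (Conj \<phi> \<psi>)
  have sub: "P \<union> Q \<subseteq> U \<union> (V \<union> W)" if "P \<subseteq> U \<union> V" "Q \<subseteq> U \<union> W" for P Q U V W :: "nat set"
    using that by blast
  show ?case unfolding relativize.simps fv.simps image_Un by (rule sub) (rule Conj)+
qed auto

text \<open>Free variables and constants take values in \<open>N\<close>, so every term does, and
  cutting the relations down to \<open>lists N\<close> changes no atom. Quantifiers match because
  \<open>near_fm\<close> defines \<open>N\<close> with the centers as parameters.\<close>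

lemma sat_relativize:
  assumes fin: "finite (rel_syms L)" and A: "is_struct L A" and wf: "wf_fm L \<phi>"
    and "(\<Union>c\<in>set cs. fv_trm c) \<subseteq> {..<m}" and "\<rho> ` fv \<phi> \<subseteq> {..<m}"
    and "eval_trm A v ` set cs \<subseteq> verts A"
    and N: "N = nbhd L A r (eval_trm A v ` set cs)" and "v ` \<rho> ` fv \<phi> \<subseteq> N"
    and C: "cst A ` const_syms L \<subseteq> N"
  shows "sat A v (relativize L cs r m \<rho> \<phi>) \<longleftrightarrow> sat (induced A N) (v \<circ> \<rho>) \<phi>"
  using wf assms(4-8)
proof (induction \<phi> arbitrary: m \<rho> v)
  case (Rel S ts)
  have "map (eval_trm (induced A N) (v \<circ> \<rho>)) ts \<in> lists N"
  proof (clarsimp simp del: eval_trm.simps)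
    fix t assume t: "t \<in> set ts"
    show "eval_trm (induced A N) (v \<circ> \<rho>) t \<in> N"
    proof (cases t)
      case (Var x)
      then have "x \<in> fv (Rel S ts)" using t by force
      then show ?thesis using Rel.prems(6) Var by auto
    next
      case (Cst c)
      then have "c \<in> const_syms L" using Rel.prems(1) t by force
      then show ?thesis using Cst C by (auto simp: induced_def)
    qed
  qed
  then show ?case by (auto simp: eval_ren_trm[of A v \<rho> _ N] comp_def induced_def)
next
  case (Eq s t)
  then show ?case by (simp only: relativize.simps sat.simps eval_ren_trm[of A v \<rho> _ N])
next
  case (Neg \<phi>)
  then show ?case by simp
next
  case (Conj \<phi> \<psi>)
  then show ?case by (simp add: image_Un)
next
  case (Exi x \<phi>)
  have m: "m \<notin> fv_trm c" if "c \<in> set cs" for c using that Exi.prems by auto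
  have im: "eval_trm A (v(m := a)) ` set cs = eval_trm A v ` set cs" for a
    by (intro image_cong) (simp_all add: eval_trm_upd m)
  have sub: "N \<subseteq> verts A" unfolding Exi.prems(5) by (rule nbhd_verts[OF A Exi.prems(4)])
  have 1: "sat A (v(m := a)) (near_fm L cs r (Suc m) (Var m)) \<longleftrightarrow> a \<in> N" for a
    using Exi.prems im by (subst sat_near_fm[OF fin A]) (auto simp: less_Suc_eq)
  have 2: "sat A (v(m := a)) (relativize L cs r (Suc m) (\<rho>(x := m)) \<phi>) \<longleftrightarrow>
      sat (induced A N) ((v \<circ> \<rho>)(x := a)) \<phi>" if a: "a \<in> N" for a
  proof -
    have lt: "\<rho> y < m" if "y \<in> fv \<phi>" "y \<noteq> x" for y using that Exi.prems by auto
    have "sat A (v(m := a)) (relativize L cs r (Suc m) (\<rho>(x := m)) \<phi>) \<longleftrightarrow>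
      sat (induced A N) (v(m := a) \<circ> \<rho>(x := m)) \<phi>"
    proof (rule Exi.IH)
      show "wf_fm L \<phi>" using Exi.prems by simp
      show "(\<Union>c\<in>set cs. fv_trm c) \<subseteq> {..<Suc m}" using Exi.prems by fastforce
      show "(\<rho>(x := m)) ` fv \<phi> \<subseteq> {..<Suc m}" using lt by (auto simp: less_Suc_eq)
      show "eval_trm A (v(m := a)) ` set cs \<subseteq> verts A" using im Exi.prems by simp
      show "N = nbhd L A r (eval_trm A (v(m := a)) ` set cs)" using im Exi.prems by simp
      show "(v(m := a)) ` (\<rho>(x := m)) ` fv \<phi> \<subseteq> N"
        using Exi.prems(6) a by fastforce
    qed
    also have "\<dots> \<longleftrightarrow> sat (induced A N) ((v \<circ> \<rho>)(x := a)) \<phi>"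
      using lt by (intro sat_cong) fastforce
    finally show ?thesis .
  qed
  have "verts (induced A N) = N" by (simp add: induced_def)
  then show ?case unfolding relativize.simps sat.simps using 1 2 sub by blast
qed

lemma sat_same_struct:
  "same_struct L A B \<Longrightarrow> wf_fm L \<phi> \<Longrightarrow> sat A v \<phi> \<longleftrightarrow> sat B v \<phi>"
proof (induction \<phi> arbitrary: v)
  have t: "eval_trm A v t = eval_trm B v t" if "same_struct L A B" "wf_trm L t" for v t
    using that by (cases t) (auto simp: same_struct_def)
  { case (Rel S ts)
    have "map (eval_trm A v) ts = map (eval_trm B v) ts" using Rel by (auto intro: t)
    then have "map (eval_trm A v) ts \<in> rel A S \<longleftrightarrow> map (eval_trm B v) ts \<in> rel A S" by (simp only:)
    then show ?case using Rel by (simp add: same_struct_def)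
  next case (Eq s u) then show ?case by (simp add: t) }
qed (auto simp: same_struct_def)

text \<open>The trivial equations make all of \<open>ys\<close> occur freely: locality refers to the free variables.\<close>

definition ball_fm :: "'l language \<Rightarrow> nat \<Rightarrow> nat list \<Rightarrow> (nat \<Rightarrow> nat) \<Rightarrow> 'l fm \<Rightarrow> 'l fm" where
  "ball_fm L r ys \<rho> \<phi> = Conj (Conjs (map (\<lambda>y. Eq (Var y) (Var y)) ys))
     (relativize L (map Var ys @ map Cst (sorted_list_of_set (const_syms L))) r
       (Suc (sum_list ys)) \<rho> \<phi>)"

lemma fv_ball_fm: "\<rho> ` fv \<phi> \<subseteq> set ys \<Longrightarrow> fv (ball_fm L r ys \<rho> \<phi>) = set ys"
  using fv_relativize[of L "map Var ys @ map Cst (sorted_list_of_set (const_syms L))" r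
       "Suc (sum_list ys)" \<rho> \<phi>]
  by (simp add: ball_fm_def) blast

lemma sat_ball_fm:
  assumes fin: "finite (rel_syms L)" "finite (const_syms L)" and A: "is_struct L A"
    and wf: "wf_fm L \<phi>" and \<rho>: "\<rho> ` fv \<phi> \<subseteq> set ys" and v: "v ` set ys \<subseteq> verts A"
  shows "sat A v (ball_fm L r ys \<rho> \<phi>) \<longleftrightarrow>
    sat (induced A (nbhd L A r (v ` set ys \<union> cst A ` const_syms L))) (v \<circ> \<rho>) \<phi>"
proof -
  let ?cs = "map Var ys @ map Cst (sorted_list_of_set (const_syms L))"
  \<comment> \<open>The sum of the variable names bounds each of them, which makes
    \<open>Suc (sum_list ys)\<close> a fresh name.\<close>
  have lt: "y < Suc (sum_list ys)" if "y \<in> set ys" for y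
    using member_le_sum_list[OF that] by simp
  have im: "eval_trm A v ` set ?cs = v ` set ys \<union> cst A ` const_syms L"
    using fin by (simp add: image_Un image_image)
  have ne: "verts A \<noteq> {}" using A by (simp add: is_struct_def)
  have sup: "v ` set ys \<union> cst A ` const_syms L \<subseteq> nbhd L A r (v ` set ys \<union> cst A ` const_syms L)"
    by (rule nbhd_superset)
  have "sat A v (relativize L ?cs r (Suc (sum_list ys)) \<rho> \<phi>) \<longleftrightarrow>
    sat (induced A (nbhd L A r (v ` set ys \<union> cst A ` const_syms L))) (v \<circ> \<rho>) \<phi>"
    unfolding im[symmetric]
  proof (rule sat_relativize[OF fin(1) A wf _ _ _ refl])
    show "(\<Union>c\<in>set ?cs. fv_trm c) \<subseteq> {..<Suc (sum_list ys)}" using lt by auto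
    show "\<rho> ` fv \<phi> \<subseteq> {..<Suc (sum_list ys)}" using lt \<rho> by auto
    show "eval_trm A v ` set ?cs \<subseteq> verts A" unfolding im using v A by (auto simp: is_struct_def)
    show "v ` \<rho> ` fv \<phi> \<subseteq> nbhd L A r (eval_trm A v ` set ?cs)"
      unfolding im using sup \<rho> by blast
    show "cst A ` const_syms L \<subseteq> nbhd L A r (eval_trm A v ` set ?cs)"
      unfolding im using sup by blast
  qed
  then show ?thesis by (simp add: ball_fm_def sat_Conjs[OF ne])
qed

text \<open>Since the free variables are exactly \<open>ys\<close>, the neighborhood in
  \<open>sat_ball_fm\<close> is the one that \<open>nbhd_determined\<close> speaks of. For a
  language without constants, constant-local means local, so the lemma serves the base as well as
  the gadgets.\<close>

lemma ball_fm_constant_local: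
  assumes fin: "finite (rel_syms L)" "finite (const_syms L)"
    and wf: "wf_fm L \<phi>" and \<rho>: "\<rho> ` fv \<phi> \<subseteq> set ys"
  shows "ball_fm L r ys \<rho> \<phi> \<in> constant_local_fms L"
proof -
  have "wf_fm L (ball_fm L r ys \<rho> \<phi>)"
    using fin wf by (auto simp: ball_fm_def intro!: wf_relativize)
  moreover have "nbhd_determined L (const_syms L) r (ball_fm L r ys \<rho> \<phi>)"
    unfolding nbhd_determined_def fv_ball_fm[OF \<rho>]
  proof (intro allI impI)
    fix A B :: "('a, nat) fo_struct" and v
    assume A: "is_struct L A" and B: "is_struct L B" and v: "v ` set ys \<subseteq> verts A \<inter> verts B"
      and "same_struct (L\<lparr>const_syms := const_syms L\<rparr>)
          (induced A (nbhd L A r (v ` set ys \<union> cst A ` const_syms L)))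
          (induced B (nbhd L B r (v ` set ys \<union> cst B ` const_syms L)))"
    then have "same_struct L
          (induced A (nbhd L A r (v ` set ys \<union> cst A ` const_syms L)))
          (induced B (nbhd L B r (v ` set ys \<union> cst B ` const_syms L)))"
      by (simp add: same_struct_def)
    then show "sat A v (ball_fm L r ys \<rho> \<phi>) = sat B v (ball_fm L r ys \<rho> \<phi>)"
      using v sat_same_struct[OF _ wf]
      by (simp add: sat_ball_fm[OF fin A wf \<rho>] sat_ball_fm[OF fin B wf \<rho>])
  qed
  ultimately show ?thesis by (auto simp: constant_local_fms_def)
qed

subsection \<open>Invariance under isomorphism\<close>

definition iso_via :: "'l language \<Rightarrow> ('a \<Rightarrow> 'b) \<Rightarrow> ('l, 'a) fo_struct \<Rightarrow> ('l, 'b) fo_struct \<Rightarrow> bool" where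
  "iso_via L f A B \<longleftrightarrow> inj_on f (verts A) \<and> verts B = f ` verts A \<and>
     (\<forall>S\<in>rel_syms L. rel B S = map f ` rel A S) \<and> (\<forall>c\<in>const_syms L. cst B c = f (cst A c))"

lemma sat_iso:
  assumes A: "is_struct L A" and f: "iso_via L f A B"
    and "wf_fm L \<phi>" "v ` fv \<phi> \<subseteq> verts A"
  shows "sat B (f \<circ> v) \<phi> \<longleftrightarrow> sat A v \<phi>"
  using assms(3-)
proof (induction \<phi> arbitrary: v)
  have ev: "eval_trm B (f \<circ> v) t = f (eval_trm A v t)" if "wf_trm L t" for v t
    using that f by (cases t) (auto simp: iso_via_def)
  have evV: "eval_trm A v t \<in> verts A" if "wf_trm L t" "v ` fv_trm t \<subseteq> verts A" for v t
    using that A by (cases t) (auto simp: is_struct_def)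
  have inj: "inj_on f (verts A)" using f by (simp add: iso_via_def)
  {
    case (Rel S ts)
    then have S: "S \<in> rel_syms L" by simp
    have m: "map (eval_trm B (f \<circ> v)) ts = map f (map (eval_trm A v) ts)" using Rel ev by auto
    have V: "map (eval_trm A v) ts \<in> lists (verts A)"
    proof (clarsimp simp del: eval_trm.simps)
      fix t assume "t \<in> set ts"
      then show "eval_trm A v t \<in> verts A" using Rel.prems by (intro evV) auto
    qed
    have "rel A S \<subseteq> lists (verts A)" using A S by (auto simp: is_struct_def)
    then have "map f (map (eval_trm A v) ts) \<in> map f ` rel A S \<longleftrightarrow> map (eval_trm A v) ts \<in> rel A S"
      using inj_on_mapI[of f "lists (verts A)"] V
      by (intro inj_on_image_mem_iff[OF _ V]) (auto intro!: inj_on_mapI inj_on_subset[OF inj])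
    moreover have "rel B S = map f ` rel A S" using f S by (simp add: iso_via_def)
    ultimately show ?case by (simp only: sat.simps m)
  next
    case (Eq s t)
    have "eval_trm A v s \<in> verts A" "eval_trm A v t \<in> verts A"
      using Eq by (auto intro!: evV)
    then have "f (eval_trm A v s) = f (eval_trm A v t) \<longleftrightarrow> eval_trm A v s = eval_trm A v t"
      by (rule inj_on_eq_iff[OF inj])
    then show ?case using Eq.prems ev[of s v] ev[of t v] by (simp only: sat.simps wf_fm.simps)
  next
    case (Neg \<phi>)
    then show ?case by simp
  next
    case (Conj \<phi> \<psi>)
    then show ?case by (simp add: image_Un)
  next
    case (Exi x \<phi>)
    have "sat B ((f \<circ> v)(x := f a)) \<phi> \<longleftrightarrow> sat A (v(x := a)) \<phi>" if "a \<in> verts A" for a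
    proof -
      have "(f \<circ> v)(x := f a) = f \<circ> v(x := a)" by auto
      moreover have "(v(x := a)) ` fv \<phi> \<subseteq> verts A" using Exi.prems that by auto
      ultimately show ?thesis using Exi.IH[of "v(x := a)"] Exi.prems by (simp only: wf_fm.simps)
    qed
    moreover have "verts B = f ` verts A" using f by (simp add: iso_via_def)
    ultimately show ?case unfolding sat.simps by (simp only: bex_simps cong: bex_cong)
  }
qed

lemma stone_pairing_iso:
  assumes A: "is_struct L A" and f: "iso_via L f A B" and wf: "wf_fm L \<phi>"
  shows "stone_pairing \<phi> B = stone_pairing \<phi> A"
proof -
  have inj: "inj_on f (verts A)" and VB: "verts B = f ` verts A" using f by (auto simp: iso_via_def)
  have "bij_betw (\<lambda>v. restrict (f \<circ> v) (fv \<phi>)) {v \<in> fv \<phi> \<rightarrow>\<^sub>E verts A. sat A v \<phi>}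
      {v \<in> fv \<phi> \<rightarrow>\<^sub>E verts B. sat B v \<phi>}"
  proof (rule bij_betw_imageI)
    show "inj_on (\<lambda>v. restrict (f \<circ> v) (fv \<phi>)) {v \<in> fv \<phi> \<rightarrow>\<^sub>E verts A. sat A v \<phi>}"
    proof (rule inj_onI)
      fix v w assume v: "v \<in> {v \<in> fv \<phi> \<rightarrow>\<^sub>E verts A. sat A v \<phi>}"
        and w: "w \<in> {v \<in> fv \<phi> \<rightarrow>\<^sub>E verts A. sat A v \<phi>}"
        and eq: "restrict (f \<circ> v) (fv \<phi>) = restrict (f \<circ> w) (fv \<phi>)"
      have "v x = w x" if "x \<in> fv \<phi>" for x
      proof -
        have "f (v x) = f (w x)" using fun_cong[OF eq, of x] that by simp
        then show ?thesis using v w that inj_onD[OF inj] by blast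
      qed
      then show "v = w" using v w PiE_ext[of v "fv \<phi>" "\<lambda>_. verts A" w] by simp
    qed
    have s: "sat B (restrict (f \<circ> v) (fv \<phi>)) \<phi> \<longleftrightarrow> sat A v \<phi>" if "v \<in> fv \<phi> \<rightarrow>\<^sub>E verts A" for v
    proof -
      have "sat B (restrict (f \<circ> v) (fv \<phi>)) \<phi> \<longleftrightarrow> sat B (f \<circ> v) \<phi>" by (intro sat_cong) simp
      also have "\<dots> \<longleftrightarrow> sat A v \<phi>" using that by (intro sat_iso[OF A f wf]) auto
      finally show ?thesis .
    qed
    show "(\<lambda>v. restrict (f \<circ> v) (fv \<phi>)) ` {v \<in> fv \<phi> \<rightarrow>\<^sub>E verts A. sat A v \<phi>} =
        {v \<in> fv \<phi> \<rightarrow>\<^sub>E verts B. sat B v \<phi>}"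
    proof (intro equalityI subsetI)
      fix w assume "w \<in> (\<lambda>v. restrict (f \<circ> v) (fv \<phi>)) ` {v \<in> fv \<phi> \<rightarrow>\<^sub>E verts A. sat A v \<phi>}"
      then obtain v where v: "v \<in> fv \<phi> \<rightarrow>\<^sub>E verts A" "sat A v \<phi>" "w = restrict (f \<circ> v) (fv \<phi>)" by blast
      then have "w \<in> fv \<phi> \<rightarrow>\<^sub>E verts B" using VB by auto
      then show "w \<in> {v \<in> fv \<phi> \<rightarrow>\<^sub>E verts B. sat B v \<phi>}" using v s by blast
    next
      fix w assume w: "w \<in> {v \<in> fv \<phi> \<rightarrow>\<^sub>E verts B. sat B v \<phi>}"
      let ?v = "restrict (inv_into (verts A) f \<circ> w) (fv \<phi>)"
      have v: "?v \<in> fv \<phi> \<rightarrow>\<^sub>E verts A" using w VB PiE_mem[of w "fv \<phi>" "\<lambda>_. verts B"]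
        by (auto intro!: inv_into_into simp del: PiE_iff)
      have "restrict (f \<circ> ?v) (fv \<phi>) = w"
      proof
        fix x show "restrict (f \<circ> ?v) (fv \<phi>) x = w x"
          using w VB by (cases "x \<in> fv \<phi>") (auto intro!: f_inv_into_f)
      qed
      then show "w \<in> (\<lambda>v. restrict (f \<circ> v) (fv \<phi>)) ` {v \<in> fv \<phi> \<rightarrow>\<^sub>E verts A. sat A v \<phi>}"
        using v s[OF v] w by (intro image_eqI[of _ _ ?v]) auto
    qed
  qed
  moreover have "card (verts B) = card (verts A)" using VB card_image[OF inj] by simp
  ultimately show ?thesis by (simp add: stone_pairing_def bij_betw_same_card)
qed

lemma nbhd_iso:
  assumes A: "is_struct L A" and f: "iso_via L f A B" and X: "X \<subseteq> verts A"
  shows "nbhd L B r (f ` X) = f ` nbhd L A r X"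
proof (induction r)
  case (Suc r)
  have inj: "inj_on f (verts A)" and rel: "\<And>S. S \<in> rel_syms L \<Longrightarrow> rel B S = map f ` rel A S"
    using f by (auto simp: iso_via_def)
  have sub: "nbhd L A r X \<subseteq> verts A" by (rule nbhd_verts[OF A X])
  have tup: "set t \<subseteq> verts A" if "S \<in> rel_syms L" "t \<in> rel A S" for S t
    using that A by (auto simp: is_struct_def)
  show ?case
  proof (intro equalityI subsetI)
    fix b assume "b \<in> nbhd L B (Suc r) (f ` X)"
    then consider "b \<in> f ` nbhd L A r X" | a S t where "a \<in> nbhd L A r X" "S \<in> rel_syms L"
      "t \<in> rel A S" "f a \<in> f ` set t" "b \<in> f ` set t"
      unfolding nbhd_Suc Suc using rel by auto
    then show "b \<in> f ` nbhd L A (Suc r) X"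
    proof cases
      case 1
      then show ?thesis by (auto simp: nbhd_Suc)
    next
      case 2
      then have "a \<in> set t" using inj_on_image_mem_iff[OF inj _ tup[OF 2(2,3)]] sub by blast
      then show ?thesis using 2 nbhd_Suc_tuple[OF 2(1-3)] by blast
    qed
  next
    fix b assume "b \<in> f ` nbhd L A (Suc r) X"
    then consider "b \<in> f ` nbhd L A r X" | a S t where "a \<in> nbhd L A r X" "S \<in> rel_syms L"
      "t \<in> rel A S" "a \<in> set t" "b \<in> f ` set t"
      by (auto simp: nbhd_Suc)
    then show "b \<in> nbhd L B (Suc r) (f ` X)"
    proof cases
      case 1
      then show ?thesis by (auto simp: nbhd_Suc Suc)
    next
      case 2
      then show ?thesis using Suc rel[OF 2(2)]
        by (intro nbhd_Suc_tuple[of "f a" _ _ _ _ S "map f t"]) auto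
    qed
  qed
qed simp

text \<open>Locality was defined by structures on the natural numbers, whereas glued structures live
  on a sum type. Both structures are moved by one map that is injective on the union of their
  universes, so that the common neighborhood stays common.\<close>

lemma nbhd_determined_any_type:
  fixes A B :: "('l, 'c) fo_struct"
  assumes \<phi>: "nbhd_determined L {} r \<phi>" "wf_fm L \<phi>" and L: "const_syms L = {}"
    and A: "is_struct L A" and B: "is_struct L B" and v: "v ` fv \<phi> \<subseteq> verts A \<inter> verts B"
    and N: "nbhd L A r (v ` fv \<phi>) = N" "nbhd L B r (v ` fv \<phi>) = N"
    and rel: "\<And>S. S \<in> rel_syms L \<Longrightarrow> rel A S \<inter> lists N = rel B S \<inter> lists N"
  shows "sat A v \<phi> \<longleftrightarrow> sat B v \<phi>"
proof -
  have "finite (verts A \<union> verts B)" using A B by (simp add: is_struct_def)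
  then obtain f :: "'c \<Rightarrow> nat" where f: "inj_on f (verts A \<union> verts B)"
    using finite_imp_inj_to_nat_seg by metis
  let ?im = "\<lambda>C :: ('l, 'c) fo_struct. \<lparr>verts = f ` verts C, rel = \<lambda>S. map f ` rel C S, cst = f \<circ> cst C\<rparr>"
  have iso: "iso_via L f A (?im A)" "iso_via L f B (?im B)"
    using f by (auto simp: iso_via_def inj_on_Un)
  have str: "is_struct L (?im A)" "is_struct L (?im B)"
    using A B L is_structD[OF A] is_structD[OF B] by (fastforce simp: is_struct_def)+
  have vi: "(f \<circ> v) ` fv \<phi> = f ` v ` fv \<phi>" by auto
  have N': "nbhd L (?im A) r ((f \<circ> v) ` fv \<phi>) = f ` N" "nbhd L (?im B) r ((f \<circ> v) ` fv \<phi>) = f ` N"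
    unfolding vi using v nbhd_iso[OF A iso(1)] nbhd_iso[OF B iso(2)] N by auto
  have NA: "N \<subseteq> verts A" "N \<subseteq> verts B"
    using nbhd_verts[OF A, of "v ` fv \<phi>" r] nbhd_verts[OF B, of "v ` fv \<phi>" r] v N by auto
  have im: "map f ` rel C S \<inter> lists (f ` N) = map f ` (rel C S \<inter> lists N)"
    if C: "is_struct L C" "N \<subseteq> verts C" "verts C \<subseteq> verts A \<union> verts B" and S: "S \<in> rel_syms L" for C S
  proof -
    have "t \<in> lists N" if "t \<in> rel C S" "map f t \<in> lists (f ` N)" for t
    proof -
      have "set t \<subseteq> verts C" using C(1) S that(1) by (auto simp: is_struct_def)
      moreover have "inj_on f (verts C)" using f C(3) by (rule inj_on_subset)
      ultimately have "x \<in> N" if "x \<in> set t" for x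
        using inj_on_image_mem_iff[of f "verts C" x N] that C(2) \<open>map f t \<in> lists (f ` N)\<close> by auto
      then show ?thesis by auto
    qed
    then show ?thesis by auto
  qed
  have "same_struct (L\<lparr>const_syms := {}\<rparr>)
      (induced (?im A) (nbhd L (?im A) r ((f \<circ> v) ` fv \<phi> \<union> cst (?im A) ` {})))
      (induced (?im B) (nbhd L (?im B) r ((f \<circ> v) ` fv \<phi> \<union> cst (?im B) ` {})))"
    using N' im[OF A NA(1)] im[OF B NA(2)] rel by (simp add: same_struct_def induced_def)
  moreover have "(f \<circ> v) ` fv \<phi> \<subseteq> verts (?im A) \<inter> verts (?im B)" using v by auto
  ultimately have "sat (?im A) (f \<circ> v) \<phi> \<longleftrightarrow> sat (?im B) (f \<circ> v) \<phi>"
    using \<phi>(1) str unfolding nbhd_determined_def by blast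
  then show ?thesis using sat_iso[OF A iso(1) \<phi>(2)] sat_iso[OF B iso(2) \<phi>(2)] v by simp
qed

subsection \<open>A quotient-free model of the gadget construction\<close>

lemma base_language_simps [simp]:
  "rel_syms (base_language L R) = insert R (rel_syms L)"
  "arity (base_language L R) = arity L" "const_syms (base_language L R) = const_syms L"
  by (auto simp: base_language_def)

lemma gadget_language_simps [simp]:
  "rel_syms (gadget_language L R) = rel_syms L"
  "arity (gadget_language L R) = arity L" "const_syms (gadget_language L R) = {1..arity L R}"
  by (auto simp: gadget_language_def)

definition roots :: "'l language \<Rightarrow> 'l \<Rightarrow> ('l, 'b) fo_struct \<Rightarrow> 'b set" where
  "roots L R G = cst G ` {1..arity L R}"

text \<open>The canonical representative of the class of \<open>Inr (e, v)\<close>: a root is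
  replaced by the base vertex to which it is glued. Roots are counted from 1 and list positions from
  0.\<close>

definition attach :: "'l language \<Rightarrow> 'l \<Rightarrow> ('l, 'b) fo_struct \<Rightarrow> 'a list \<Rightarrow> 'b \<Rightarrow> 'a + 'a list \<times> 'b" where
  "attach L R G e v = (if v \<in> roots L R G
     then Inl (e ! (the_inv_into {1..arity L R} (cst G) v - 1)) else Inr (e, v))"

text \<open>Different edges may carry different gadgets, since the neighborhoods of a tuple meet their copies in
  different pieces.\<close>

definition glued :: "'l language \<Rightarrow> 'l \<Rightarrow> ('l, 'a) fo_struct \<Rightarrow> ('a list \<Rightarrow> ('l, 'b) fo_struct) \<Rightarrow>
    ('l, 'a + 'a list \<times> 'b) fo_struct" where
  "glued L R A GG = \<lparr>verts = Inl ` verts A \<union> Inr ` (SIGMA e:rel A R. verts (GG e) - roots L R (GG e)),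
     rel = (\<lambda>S. map Inl ` rel A S \<union>
       {map (attach L R (GG e) e) t | e t. e \<in> rel A R \<and> t \<in> rel (GG e) S}),
     cst = (\<lambda>_. undefined)\<rparr>"

lemma is_gadgetD:
  assumes "is_gadget L R G"
  shows "is_struct (gadget_language L R) G" "inj_on (cst G) {1..arity L R}" "roots L R G \<subseteq> verts G"
  using assms by (auto simp: is_gadget_def is_struct_def roots_def)

lemma attach_root:
  "is_gadget L R G \<Longrightarrow> i \<in> {1..arity L R} \<Longrightarrow> attach L R G e (cst G i) = Inl (e ! (i - 1))"
  using the_inv_into_f_f[of "cst G" "{1..arity L R}" i]
  by (auto simp: attach_def roots_def is_gadget_def)

lemma attach_nonroot: "v \<notin> roots L R G \<Longrightarrow> attach L R G e v = Inr (e, v)"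
  by (simp add: attach_def)

lemma attach_cases:
  assumes "is_gadget L R G"
  obtains i where "i \<in> {1..arity L R}" "v = cst G i" "attach L R G e v = Inl (e ! (i - 1))"
  | "v \<notin> roots L R G" "attach L R G e v = Inr (e, v)"
proof (cases "v \<in> roots L R G")
  case True
  then obtain i where "i \<in> {1..arity L R}" "v = cst G i" by (auto simp: roots_def)
  then show ?thesis using that(1) attach_root[OF assms] by blast
qed (auto intro: that(2) attach_nonroot)

lemma finite_rel:
  assumes A: "is_struct L A" and S: "S \<in> rel_syms L"
  shows "finite (rel A S)"
proof -
  have "finite {t. set t \<subseteq> verts A \<and> length t = arity L S}"
    using A by (intro finite_lists_length_eq) (simp add: is_struct_def)
  moreover have "rel A S \<subseteq> {t. set t \<subseteq> verts A \<and> length t = arity L S}"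
    using is_structD[OF A S] by auto
  ultimately show ?thesis by (rule rev_finite_subset)
qed

lemma glued_struct:
  assumes L: "const_syms L = {}" and A: "is_struct (base_language L R) A"
    and GG: "\<And>e. e \<in> rel A R \<Longrightarrow> is_gadget L R (GG e)"
  shows "is_struct L (glued L R A GG)"
proof -
  have finR: "finite (rel A R)" using finite_rel[OF A] by simp
  have finG: "finite (verts (GG e))" if "e \<in> rel A R" for e
    using GG[OF that] by (simp add: is_gadget_def is_struct_def)
  have "finite (verts (glued L R A GG))"
    using finR finG A by (auto simp: glued_def is_struct_def)
  moreover have "verts (glued L R A GG) \<noteq> {}" using A by (auto simp: glued_def is_struct_def)
  moreover have "t \<in> lists (verts (glued L R A GG)) \<and> length t = arity L S"
    if S: "S \<in> rel_syms L" and t: "t \<in> rel (glued L R A GG) S" for S t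
  proof -
    from t consider t' where "t' \<in> rel A S" "t = map Inl t'"
      | e t' where "e \<in> rel A R" "t' \<in> rel (GG e) S" "t = map (attach L R (GG e) e) t'"
      by (auto simp: glued_def)
    then show ?thesis
    proof cases
      case 1
      then show ?thesis using is_structD[OF A _ 1(1)] S by (auto 0 3 simp: glued_def)
    next
      case 2
      note G = GG[OF 2(1)]
      have t': "set t' \<subseteq> verts (GG e)" "length t' = arity L S"
        using is_structD[OF is_gadgetD(1)[OF G] _ 2(2)] S by auto
      have e: "set e \<subseteq> verts A" "length e = arity L R" using is_structD[OF A _ 2(1)] by auto
      have "attach L R (GG e) e v \<in> verts (glued L R A GG)" if "v \<in> set t'" for v
      proof (rule attach_cases[OF G, of v e])
        fix i assume i: "i \<in> {1..arity L R}" "attach L R (GG e) e v = Inl (e ! (i - 1))"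
        then have "e ! (i - 1) \<in> set e" using e(2) by (intro nth_mem) auto
        then show ?thesis using i e(1) by (auto simp: glued_def)
      next
        assume "v \<notin> roots L R (GG e)" "attach L R (GG e) e v = Inr (e, v)"
        then show ?thesis using that t' 2(1) by (auto simp: glued_def)
      qed
      then show ?thesis using 2(3) t'(2) by auto
    qed
  qed
  ultimately show ?thesis using L by (auto simp: is_struct_def)
qed

lemma card_glued:
  fixes A :: "('l, 'a) fo_struct" and G :: "('l, 'b) fo_struct"
  assumes A: "is_struct (base_language L R) A" and G: "is_gadget L R G"
  shows "card (verts (glued L R A (\<lambda>_. G))) =
    card (verts A) + card (rel A R) * (card (verts G) - arity L R)"
proof -
  have finR: "finite (rel A R)" using finite_rel[OF A] by simp
  have fin: "finite (verts A)" "finite (verts G)"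
    using A is_gadgetD(1)[OF G] by (auto simp: is_struct_def)
  have "card (roots L R G) = arity L R" unfolding roots_def
    using card_image[OF is_gadgetD(2)[OF G]] by simp
  moreover have "finite (roots L R G)" by (simp add: roots_def)
  ultimately have c: "card (verts G - roots L R G) = card (verts G) - arity L R"
    using card_Diff_subset[OF _ is_gadgetD(3)[OF G]] by simp
  have "card (verts (glued L R A (\<lambda>_. G))) =
      card (Inl ` verts A :: ('a + 'a list \<times> 'b) set) +
      card (Inr ` (rel A R \<times> (verts G - roots L R G)) :: ('a + 'a list \<times> 'b) set)"
    unfolding glued_def using fin finR by (simp, intro card_Un_disjoint) auto
  then show ?thesis by (simp add: card_image inj_on_def card_cartesian_product c)
qed

definition glue_nf :: "'l language \<Rightarrow> 'l \<Rightarrow> ('l, 'a) fo_struct \<Rightarrow> ('l, 'b) fo_struct \<Rightarrow>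
    'a + 'a list \<times> 'b \<Rightarrow> 'a + 'a list \<times> 'b" where
  "glue_nf L R A G x = (case x of Inl a \<Rightarrow> Inl a
     | Inr (e, v) \<Rightarrow> if e \<in> rel A R then attach L R G e v else Inr (e, v))"

text \<open>A glueing step preserves \<open>glue_nf\<close>, because the roots are pairwise distinct
  and a root thus determines its position in the edge. Conversely, every point either is its own
  normal form or is joined to it by a single glueing step.\<close>

lemma equivclp_glue_iff:
  assumes G: "is_gadget L R G"
  shows "equivclp (glue L R A G) x y \<longleftrightarrow> glue_nf L R A G x = glue_nf L R A G y"
proof
  assume "equivclp (glue L R A G) x y"
  then show "glue_nf L R A G x = glue_nf L R A G y"
  proof (induction rule: equivclp_induct)
    case (step y z)
    have "glue_nf L R A G a = glue_nf L R A G b" if ab: "glue L R A G a b" for a b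
    proof -
      obtain e i where "e \<in> rel A R" "i \<in> {1..arity L R}" "a = Inl (e ! (i - 1))" "b = Inr (e, cst G i)"
        using ab unfolding glue_def by blast
      then show ?thesis by (simp add: glue_nf_def attach_root[OF G, simplified])
    qed
    then show ?case using step by metis
  qed simp
next
  have nf: "equivclp (glue L R A G) x (glue_nf L R A G x)" for x
  proof (cases "glue_nf L R A G x = x")
    case False
    then obtain e v where x: "x = Inr (e, v)" "e \<in> rel A R" "attach L R G e v \<noteq> Inr (e, v)"
      by (auto simp: glue_nf_def split: sum.splits if_splits)
    then obtain i where i: "i \<in> {1..arity L R}" "v = cst G i" "attach L R G e v = Inl (e ! (i - 1))"
      using attach_cases[OF G, of v e] by metis
    have "glue L R A G (Inl (e ! (i - 1))) x" unfolding glue_def x(1) i(2) using x(2) i(1) by blast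
    then have "equivclp (glue L R A G) x (Inl (e ! (i - 1)))"
      by (metis equivclp_sym r_into_equivclp)
    then show ?thesis using x i by (simp add: glue_nf_def)
  qed simp
  assume "glue_nf L R A G x = glue_nf L R A G y"
  then show "equivclp (glue L R A G) x y" using nf[of x] nf[of y]
    by (metis equivclp_sym equivclp_trans)
qed

text \<open>The universe of the model consists of normal forms and contains the normal form of every
  point, so the class map is injective on it and reaches every class.\<close>

lemma glued_iso:
  assumes L: "const_syms L = {}"
    and A: "is_struct (base_language L R) A" and G: "is_gadget L R G"
  shows "iso_via L (glue_class L R A G) (glued L R A (\<lambda>_. G)) (gadget_construction L R A G)"
proof -
  let ?c = "glue_class L R A G" and ?nf = "glue_nf L R A G"
  have c: "?c x = {y. ?nf x = ?nf y}" for x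
    by (auto simp: glue_class_def glue_eq_def equivclp_glue_iff[OF G])
  have c_eq: "?c x = ?c y \<longleftrightarrow> ?nf x = ?nf y" for x y unfolding c by auto
  have nf_id: "?nf x = x" if "x \<in> verts (glued L R A (\<lambda>_. G))" for x
    using that by (auto simp: glued_def glue_nf_def attach_nonroot)
  have inj: "inj_on ?c (verts (glued L R A (\<lambda>_. G)))"
    using nf_id by (auto simp: inj_on_def c_eq)
  have nfv: "?nf x \<in> verts (glued L R A (\<lambda>_. G))" "?nf (?nf x) = ?nf x"
    if x: "x \<in> verts A <+> rel A R \<times> verts G" for x
  proof -
    show 1: "?nf x \<in> verts (glued L R A (\<lambda>_. G))"
    proof (cases x)
      case (Inl a)
      then show ?thesis using x by (auto simp: glue_nf_def glued_def)
    next
      case (Inr p)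
      then obtain e v where ev: "x = Inr (e, v)" "e \<in> rel A R" "v \<in> verts G" using x by (cases p) auto
      have e: "set e \<subseteq> verts A" "length e = arity L R" using is_structD[OF A _ ev(2)] by auto
      show ?thesis
      proof (rule attach_cases[OF G, of v e])
        fix i assume i: "i \<in> {1..arity L R}" "attach L R G e v = Inl (e ! (i - 1))"
        then have "e ! (i - 1) \<in> set e" using e(2) by (intro nth_mem) auto
        then show ?thesis using ev i e by (auto simp: glue_nf_def glued_def)
      next
        assume "v \<notin> roots L R G" "attach L R G e v = Inr (e, v)"
        then show ?thesis using ev by (auto simp: glue_nf_def glued_def)
      qed
    qed
    show "?nf (?nf x) = ?nf x" using nf_id[OF 1] .
  qed
  have "verts (gadget_construction L R A G) = ?c ` (verts A <+> rel A R \<times> verts G)"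
    by (auto simp: gadget_construction_def quotient_def glue_class_def)
  also have "\<dots> = ?c ` verts (glued L R A (\<lambda>_. G))"
  proof (intro equalityI subsetI)
    fix X assume "X \<in> ?c ` (verts A <+> rel A R \<times> verts G)"
    then obtain x where "x \<in> verts A <+> rel A R \<times> verts G" "X = ?c x" by blast
    then have "X = ?c (?nf x)" "?nf x \<in> verts (glued L R A (\<lambda>_. G))" using nfv c_eq by auto
    then show "X \<in> ?c ` verts (glued L R A (\<lambda>_. G))" by blast
  next
    have "verts (glued L R A (\<lambda>_. G)) \<subseteq> verts A <+> rel A R \<times> verts G" by (auto simp: glued_def)
    then show "X \<in> ?c ` (verts A <+> rel A R \<times> verts G)"
      if "X \<in> ?c ` verts (glued L R A (\<lambda>_. G))" for X using that by blast
  qed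
  finally have V: "verts (gadget_construction L R A G) = ?c ` verts (glued L R A (\<lambda>_. G))" .
  have att: "?c (Inr (e, v)) = ?c (attach L R G e v)" if e: "e \<in> rel A R" for e v
  proof -
    have "?nf (attach L R G e v) = attach L R G e v"
      by (rule attach_cases[OF G, of v e]) (auto simp: glue_nf_def)
    then show ?thesis using e by (simp add: c_eq) (simp add: glue_nf_def)
  qed
  have R: "rel (gadget_construction L R A G) S = map ?c ` rel (glued L R A (\<lambda>_. G)) S" for S
  proof -
    have m: "map (\<lambda>v. ?c (Inr (e, v))) t = map ?c (map (attach L R G e) t)" if "e \<in> rel A R" for e t
      using att[OF that] by simp
    have "{map (\<lambda>v. ?c (Inr (e, v))) t | e t. e \<in> rel A R \<and> t \<in> rel G S} =
      map ?c ` {map (attach L R G e) t | e t. e \<in> rel A R \<and> t \<in> rel G S}" (is "?l = ?r")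
    proof (intro equalityI subsetI)
      fix X assume "X \<in> ?l"
      then obtain e t where "X = map (\<lambda>v. ?c (Inr (e, v))) t" "e \<in> rel A R" "t \<in> rel G S" by blast
      then show "X \<in> ?r" using m[of e t] by blast
    next
      fix X assume "X \<in> ?r"
      then obtain e t where "X = map ?c (map (attach L R G e) t)" "e \<in> rel A R" "t \<in> rel G S" by blast
      then show "X \<in> ?l" using m[of e t, symmetric] by blast
    qed
    moreover have "{map (\<lambda>a. ?c (Inl a)) t | t. t \<in> rel A S} = map ?c ` map Inl ` rel A S"
      by (force simp: image_image comp_def)
    ultimately show ?thesis by (simp add: gadget_construction_def glued_def image_Un)
  qed
  show ?thesis using inj V R L by (auto simp: iso_via_def)
qed

subsection \<open>A decomposition of satisfaction in glued structures\<close>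

text \<open>A tuple of vertices of a glued structure is described by a shape \<open>s\<close>: \<open>s x = None\<close> means that
  \<open>x\<close> is a base vertex, \<open>s x = Some j\<close> that \<open>x\<close> is a non-root vertex of the copy over the edge
  named \<open>j\<close>. A valuation of the base structure assigns to \<open>base_var x\<close> the base vertex \<open>x\<close> and to
  \<open>edge_var i j\<close> the \<open>i\<close>-th entry of the edge \<open>j\<close>, counting from 1.\<close>

definition base_var :: "nat \<Rightarrow> nat" where
  "base_var x = prod_encode (0, x)"

definition edge_var :: "nat \<Rightarrow> nat \<Rightarrow> nat" where
  "edge_var i j = prod_encode (i, j)"

lemma base_var_eq [simp]: "base_var x = base_var y \<longleftrightarrow> x = y"
  by (simp add: base_var_def)

lemma edge_var_eq [simp]: "edge_var i j = edge_var i' j' \<longleftrightarrow> i = i' \<and> j = j'"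
  by (simp add: edge_var_def)

text \<open>Position 0 in the pairing is reserved for base vertices; entries of edges start at
  position 1.\<close>

lemma base_var_neq_edge_var: "1 \<le> i \<Longrightarrow> base_var x \<noteq> edge_var i j" "1 \<le> i \<Longrightarrow> edge_var i j \<noteq> base_var x"
  by (auto simp: base_var_def edge_var_def)

definition edge :: "nat \<Rightarrow> (nat \<Rightarrow> 'a) \<Rightarrow> nat \<Rightarrow> 'a list" where
  "edge k v j = map (\<lambda>i. v (edge_var i j)) [1..<Suc k]"

lemma length_edge [simp]: "length (edge k v j) = k"
  by (simp add: edge_def del: upt_Suc)

lemma edge_nth: "i \<in> {1..k} \<Longrightarrow> edge k v j ! (i - 1) = v (edge_var i j)"
  by (auto simp: edge_def simp del: upt_Suc)

lemma set_edge: "set (edge k v j) = (\<lambda>i. v (edge_var i j)) ` {1..k}"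
  by (auto simp: edge_def simp del: upt_Suc)

lemma edge_eq_iff: "edge k v j = edge k v' j' \<longleftrightarrow> (\<forall>i\<in>{1..k}. v (edge_var i j) = v' (edge_var i j'))"
  by (auto simp: edge_def simp del: upt_Suc)

definition upd_edge :: "(nat \<Rightarrow> 'a) \<Rightarrow> nat \<Rightarrow> 'a list \<Rightarrow> nat \<Rightarrow> 'a" where
  "upd_edge v j e z = (case prod_decode z of (i, j') \<Rightarrow>
     if j' = j \<and> 1 \<le> i \<and> i \<le> length e then e ! (i - 1) else v z)"

lemma upd_edge_base_var [simp]: "upd_edge v j e (base_var x) = v (base_var x)"
  by (simp add: upd_edge_def base_var_def)

lemma upd_edge_edge_var: "upd_edge v j e (edge_var i j') =
    (if j' = j \<and> 1 \<le> i \<and> i \<le> length e then e ! (i - 1) else v (edge_var i j'))"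
  by (simp add: upd_edge_def edge_var_def)

lemma edge_upd_edge:
  "length e = k \<Longrightarrow> edge k (upd_edge v j e) j' = (if j' = j then e else edge k v j')"
  by (rule nth_equalityI) (auto simp: edge_def upd_edge_edge_var simp del: upt_Suc)

lemma edge_upd_base_var [simp]: "edge k (v(base_var x := a)) = edge k v"
  by (auto simp: edge_def base_var_neq_edge_var simp del: upt_Suc)

section \<open>Configurations and properties decided by finitely many formulas\<close>

record ('l, 'a, 'b) conf =
  base :: "('l, 'a) fo_struct"
  gadgets :: "'a list \<Rightarrow> ('l, 'b) fo_struct"
  default :: "('l, 'b) fo_struct"
  bval :: "nat \<Rightarrow> 'a"
  gval :: "nat \<Rightarrow> 'b"

definition gadget_of :: "nat \<Rightarrow> ('l, 'a, 'b) conf \<Rightarrow> nat \<Rightarrow> ('l, 'b) fo_struct" where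
  "gadget_of k c j = gadgets c (edge k (bval c) j)"

lemma gadget_of_upd [simp]:
  "gadget_of k (c\<lparr>bval := (bval c)(base_var x := a)\<rparr>) = gadget_of k c"
  "gadget_of k (c\<lparr>gval := w\<rparr>) = gadget_of k c"
  by (auto simp: gadget_of_def)

definition point :: "nat \<Rightarrow> (nat \<Rightarrow> nat option) \<Rightarrow> ('l, 'a, 'b) conf \<Rightarrow> nat \<Rightarrow> 'a + 'a list \<times> 'b" where
  "point k s c x = (case s x of None \<Rightarrow> Inl (bval c (base_var x))
     | Some j \<Rightarrow> Inr (edge k (bval c) j, gval c x))"

definition conf_glued :: "'l language \<Rightarrow> 'l \<Rightarrow> ('l, 'a, 'b) conf \<Rightarrow> ('l, 'a + 'a list \<times> 'b) fo_struct" where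
  "conf_glued L R c = glued L R (base c) (gadgets c)"

definition base_vars :: "nat \<Rightarrow> nat set \<Rightarrow> nat set \<Rightarrow> (nat \<Rightarrow> nat option) \<Rightarrow> nat set" where
  "base_vars k X J s = base_var ` {x \<in> X. s x = None} \<union> (\<Union>j\<in>J. (\<lambda>i. edge_var i j) ` {1..k})"

definition class_vars :: "nat set \<Rightarrow> (nat \<Rightarrow> nat option) \<Rightarrow> nat \<Rightarrow> nat set" where
  "class_vars X s j = {x \<in> X. s x = Some j}"

text \<open>Different names in \<open>J\<close> denote different edges, so the shape alone tells
  whether two entries lie in the same copy. All unnamed edges carry the \<open>default\<close>
  gadget: they cannot be told apart by what is glued to them, and a quantifier over them stays
  within reach of finitely many formulas.\<close>

definition is_conf :: "'l language \<Rightarrow> 'l \<Rightarrow> nat set \<Rightarrow> nat set \<Rightarrow> (nat \<Rightarrow> nat option) \<Rightarrow>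
    ('l, 'a, 'b) conf \<Rightarrow> bool" where
  "is_conf L R X J s c \<longleftrightarrow> is_struct (base_language L R) (base c) \<and>
     (\<forall>e\<in>rel (base c) R. is_gadget L R (gadgets c e)) \<and> is_gadget L R (default c) \<and>
     (\<forall>j\<in>J. edge (arity L R) (bval c) j \<in> rel (base c) R) \<and> inj_on (edge (arity L R) (bval c)) J \<and>
     (\<forall>e\<in>rel (base c) R - edge (arity L R) (bval c) ` J. gadgets c e = default c) \<and>
     (\<forall>x\<in>X. case s x of None \<Rightarrow> bval c (base_var x) \<in> verts (base c)
        | Some j \<Rightarrow> j \<in> J \<and> gval c x \<in> verts (gadget_of (arity L R) c j) - roots L R (gadget_of (arity L R) c j))"

definition agree :: "'l fm set \<Rightarrow> ('l, 'a) fo_struct \<Rightarrow> (nat \<Rightarrow> 'a) \<Rightarrow> ('l, 'a) fo_struct \<Rightarrow> (nat \<Rightarrow> 'a) \<Rightarrow> bool" where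
  "agree F A v A' v' \<longleftrightarrow> (\<forall>\<alpha>\<in>F. sat A v \<alpha> \<longleftrightarrow> sat A' v' \<alpha>)"

definition conf_agree :: "nat \<Rightarrow> nat set \<Rightarrow> 'l fm set \<Rightarrow> (nat \<Rightarrow> 'l fm set) \<Rightarrow> 'l fm set \<Rightarrow>
    ('l, 'a, 'b) conf \<Rightarrow> ('l, 'a, 'b) conf \<Rightarrow> bool" where
  "conf_agree k J F \<Gamma> \<Gamma>0 c c' \<longleftrightarrow> agree F (base c) (bval c) (base c') (bval c') \<and>
     (\<forall>j\<in>J. agree (\<Gamma> j) (gadget_of k c j) (gval c) (gadget_of k c' j) (gval c')) \<and>
     agree \<Gamma>0 (default c) (gval c) (default c') (gval c')"

definition fms_over :: "'l language \<Rightarrow> nat set \<Rightarrow> 'l fm set \<Rightarrow> bool" where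
  "fms_over L W F \<longleftrightarrow> finite F \<and> (\<forall>\<alpha>\<in>F. wf_fm L \<alpha> \<and> fv \<alpha> \<subseteq> W)"

definition deciding :: "'l language \<Rightarrow> 'l \<Rightarrow> nat set \<Rightarrow> nat set \<Rightarrow> (nat \<Rightarrow> nat option) \<Rightarrow>
    'l fm set \<Rightarrow> (nat \<Rightarrow> 'l fm set) \<Rightarrow> 'l fm set \<Rightarrow> bool" where
  "deciding L R X J s F \<Gamma> \<Gamma>0 \<longleftrightarrow> fms_over (base_language L R) (base_vars (arity L R) X J s) F \<and>
     (\<forall>j\<in>J. fms_over (gadget_language L R) (class_vars X s j) (\<Gamma> j)) \<and>
     fms_over (gadget_language L R) {} \<Gamma>0"

text \<open>The Feferman-Vaught property, stated as transfer between agreeing configurations instead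
  of by an explicit Boolean combination. Agreement is symmetric, so the one implication
  \<open>P c \<longrightarrow> P c'\<close> gives an equivalence.\<close>

definition decided :: "'l language \<Rightarrow> 'l \<Rightarrow> nat set \<Rightarrow> nat set \<Rightarrow> (nat \<Rightarrow> nat option) \<Rightarrow>
    (('l, 'a, 'b) conf \<Rightarrow> bool) \<Rightarrow> bool" where
  "decided L R X J s P \<longleftrightarrow> (\<exists>F \<Gamma> \<Gamma>0. deciding L R X J s F \<Gamma> \<Gamma>0 \<and>
     (\<forall>c c'. is_conf L R X J s c \<longrightarrow> is_conf L R X J s c' \<longrightarrow>
        conf_agree (arity L R) J F \<Gamma> \<Gamma>0 c c' \<longrightarrow> P c \<longrightarrow> P c'))"

lemma agree_sym: "agree F A v A' v' \<Longrightarrow> agree F A' v' A v"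
  by (simp add: agree_def)

lemma agree_Un [simp]: "agree (F \<union> F') A v A' v' \<longleftrightarrow> agree F A v A' v' \<and> agree F' A v A' v'"
  by (auto simp: agree_def)

lemma fms_over_Un [simp]: "fms_over L W (F \<union> F') \<longleftrightarrow> fms_over L W F \<and> fms_over L W F'"
  by (auto simp: fms_over_def)

lemma fms_over_mono: "fms_over L W F \<Longrightarrow> W \<subseteq> W' \<Longrightarrow> fms_over L W' F"
  by (auto simp: fms_over_def)

lemma conf_agree_sym: "conf_agree k J F \<Gamma> \<Gamma>0 c c' \<Longrightarrow> conf_agree k J F \<Gamma> \<Gamma>0 c' c"
  by (simp add: conf_agree_def agree_sym)

lemma decidedI:
  assumes "deciding L R X J s F \<Gamma> \<Gamma>0"
    and "\<And>c c'. is_conf L R X J s c \<Longrightarrow> is_conf L R X J s c' \<Longrightarrow>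
      conf_agree (arity L R) J F \<Gamma> \<Gamma>0 c c' \<Longrightarrow> P c \<Longrightarrow> P c'"
  shows "decided L R X J s P"
  using assms unfolding decided_def by blast

lemma decidedE:
  assumes "decided L R X J s P"
  obtains F \<Gamma> \<Gamma>0 where "deciding L R X J s F \<Gamma> \<Gamma>0"
    and "\<And>c c'. is_conf L R X J s c \<Longrightarrow> is_conf L R X J s c' \<Longrightarrow>
      conf_agree (arity L R) J F \<Gamma> \<Gamma>0 c c' \<Longrightarrow> P c \<Longrightarrow> P c'"
  using assms unfolding decided_def by blast

lemma decided_cong:
  assumes "decided L R X J s P" "\<And>c. is_conf L R X J s c \<Longrightarrow> P c \<longleftrightarrow> Q c"
  shows "decided L R X J s Q"
  using assms(1)
proof (rule decidedE)
  fix F \<Gamma> \<Gamma>0 assume "deciding L R X J s F \<Gamma> \<Gamma>0"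
    and "\<And>c c'. is_conf L R X J s c \<Longrightarrow> is_conf L R X J s c' \<Longrightarrow>
      conf_agree (arity L R) J F \<Gamma> \<Gamma>0 c c' \<Longrightarrow> P c \<Longrightarrow> P c'"
  then show ?thesis using assms(2) by (intro decidedI) blast+
qed

lemma decided_const: "decided L R X J s (\<lambda>_. b)"
  by (rule decidedI[of _ _ _ _ _ "{}" "\<lambda>_. {}" "{}"]) (auto simp: deciding_def fms_over_def)

lemma decided_not:
  assumes "decided L R X J s P"
  shows "decided L R X J s (\<lambda>c. \<not> P c)"
  using assms
proof (rule decidedE)
  fix F \<Gamma> \<Gamma>0 assume "deciding L R X J s F \<Gamma> \<Gamma>0"
    and "\<And>c c'. is_conf L R X J s c \<Longrightarrow> is_conf L R X J s c' \<Longrightarrow>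
      conf_agree (arity L R) J F \<Gamma> \<Gamma>0 c c' \<Longrightarrow> P c \<Longrightarrow> P c'"
  then show ?thesis by (intro decidedI) (blast dest: conf_agree_sym)+
qed

lemma decided_conj:
  assumes "decided L R X J s P" "decided L R X J s Q"
  shows "decided L R X J s (\<lambda>c. P c \<and> Q c)"
proof -
  obtain F \<Gamma> \<Gamma>0 where 1: "deciding L R X J s F \<Gamma> \<Gamma>0"
    and P: "\<And>c c'. is_conf L R X J s c \<Longrightarrow> is_conf L R X J s c' \<Longrightarrow>
      conf_agree (arity L R) J F \<Gamma> \<Gamma>0 c c' \<Longrightarrow> P c \<Longrightarrow> P c'"
    using assms(1) unfolding decided_def by blast
  obtain F' \<Gamma>' \<Gamma>0' where 2: "deciding L R X J s F' \<Gamma>' \<Gamma>0'"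
    and Q: "\<And>c c'. is_conf L R X J s c \<Longrightarrow> is_conf L R X J s c' \<Longrightarrow>
      conf_agree (arity L R) J F' \<Gamma>' \<Gamma>0' c c' \<Longrightarrow> Q c \<Longrightarrow> Q c'"
    using assms(2) unfolding decided_def by blast
  show ?thesis
  proof (rule decidedI[of _ _ _ _ _ "F \<union> F'" "\<lambda>j. \<Gamma> j \<union> \<Gamma>' j" "\<Gamma>0 \<union> \<Gamma>0'"])
    show "deciding L R X J s (F \<union> F') (\<lambda>j. \<Gamma> j \<union> \<Gamma>' j) (\<Gamma>0 \<union> \<Gamma>0')"
      using 1 2 by (simp add: deciding_def)
    fix c c' assume "is_conf L R X J s c" "is_conf L R X J s c'"
      "conf_agree (arity L R) J (F \<union> F') (\<lambda>j. \<Gamma> j \<union> \<Gamma>' j) (\<Gamma>0 \<union> \<Gamma>0') c c'" "P c \<and> Q c"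
    then show "P c' \<and> Q c'" using P[of c c'] Q[of c c'] by (simp add: conf_agree_def)
  qed
qed

lemma decided_disj:
  assumes "decided L R X J s P" "decided L R X J s Q"
  shows "decided L R X J s (\<lambda>c. P c \<or> Q c)"
  using decided_not[OF decided_conj[OF decided_not[OF assms(1)] decided_not[OF assms(2)]]] by simp

lemma decided_bex:
  assumes "finite I" "\<And>i. i \<in> I \<Longrightarrow> decided L R X J s (P i)"
  shows "decided L R X J s (\<lambda>c. \<exists>i\<in>I. P i c)"
  using assms by (induction I) (auto intro: decided_const decided_disj)

lemma decided_base:
  assumes "wf_fm (base_language L R) \<alpha>" "fv \<alpha> \<subseteq> base_vars (arity L R) X J s"
  shows "decided L R X J s (\<lambda>c. sat (base c) (bval c) \<alpha>)"
  by (rule decidedI[of _ _ _ _ _ "{\<alpha>}" "\<lambda>_. {}" "{}"])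
    (use assms in \<open>auto simp: deciding_def fms_over_def conf_agree_def agree_def\<close>)

lemma decided_gadget:
  assumes "wf_fm (gadget_language L R) \<gamma>" "fv \<gamma> \<subseteq> class_vars X s j" "j \<in> J"
  shows "decided L R X J s (\<lambda>c. sat (gadget_of (arity L R) c j) (gval c) \<gamma>)"
  by (rule decidedI[of _ _ _ _ _ "{}" "\<lambda>i. if i = j then {\<gamma>} else {}" "{}"])
    (use assms in \<open>auto simp: deciding_def fms_over_def conf_agree_def agree_def\<close>)

section \<open>Transfer of quantifiers along types\<close>

definition pattern :: "'l fm set \<Rightarrow> 'l fm set \<Rightarrow> 'l fm" where
  "pattern F T = Conjs (map (\<lambda>\<alpha>. if \<alpha> \<in> T then \<alpha> else Neg \<alpha>) (SOME \<alpha>s. set \<alpha>s = F))"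

lemma pattern:
  assumes "fms_over L W F"
  shows "wf_fm L (pattern F T)" "fv (pattern F T) \<subseteq> W"
    "verts A \<noteq> {} \<Longrightarrow> sat A v (pattern F T) \<longleftrightarrow> (\<forall>\<alpha>\<in>F. \<alpha> \<in> T \<longleftrightarrow> sat A v \<alpha>)"
proof -
  have "\<exists>\<alpha>s. set \<alpha>s = F" using assms finite_list[of F] by (simp add: fms_over_def)
  then have F: "set (SOME \<alpha>s. set \<alpha>s = F) = F" by (rule someI_ex)
  show "wf_fm L (pattern F T)" "fv (pattern F T) \<subseteq> W"
    using assms F by (auto simp: pattern_def fms_over_def split: if_splits)
  assume ne: "verts A \<noteq> {}"
  have "sat A v (pattern F T) \<longleftrightarrow> (\<forall>\<alpha>\<in>F. sat A v (if \<alpha> \<in> T then \<alpha> else Neg \<alpha>))"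
    by (simp only: pattern_def sat_Conjs[OF ne] set_map F ball_simps)
  then show "sat A v (pattern F T) \<longleftrightarrow> (\<forall>\<alpha>\<in>F. \<alpha> \<in> T \<longleftrightarrow> sat A v \<alpha>)" by auto
qed

text \<open>One back-and-forth step. The \<open>F\<close>-type of the extended valuation
  \<open>w\<close> is expressed by a single formula \<open>pattern F T\<close>; agreement on the
  existential closures of all patterns therefore provides an extension of the same type on the other
  side.\<close>

lemma exists_agreeing:
  assumes F: "fms_over L W F" and ne: "verts A \<noteq> {}" "verts A' \<noteq> {}"
    and ag: "agree ((\<lambda>T. Exis xs (pattern F T)) ` Pow F) A v A' v'"
    and w: "\<And>x. x \<notin> set xs \<Longrightarrow> w x = v x" "\<And>x. x \<in> set xs \<Longrightarrow> w x \<in> verts A"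
  obtains w' where "\<And>x. x \<notin> set xs \<Longrightarrow> w' x = v' x" "\<And>x. x \<in> set xs \<Longrightarrow> w' x \<in> verts A'"
    "agree F A w A' w'"
proof -
  let ?T = "{\<alpha> \<in> F. sat A w \<alpha>}"
  have "sat A w (pattern F ?T)" using pattern(3)[OF F ne(1), of w ?T] by auto
  then have "sat A v (Exis xs (pattern F ?T))" unfolding sat_Exis using w by blast
  then have "sat A' v' (Exis xs (pattern F ?T))" using ag by (auto simp: agree_def)
  then obtain w' where w': "\<forall>x. x \<notin> set xs \<longrightarrow> w' x = v' x" "\<forall>x\<in>set xs. w' x \<in> verts A'"
      "sat A' w' (pattern F ?T)" unfolding sat_Exis by blast
  have "agree F A w A' w'"
    using w'(3) unfolding pattern(3)[OF F ne(2)] agree_def by blast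
  then show thesis using w' that by blast
qed

lemma fms_over_Exis:
  "fms_over L W F \<Longrightarrow> W - set xs \<subseteq> W' \<Longrightarrow> fms_over L W' ((\<lambda>T. Exis xs (pattern F T)) ` Pow F)"
  using pattern(1,2)[of L W F] unfolding fms_over_def by auto

lemma is_conf_ne:
  assumes "is_conf L R X J s c"
  shows "verts (base c) \<noteq> {}" "j \<in> J \<Longrightarrow> verts (gadget_of (arity L R) c j) \<noteq> {}"
    "j \<in> J \<Longrightarrow> is_gadget L R (gadget_of (arity L R) c j)"
  using assms by (auto simp: is_conf_def is_struct_def is_gadget_def gadget_of_def)

text \<open>Choosing a base vertex affects the base valuation only. Hence \<open>F\<close> is
  replaced by the existential closures of its patterns, and the families for the gadgets are
  kept.\<close>

lemma decided_ex_base: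
  assumes "decided L R (insert x X) J (s(x := None)) P"
  shows "decided L R X J s (\<lambda>c. \<exists>a\<in>verts (base c). P (c\<lparr>bval := (bval c)(base_var x := a)\<rparr>))"
proof -
  let ?k = "arity L R" and ?X = "insert x X" and ?s = "s(x := None)"
  obtain F \<Gamma> \<Gamma>0 where d: "deciding L R ?X J ?s F \<Gamma> \<Gamma>0"
    and P: "\<And>c c'. is_conf L R ?X J ?s c \<Longrightarrow> is_conf L R ?X J ?s c' \<Longrightarrow>
      conf_agree ?k J F \<Gamma> \<Gamma>0 c c' \<Longrightarrow> P c \<Longrightarrow> P c'"
    using assms unfolding decided_def by blast
  let ?F = "(\<lambda>T. Exis [base_var x] (pattern F T)) ` Pow F"
  have F: "fms_over (base_language L R) (base_vars ?k ?X J ?s) F" using d by (simp add: deciding_def)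
  show ?thesis
  proof (rule decidedI[of _ _ _ _ _ ?F \<Gamma> \<Gamma>0])
    have bv: "base_vars ?k ?X J ?s - set [base_var x] \<subseteq> base_vars ?k X J s"
      by (auto simp: base_vars_def)
    have "class_vars ?X ?s j \<subseteq> class_vars X s j" for j by (auto simp: class_vars_def)
    then have "\<forall>j\<in>J. fms_over (gadget_language L R) (class_vars X s j) (\<Gamma> j)"
      using d by (auto simp: deciding_def intro: fms_over_mono)
    then show "deciding L R X J s ?F \<Gamma> \<Gamma>0"
      using d fms_over_Exis[OF F bv] by (simp only: deciding_def)
    fix c c' assume c: "is_conf L R X J s c" and c': "is_conf L R X J s c'"
      and ag: "conf_agree ?k J ?F \<Gamma> \<Gamma>0 c c'"
      and "\<exists>a\<in>verts (base c). P (c\<lparr>bval := (bval c)(base_var x := a)\<rparr>)"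
    then obtain a where a: "a \<in> verts (base c)" "P (c\<lparr>bval := (bval c)(base_var x := a)\<rparr>)" by blast
    obtain w where w: "\<And>y. y \<notin> set [base_var x] \<Longrightarrow> w y = bval c' y"
        "\<And>y. y \<in> set [base_var x] \<Longrightarrow> w y \<in> verts (base c')"
        "agree F (base c) ((bval c)(base_var x := a)) (base c') w"
      by (rule exists_agreeing[OF F is_conf_ne(1)[OF c] is_conf_ne(1)[OF c'],
            of "[base_var x]" "bval c" "bval c'" "(bval c)(base_var x := a)"])
        (use ag a in \<open>auto simp: conf_agree_def\<close>)
    define a' where "a' = w (base_var x)"
    have weq: "w = (bval c')(base_var x := a')" using w(1) by (auto simp: a'_def)
    have a': "a' \<in> verts (base c')" using w(2) by (simp add: a'_def)
    have conf: "is_conf L R ?X J ?s (d\<lparr>bval := (bval d)(base_var x := b)\<rparr>)"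
      if "is_conf L R X J s d" "b \<in> verts (base d)" for d :: "('a, 'b, 'c) conf" and b
      using that by (auto simp: is_conf_def split: option.splits)
    have "conf_agree ?k J F \<Gamma> \<Gamma>0 (c\<lparr>bval := (bval c)(base_var x := a)\<rparr>)
        (c'\<lparr>bval := (bval c')(base_var x := a')\<rparr>)"
      using ag w(3) unfolding weq by (simp add: conf_agree_def)
    then have "P (c'\<lparr>bval := (bval c')(base_var x := a')\<rparr>)"
      using P[OF conf[OF c a(1)] conf[OF c' a']] a(2) by blast
    then show "\<exists>a\<in>verts (base c'). P (c'\<lparr>bval := (bval c')(base_var x := a)\<rparr>)"
      using a' by blast
  qed
qed

definition nonroot_fm :: "nat \<Rightarrow> nat \<Rightarrow> 'l fm" where
  "nonroot_fm k x = Conjs (map (\<lambda>i. Neg (Eq (Var x) (Cst i))) [1..<Suc k])"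

lemma nonroot_fm:
  "wf_fm (gadget_language L R) (nonroot_fm (arity L R) x)" "fv (nonroot_fm k x) \<subseteq> {x}"
  "verts G \<noteq> {} \<Longrightarrow> sat G v (nonroot_fm (arity L R) x) \<longleftrightarrow> v x \<notin> roots L R G"
  by (auto simp: nonroot_fm_def sat_Conjs roots_def simp del: upt_Suc)

text \<open>Only the copy named \<open>j\<close> is affected: the formulas for the other copies and
  for \<open>default\<close> do not mention \<open>x\<close>, whose class is \<open>j\<close>, so
  the update of \<open>gval\<close> is invisible to them.\<close>

lemma decided_ex_gadget:
  assumes "decided L R (insert x X) J (s(x := Some j)) P" and j: "j \<in> J"
  shows "decided L R X J s (\<lambda>c. \<exists>a\<in>verts (gadget_of (arity L R) c j) - roots L R (gadget_of (arity L R) c j).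
    P (c\<lparr>gval := (gval c)(x := a)\<rparr>))"
proof -
  let ?k = "arity L R" and ?X = "insert x X" and ?s = "s(x := Some j)"
  obtain F \<Gamma> \<Gamma>0 where d: "deciding L R ?X J ?s F \<Gamma> \<Gamma>0"
    and P: "\<And>c c'. is_conf L R ?X J ?s c \<Longrightarrow> is_conf L R ?X J ?s c' \<Longrightarrow>
      conf_agree ?k J F \<Gamma> \<Gamma>0 c c' \<Longrightarrow> P c \<Longrightarrow> P c'"
    using assms(1) unfolding decided_def by blast
  \<comment> \<open>With \<open>nonroot_fm\<close> among the formulas of the pattern, the
    transported witness is again no root.\<close>
  let ?N = "{nonroot_fm ?k x} \<union> \<Gamma> j"
  let ?\<Gamma> = "\<Gamma>(j := (\<lambda>T. Exis [x] (pattern ?N T)) ` Pow ?N)"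
  have N: "fms_over (gadget_language L R) (class_vars ?X ?s j) ?N"
    using d j nonroot_fm(1)[of L R x] nonroot_fm(2)[of ?k x]
    by (auto simp: deciding_def fms_over_def class_vars_def)
  show ?thesis
  proof (rule decidedI[of _ _ _ _ _ F ?\<Gamma> \<Gamma>0])
    have "base_vars ?k ?X J ?s \<subseteq> base_vars ?k X J s" by (auto simp: base_vars_def)
    have cl: "class_vars ?X ?s i \<subseteq> class_vars X s i" if "i \<noteq> j" for i
      using that by (auto simp: class_vars_def)
    have "class_vars ?X ?s j - set [x] \<subseteq> class_vars X s j" by (auto simp: class_vars_def)
    then have "fms_over (gadget_language L R) (class_vars X s j) (?\<Gamma> j)"
      using fms_over_Exis[OF N] by (simp only: fun_upd_same)
    moreover have "fms_over (base_language L R) (base_vars ?k X J s) F"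
      "fms_over (gadget_language L R) {} \<Gamma>0"
      using d \<open>base_vars ?k ?X J ?s \<subseteq> base_vars ?k X J s\<close> by (auto simp: deciding_def intro: fms_over_mono)
    moreover have "fms_over (gadget_language L R) (class_vars X s i) (?\<Gamma> i)" if "i \<in> J" "i \<noteq> j" for i
      using d cl[OF that(2)] that by (auto simp: deciding_def intro: fms_over_mono)
    ultimately show "deciding L R X J s F ?\<Gamma> \<Gamma>0" unfolding deciding_def by blast
    fix c c' assume c: "is_conf L R X J s c" and c': "is_conf L R X J s c'"
      and ag: "conf_agree ?k J F ?\<Gamma> \<Gamma>0 c c'"
      and "\<exists>a\<in>verts (gadget_of ?k c j) - roots L R (gadget_of ?k c j). P (c\<lparr>gval := (gval c)(x := a)\<rparr>)"
    then obtain a where a: "a \<in> verts (gadget_of ?k c j) - roots L R (gadget_of ?k c j)"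
      "P (c\<lparr>gval := (gval c)(x := a)\<rparr>)" by blast
    obtain w where w: "\<And>y. y \<notin> set [x] \<Longrightarrow> w y = gval c' y"
        "\<And>y. y \<in> set [x] \<Longrightarrow> w y \<in> verts (gadget_of ?k c' j)"
        "agree ?N (gadget_of ?k c j) ((gval c)(x := a)) (gadget_of ?k c' j) w"
    proof (rule exists_agreeing[OF N is_conf_ne(2)[OF c j] is_conf_ne(2)[OF c' j],
            of "[x]" "gval c" "gval c'" "(gval c)(x := a)"])
      have "agree (?\<Gamma> j) (gadget_of ?k c j) (gval c) (gadget_of ?k c' j) (gval c')"
        using ag j unfolding conf_agree_def by blast
      then show "agree ((\<lambda>T. Exis [x] (pattern ?N T)) ` Pow ?N)
         (gadget_of ?k c j) (gval c) (gadget_of ?k c' j) (gval c')" by (simp only: fun_upd_same)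
    qed (use a in auto)
    define a' where "a' = w x"
    have weq: "w = (gval c')(x := a')" using w(1) by (auto simp: a'_def)
    have "sat (gadget_of ?k c' j) w (nonroot_fm ?k x) \<longleftrightarrow>
        sat (gadget_of ?k c j) ((gval c)(x := a)) (nonroot_fm ?k x)"
      using w(3) unfolding agree_Un by (simp add: agree_def)
    then have a': "a' \<in> verts (gadget_of ?k c' j) - roots L R (gadget_of ?k c' j)"
      using w(2)[of x] a(1) unfolding nonroot_fm(3)[OF is_conf_ne(2)[OF c' j]]
        nonroot_fm(3)[OF is_conf_ne(2)[OF c j]] by (simp add: a'_def)
    have conf: "is_conf L R ?X J ?s (d\<lparr>gval := (gval d)(x := b)\<rparr>)"
      if "is_conf L R X J s d" "b \<in> verts (gadget_of ?k d j) - roots L R (gadget_of ?k d j)"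
      for d :: "('a, 'b, 'c) conf" and b
      using that j by (auto simp: is_conf_def split: option.splits)
    have unused: "agree \<Delta> B ((gval c)(x := a)) B' ((gval c')(x := a'))"
      if "agree \<Delta> B (gval c) B' (gval c')" "\<forall>\<gamma>\<in>\<Delta>. x \<notin> fv \<gamma>" for \<Delta> B B'
      unfolding agree_def
    proof
      fix \<gamma> assume \<gamma>: "\<gamma> \<in> \<Delta>"
      have "sat B ((gval c)(x := a)) \<gamma> \<longleftrightarrow> sat B (gval c) \<gamma>" using that(2) \<gamma> by (intro sat_cong) auto
      also have "\<dots> \<longleftrightarrow> sat B' (gval c') \<gamma>" using that(1) \<gamma> by (simp add: agree_def)
      also have "\<dots> \<longleftrightarrow> sat B' ((gval c')(x := a')) \<gamma>" using that(2) \<gamma> by (intro sat_cong) auto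
      finally show "sat B ((gval c)(x := a)) \<gamma> \<longleftrightarrow> sat B' ((gval c')(x := a')) \<gamma>" .
    qed
    have "agree (\<Gamma> i) (gadget_of ?k c i) ((gval c)(x := a)) (gadget_of ?k c' i) ((gval c')(x := a'))"
      if i: "i \<in> J" for i
    proof (cases "i = j")
      case True
      then show ?thesis using w(3) unfolding weq agree_Un by simp
    next
      case False
      have "agree (?\<Gamma> i) (gadget_of ?k c i) (gval c) (gadget_of ?k c' i) (gval c')"
        using ag i unfolding conf_agree_def by blast
      then have "agree (\<Gamma> i) (gadget_of ?k c i) (gval c) (gadget_of ?k c' i) (gval c')"
        by (simp only: fun_upd_other[OF False])
      moreover have "x \<notin> class_vars ?X ?s i" using False by (simp add: class_vars_def)
      then have "\<forall>\<gamma>\<in>\<Gamma> i. x \<notin> fv \<gamma>"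
        using d i unfolding deciding_def fms_over_def by blast
      ultimately show ?thesis by (rule unused)
    qed
    moreover have "agree \<Gamma>0 (default c) ((gval c)(x := a)) (default c') ((gval c')(x := a'))"
      using ag d by (intro unused) (auto simp: conf_agree_def deciding_def fms_over_def)
    ultimately have "conf_agree ?k J F \<Gamma> \<Gamma>0 (c\<lparr>gval := (gval c)(x := a)\<rparr>)
        (c'\<lparr>gval := (gval c')(x := a')\<rparr>)"
      using ag by (simp add: conf_agree_def)
    then have "P (c'\<lparr>gval := (gval c')(x := a')\<rparr>)"
      using P[OF conf[OF c a(1)] conf[OF c' a']] a(2) by blast
    then show "\<exists>a\<in>verts (gadget_of ?k c' j) - roots L R (gadget_of ?k c' j). P (c'\<lparr>gval := (gval c')(x := a)\<rparr>)"
      using a' by blast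
  qed
qed

lemma base_vars_memI:
  "x \<in> X \<Longrightarrow> s x = None \<Longrightarrow> base_var x \<in> base_vars k X J s"
  "j \<in> J \<Longrightarrow> i \<in> {1..k} \<Longrightarrow> edge_var i j \<in> base_vars k X J s"
  unfolding base_vars_def by blast+

lemma upd_edge_other:
  assumes "y \<notin> (\<lambda>i. edge_var i j) ` {1..length e}"
  shows "upd_edge v j e y = v y"
proof -
  obtain i j' where y: "prod_decode y = (i, j')" by force
  then have "y = edge_var i j'" unfolding edge_var_def by (metis prod_decode_inverse)
  then show ?thesis using assms by (auto simp: upd_edge_edge_var)
qed

definition edge_vars :: "nat \<Rightarrow> nat \<Rightarrow> nat list" where
  "edge_vars k j = map (\<lambda>i. edge_var i j) [1..<Suc k]"

definition edges_eq_fm :: "nat \<Rightarrow> nat \<Rightarrow> nat \<Rightarrow> 'l fm" where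
  "edges_eq_fm k j j' = Conjs (map (\<lambda>i. Eq (Var (edge_var i j)) (Var (edge_var i j'))) [1..<Suc k])"

definition is_edge_fm :: "'l language \<Rightarrow> 'l \<Rightarrow> nat \<Rightarrow> 'l fm" where
  "is_edge_fm L R j = Rel R (map Var (edge_vars (arity L R) j))"

lemma set_edge_vars [simp]: "set (edge_vars k j) = (\<lambda>i. edge_var i j) ` {1..k}"
  by (auto simp: edge_vars_def simp del: upt_Suc)

lemma edges_eq_fm:
  "wf_fm L (edges_eq_fm k j j')"
  "fv (edges_eq_fm k j j') = (\<lambda>i. edge_var i j) ` {1..k} \<union> (\<lambda>i. edge_var i j') ` {1..k}"
  "verts A \<noteq> {} \<Longrightarrow> sat A v (edges_eq_fm k j j') \<longleftrightarrow> edge k v j = edge k v j'"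
proof -
  show "fv (edges_eq_fm k j j') = (\<lambda>i. edge_var i j) ` {1..k} \<union> (\<lambda>i. edge_var i j') ` {1..k}"
    unfolding edges_eq_fm_def fv_Conjs set_map set_upt atLeastLessThanSuc_atLeastAtMost by auto
qed (auto simp: edges_eq_fm_def sat_Conjs edge_eq_iff simp del: upt_Suc)

lemma is_edge_fm:
  "wf_fm (base_language L R) (is_edge_fm L R j)"
  "fv (is_edge_fm L R j) = (\<lambda>i. edge_var i j) ` {1..arity L R}"
  "sat A v (is_edge_fm L R j) \<longleftrightarrow> edge (arity L R) v j \<in> rel A R"
  by (auto simp: is_edge_fm_def edge_vars_def edge_def comp_def simp del: upt_Suc)

lemma is_conf_upd_edge:
  assumes c: "is_conf L R X J s c" and e: "e \<in> rel (base c) R - edge (arity L R) (bval c) ` J"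
    and j: "j \<notin> J"
  shows "is_conf L R X (insert j J) s (c\<lparr>bval := upd_edge (bval c) j e\<rparr>)"
    "gadget_of (arity L R) (c\<lparr>bval := upd_edge (bval c) j e\<rparr>) j = default c"
    "\<And>i. i \<in> J \<Longrightarrow> gadget_of (arity L R) (c\<lparr>bval := upd_edge (bval c) j e\<rparr>) i = gadget_of (arity L R) c i"
proof -
  let ?k = "arity L R"
  have l: "length e = ?k" using c e is_structD(2)[of "base_language L R" "base c" R e] by (auto simp: is_conf_def)
  note ed = edge_upd_edge[OF l, of "bval c" j]
  have im: "edge ?k (upd_edge (bval c) j e) ` insert j J = insert e (edge ?k (bval c) ` J)"
    using j by (auto simp: ed)
  show g: "gadget_of ?k (c\<lparr>bval := upd_edge (bval c) j e\<rparr>) j = default c"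
    using c e by (simp add: gadget_of_def ed is_conf_def)
  show g': "gadget_of ?k (c\<lparr>bval := upd_edge (bval c) j e\<rparr>) i = gadget_of ?k c i" if "i \<in> J" for i
    using that j by (auto simp: gadget_of_def ed)
  have inj: "inj_on (edge ?k (upd_edge (bval c) j e)) (insert j J)"
  proof -
    have "inj_on (edge ?k (bval c)) J" using c by (simp add: is_conf_def)
    then have "inj_on (edge ?k (upd_edge (bval c) j e)) J"
      using j by (subst inj_on_cong[of J _ "edge ?k (bval c)"]) (auto simp: ed)
    moreover have "e \<notin> edge ?k (upd_edge (bval c) j e) ` J" using e j by (auto simp: ed)
    ultimately show ?thesis using j by (simp add: ed)
  qed
  have "\<forall>x\<in>X. case s x of None \<Rightarrow> bval (c\<lparr>bval := upd_edge (bval c) j e\<rparr>) (base_var x) \<in> verts (base (c\<lparr>bval := upd_edge (bval c) j e\<rparr>))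
      | Some i \<Rightarrow> i \<in> insert j J \<and> gval (c\<lparr>bval := upd_edge (bval c) j e\<rparr>) x \<in> verts (gadget_of ?k (c\<lparr>bval := upd_edge (bval c) j e\<rparr>) i) -
          roots L R (gadget_of ?k (c\<lparr>bval := upd_edge (bval c) j e\<rparr>) i)"
    using c g' by (auto simp: is_conf_def split: option.splits)
  moreover have "\<forall>e'\<in>rel (base c) R - edge ?k (upd_edge (bval c) j e) ` insert j J. gadgets c e' = default c"
    unfolding im using c by (auto simp: is_conf_def)
  moreover have "\<forall>i\<in>insert j J. edge ?k (upd_edge (bval c) j e) i \<in> rel (base c) R"
    using c e by (auto simp: is_conf_def ed)
  moreover have "base (c\<lparr>bval := upd_edge (bval c) j e\<rparr>) = base c"
      "gadgets (c\<lparr>bval := upd_edge (bval c) j e\<rparr>) = gadgets c"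
      "default (c\<lparr>bval := upd_edge (bval c) j e\<rparr>) = default c"
      "bval (c\<lparr>bval := upd_edge (bval c) j e\<rparr>) = upd_edge (bval c) j e" by simp_all
  ultimately show "is_conf L R X (insert j J) s (c\<lparr>bval := upd_edge (bval c) j e\<rparr>)"
    using c inj unfolding is_conf_def by (simp only: simp_thms) (elim conjE, intro conjI; assumption)
qed

text \<open>Naming a so far unnamed edge. The patterns also record that the new tuple is an edge and
  differs from all named ones. No entry of the tuple lies in its copy, so the formulas in
  \<open>\<Gamma> j\<close> are sentences; its gadget is the default one, so they can be asked of
  \<open>default\<close> before the edge has a name. This gives
  \<open>\<Gamma>0 \<union> \<Gamma> j\<close>.\<close>

lemma decided_ex_edge:
  fixes L :: "'l language"
  assumes "decided L R X (insert j J) s P" and j: "j \<notin> J" and J: "finite J"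
    and s: "\<And>x. x \<in> X \<Longrightarrow> s x \<noteq> Some j"
  shows "decided L R X J s (\<lambda>c. \<exists>e\<in>rel (base c) R - edge (arity L R) (bval c) ` J.
    P (c\<lparr>bval := upd_edge (bval c) j e\<rparr>))"
proof -
  let ?k = "arity L R" and ?J = "insert j J"
  obtain F \<Gamma> \<Gamma>0 where d: "deciding L R X ?J s F \<Gamma> \<Gamma>0"
    and P: "\<And>c c'. is_conf L R X ?J s c \<Longrightarrow> is_conf L R X ?J s c' \<Longrightarrow>
      conf_agree ?k ?J F \<Gamma> \<Gamma>0 c c' \<Longrightarrow> P c \<Longrightarrow> P c'"
    using assms(1) unfolding decided_def by blast
  let ?N = "{is_edge_fm L R j} \<union> edges_eq_fm ?k j ` J \<union> F"
  let ?F = "(\<lambda>T. Exis (edge_vars ?k j) (pattern ?N T)) ` Pow ?N"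
  have "fv (edges_eq_fm ?k j i :: 'l fm) \<subseteq> base_vars ?k X ?J s" if "i \<in> J" for i
    using that unfolding edges_eq_fm base_vars_def by blast
  then have "fms_over (base_language L R) (base_vars ?k X ?J s) (edges_eq_fm ?k j ` J)"
    using J by (simp add: fms_over_def edges_eq_fm(1))
  moreover have "fv (is_edge_fm L R j) \<subseteq> base_vars ?k X ?J s"
    unfolding is_edge_fm base_vars_def by blast
  then have "fms_over (base_language L R) (base_vars ?k X ?J s) {is_edge_fm L R j}"
    by (simp add: fms_over_def is_edge_fm(1))
  moreover have "fms_over (base_language L R) (base_vars ?k X ?J s) F" using d by (simp add: deciding_def)
  ultimately have N: "fms_over (base_language L R) (base_vars ?k X ?J s) ?N"
    unfolding fms_over_Un by blast
  have cl: "class_vars X s j = {}" using s by (auto simp: class_vars_def)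
  show ?thesis
  proof (rule decidedI[of _ _ _ _ _ ?F \<Gamma> "\<Gamma>0 \<union> \<Gamma> j"])
    have "base_vars ?k X ?J s - set (edge_vars ?k j) \<subseteq> base_vars ?k X J s"
      by (auto simp: base_vars_def)
    then have "fms_over (base_language L R) (base_vars ?k X J s) ?F" by (rule fms_over_Exis[OF N])
    moreover have "fms_over (gadget_language L R) {} (\<Gamma> j)" using d cl by (simp add: deciding_def)
    ultimately show "deciding L R X J s ?F \<Gamma> (\<Gamma>0 \<union> \<Gamma> j)"
      using d unfolding deciding_def fms_over_Un by blast
    fix c c' assume c: "is_conf L R X J s c" and c': "is_conf L R X J s c'"
      and ag: "conf_agree ?k J ?F \<Gamma> (\<Gamma>0 \<union> \<Gamma> j) c c'"
      and "\<exists>e\<in>rel (base c) R - edge ?k (bval c) ` J. P (c\<lparr>bval := upd_edge (bval c) j e\<rparr>)"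
    then obtain e where e: "e \<in> rel (base c) R - edge ?k (bval c) ` J"
      "P (c\<lparr>bval := upd_edge (bval c) j e\<rparr>)" by blast
    have str: "is_struct (base_language L R) (base c)" "is_struct (base_language L R) (base c')"
      using c c' by (auto simp: is_conf_def)
    have le: "length e = ?k" "set e \<subseteq> verts (base c)" using is_structD[OF str(1), of R e] e by auto
    obtain w where w: "\<And>y. y \<notin> set (edge_vars ?k j) \<Longrightarrow> w y = bval c' y"
        "\<And>y. y \<in> set (edge_vars ?k j) \<Longrightarrow> w y \<in> verts (base c')"
        "agree ?N (base c) (upd_edge (bval c) j e) (base c') w"
    proof (rule exists_agreeing[OF N is_conf_ne(1)[OF c] is_conf_ne(1)[OF c'],
            of "edge_vars ?k j" "bval c" "bval c'" "upd_edge (bval c) j e"])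
      show "agree ?F (base c) (bval c) (base c') (bval c')"
        using ag unfolding conf_agree_def by blast
      show "upd_edge (bval c) j e y = bval c y" if "y \<notin> set (edge_vars ?k j)" for y
        using that le(1) by (intro upd_edge_other) simp
      show "upd_edge (bval c) j e y \<in> verts (base c)" if "y \<in> set (edge_vars ?k j)" for y
        using that le by (auto simp: upd_edge_edge_var intro!: subsetD[OF le(2)] nth_mem)
    qed blast
    define e' where "e' = edge ?k w j"
    have weq: "w = upd_edge (bval c') j e'"
    proof
      fix y
      show "w y = upd_edge (bval c') j e' y"
      proof (cases "y \<in> set (edge_vars ?k j)")
        case True
        then obtain i where "i \<in> {1..?k}" "y = edge_var i j" by auto
        then show ?thesis by (auto simp: upd_edge_edge_var e'_def edge_nth[simplified])
      next
        case False
        then have "upd_edge (bval c') j e' y = bval c' y"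
          by (intro upd_edge_other) (simp add: e'_def)
        then show ?thesis using w(1)[OF False] by simp
      qed
    qed
    have le': "length e' = ?k" by (simp add: e'_def)
    have N1: "sat (base c) (upd_edge (bval c) j e) \<alpha> \<longleftrightarrow> sat (base c') w \<alpha>" if "\<alpha> \<in> ?N" for \<alpha>
      using w(3) that unfolding agree_def by blast
    have "e' \<in> rel (base c') R"
      using N1[of "is_edge_fm L R j"] e(1) unfolding is_edge_fm
      by (simp add: edge_upd_edge[OF le(1)] e'_def)
    moreover have "e' \<noteq> edge ?k (bval c') i" if i: "i \<in> J" for i
    proof -
      have "edge ?k (upd_edge (bval c) j e) j = edge ?k (upd_edge (bval c) j e) i \<longleftrightarrow> edge ?k w j = edge ?k w i"
        using N1[of "edges_eq_fm ?k j i"] i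
        unfolding edges_eq_fm(3)[OF is_conf_ne(1)[OF c]] edges_eq_fm(3)[OF is_conf_ne(1)[OF c']] by blast
      then have "e = edge ?k (bval c) i \<longleftrightarrow> e' = edge ?k (bval c') i"
        using i j unfolding weq edge_upd_edge[OF le(1)] edge_upd_edge[OF le'] by (simp split: if_splits)
      then show ?thesis using i e(1) by blast
    qed
    ultimately have e': "e' \<in> rel (base c') R - edge ?k (bval c') ` J" by blast
    note conf = is_conf_upd_edge[OF c e(1) j] and conf' = is_conf_upd_edge[OF c' e' j]
    have "agree F (base c) (upd_edge (bval c) j e) (base c') (upd_edge (bval c') j e')"
      using w(3) unfolding weq agree_Un by blast
    moreover have "agree \<Gamma>0 (default c) (gval c) (default c') (gval c')"
      "agree (\<Gamma> j) (default c) (gval c) (default c') (gval c')"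
      using ag unfolding conf_agree_def agree_Un by blast+
    moreover have "agree (\<Gamma> i) (gadget_of ?k c i) (gval c) (gadget_of ?k c' i) (gval c')"
      if "i \<in> J" for i using ag that unfolding conf_agree_def by blast
    ultimately have "conf_agree ?k ?J F \<Gamma> \<Gamma>0 (c\<lparr>bval := upd_edge (bval c) j e\<rparr>)
        (c'\<lparr>bval := upd_edge (bval c') j e'\<rparr>)"
      using conf(2,3) conf'(2,3) by (auto simp: conf_agree_def)
    then have "P (c'\<lparr>bval := upd_edge (bval c') j e'\<rparr>)"
      using P[OF conf(1) conf'(1)] e(2) by blast
    then show "\<exists>e\<in>rel (base c') R - edge ?k (bval c') ` J. P (c'\<lparr>bval := upd_edge (bval c') j e\<rparr>)"
      using e' by blast
  qed
qed

text \<open>\<open>root_match s j x t\<close>: the term \<open>t\<close> names, inside the gadget over the edge \<open>j\<close>, a vertex that can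
  coincide with \<open>x\<close>; for a root the coincidence remains to be checked in the base structure.\<close>

definition root_match :: "nat \<Rightarrow> (nat \<Rightarrow> nat option) \<Rightarrow> nat \<Rightarrow> nat \<Rightarrow> trm \<Rightarrow> bool" where
  "root_match k s j x t \<longleftrightarrow> (t = Var x \<and> s x = Some j) \<or> (s x = None \<and> (\<exists>i\<in>{1..k}. t = Cst i))"

definition root_fm :: "nat \<Rightarrow> nat \<Rightarrow> trm \<Rightarrow> 'l fm" where
  "root_fm j x t = (case t of Var _ \<Rightarrow> Truth | Cst i \<Rightarrow> Eq (Var (base_var x)) (Var (edge_var i j)))"

text \<open>A base vertex meets a copy only in roots, and whether it is the base vertex glued to a
  given root is an equation in the base. A point inside a copy is not identified with anything else,
  and by injectivity of the names it lies over the edge \<open>j\<close> only if its name is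
  \<open>j\<close>.\<close>

lemma point_eq_attach:
  assumes c: "is_conf L R X J s c" and x: "x \<in> X" and j: "j \<in> J"
    and y: "y \<in> verts (gadget_of (arity L R) c j)"
  shows "point (arity L R) s c x = attach L R (gadget_of (arity L R) c j) (edge (arity L R) (bval c) j) y \<longleftrightarrow>
    (\<exists>t. root_match (arity L R) s j x t \<and> eval_trm (gadget_of (arity L R) c j) (gval c) t = y \<and>
       sat (base c) (bval c) (root_fm j x t))" (is "?l \<longleftrightarrow> ?r")
proof -
  let ?k = "arity L R" and ?G = "gadget_of (arity L R) c j"
  have G: "is_gadget L R ?G" using c j by (simp add: is_conf_ne)
  have ne: "verts (base c) \<noteq> {}" using c by (rule is_conf_ne)
  then have tr: "sat (base c) v Truth" for v by (auto simp: Truth_def)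
  show ?thesis
  proof (cases "s x")
    case None
    show ?thesis
    proof
      assume l: ?l
      show ?r
      proof (rule attach_cases[OF G, of y "edge ?k (bval c) j"])
        fix i assume i: "i \<in> {1..?k}" "y = cst ?G i"
          "attach L R ?G (edge ?k (bval c) j) y = Inl (edge ?k (bval c) j ! (i - 1))"
        then show ?r using l None edge_nth[OF i(1), of "bval c" j]
          by (intro exI[of _ "Cst i"]) (simp add: root_match_def root_fm_def point_def)
      next
        assume "attach L R ?G (edge ?k (bval c) j) y = Inr (edge ?k (bval c) j, y)"
        then show ?r using l None by (simp add: point_def)
      qed
    next
      assume ?r
      then obtain i where "i \<in> {1..?k}" "y = cst ?G i" "bval c (base_var x) = bval c (edge_var i j)"
        using None by (auto simp: root_match_def root_fm_def)
      then show ?l using None attach_root[OF G, of i "edge ?k (bval c) j"] edge_nth[of i ?k "bval c" j]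
        by (simp add: point_def)
    qed
  next
    case (Some i)
    then have i: "i \<in> J" "gval c x \<notin> roots L R (gadget_of ?k c i)"
      using c x by (auto simp: is_conf_def)
    have eq: "edge ?k (bval c) i = edge ?k (bval c) j \<longleftrightarrow> i = j"
      using c i(1) j by (auto simp: is_conf_def dest: inj_onD)
    show ?thesis
    proof
      assume l: ?l
      show ?r
      proof (rule attach_cases[OF G, of y "edge ?k (bval c) j"])
        fix i assume "attach L R ?G (edge ?k (bval c) j) y = Inl (edge ?k (bval c) j ! (i - 1))"
        then show ?r using l Some by (simp add: point_def)
      next
        assume "attach L R ?G (edge ?k (bval c) j) y = Inr (edge ?k (bval c) j, y)"
        then show ?r using l Some eq tr
          by (intro exI[of _ "Var x"]) (simp add: point_def root_match_def root_fm_def)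
      qed
    next
      assume ?r
      then have "i = j" "y = gval c x" using Some by (auto simp: root_match_def)
      then show ?l using Some i(2) by (simp add: point_def attach_nonroot)
    qed
  qed
qed

definition tuple_in :: "'l language \<Rightarrow> 'l \<Rightarrow> (nat \<Rightarrow> nat option) \<Rightarrow> 'l \<Rightarrow> nat list \<Rightarrow> nat \<Rightarrow> ('l, 'a, 'b) conf \<Rightarrow> bool" where
  "tuple_in L R s S xs j c \<longleftrightarrow> map (point (arity L R) s c) xs \<in>
     map (attach L R (gadget_of (arity L R) c j) (edge (arity L R) (bval c) j)) ` rel (gadget_of (arity L R) c j) S"

text \<open>Each entry of the tuple is described by a term of the gadget that names the vertex under
  it. There are finitely many such lists of terms, and each reduces membership to one atom of the
  gadget and equations in the base. A base vertex may lie under several roots when an edge repeats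
  an entry, hence the disjunction over all lists.\<close>

lemma decided_tuple_in:
  assumes S: "S \<in> rel_syms L" and xs: "set xs \<subseteq> X" "length xs = arity L S" and j: "j \<in> J"
  shows "decided L R X J s (tuple_in L R s S xs j)"
proof -
  let ?k = "arity L R"
  let ?TS = "{ts. list_all2 (root_match ?k s j) xs ts}"
  let ?Q = "\<lambda>ts c. sat (gadget_of ?k c j) (gval c) (Rel S ts) \<and>
      sat (base c) (bval c) (Conjs (map2 (root_fm j) xs ts))"
  have "?TS \<subseteq> {ts. set ts \<subseteq> Var ` set xs \<union> Cst ` {1..?k} \<and> length ts = length xs}"
  proof (clarsimp simp: list_all2_lengthD)
    fix ts t assume ts: "list_all2 (root_match ?k s j) xs ts" and t: "t \<in> set ts" "t \<notin> Cst ` {Suc 0..?k}"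
    then obtain i where i: "i < length ts" "ts ! i = t" by (auto simp: in_set_conv_nth)
    then have "root_match ?k s j (xs ! i) t" "xs ! i \<in> set xs"
      using ts list_all2_nthD2[OF ts] list_all2_lengthD[OF ts] by auto
    then show "t \<in> Var ` set xs" using t(2) by (auto simp: root_match_def)
  qed
  then have fin: "finite ?TS" by (rule finite_subset) (intro finite_lists_length_eq, simp)
  have "decided L R X J s (\<lambda>c. \<exists>ts\<in>?TS. ?Q ts c)"
  proof (intro decided_bex[OF fin] decided_conj)
    fix ts assume "ts \<in> ?TS"
    then have ts: "length ts = length xs" "\<And>i. i < length xs \<Longrightarrow> root_match ?k s j (xs ! i) (ts ! i)"
      by (auto simp: list_all2_conv_all_nth)
    have "wf_trm (gadget_language L R) (ts ! i) \<and> fv_trm (ts ! i) \<subseteq> class_vars X s j" if "i < length xs" for i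
      using ts(2)[OF that] xs(1) nth_mem[OF that] by (auto simp: root_match_def class_vars_def)
    then have "\<forall>t\<in>set ts. wf_trm (gadget_language L R) t \<and> fv_trm t \<subseteq> class_vars X s j"
      unfolding all_set_conv_all_nth ts(1) by blast
    then show "decided L R X J s (\<lambda>c. sat (gadget_of ?k c j) (gval c) (Rel S ts))"
      using S xs(2) ts(1) j by (intro decided_gadget) (simp, simp, blast)
    have "wf_fm (base_language L R) (root_fm j (xs ! i) (ts ! i))"
      "fv (root_fm j (xs ! i) (ts ! i)) \<subseteq> base_vars ?k X J s" if "i < length xs" for i
      using ts(2)[OF that] base_vars_memI(1)[OF subsetD[OF xs(1) nth_mem[OF that]], of s ?k J]
        base_vars_memI(2)[OF j, of _ ?k X s]
      by (auto simp: root_match_def root_fm_def Truth_def)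
    then show "decided L R X J s (\<lambda>c. sat (base c) (bval c) (Conjs (map2 (root_fm j) xs ts)))"
      using ts(1) by (intro decided_base) (auto simp: set_zip)
  qed
  then show ?thesis
  proof (rule decided_cong)
    fix c :: "('a, 'b, 'c) conf" assume c: "is_conf L R X J s c"
    let ?G = "gadget_of ?k c j" and ?e = "edge ?k (bval c) j"
    have G: "is_gadget L R ?G" using c j by (simp add: is_conf_ne)
    have cj: "sat (base c) (bval c) (Conjs (map2 (root_fm j) xs ts)) \<longleftrightarrow>
        (\<forall>i<length xs. sat (base c) (bval c) (root_fm j (xs ! i) (ts ! i)))" if "length ts = length xs" for ts
      using that by (auto simp: sat_Conjs[OF is_conf_ne(1)[OF c]] set_zip)
    have pt: "point ?k s c (xs ! i) = attach L R ?G ?e y \<longleftrightarrow>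
      (\<exists>t. root_match ?k s j (xs ! i) t \<and> eval_trm ?G (gval c) t = y \<and>
         sat (base c) (bval c) (root_fm j (xs ! i) t))" if "i < length xs" "y \<in> verts ?G" for i y
      using that xs(1) nth_mem[OF that(1)] by (intro point_eq_attach[OF c _ j]) auto
    show "(\<exists>ts\<in>?TS. ?Q ts c) \<longleftrightarrow> tuple_in L R s S xs j c"
    proof
      assume "\<exists>ts\<in>?TS. ?Q ts c"
      then obtain ts where ts: "list_all2 (root_match ?k s j) xs ts" "?Q ts c" by blast
      let ?t = "map (eval_trm ?G (gval c)) ts"
      have l: "length ts = length xs" using ts(1) by (simp add: list_all2_lengthD)
      have t: "?t \<in> rel ?G S" using ts(2) by simp
      have "set ?t \<subseteq> verts ?G" using is_structD(1)[OF is_gadgetD(1)[OF G] _ t] S by simp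
      then have "?t ! i \<in> verts ?G" if "i < length xs" for i
        using that l nth_mem[of i ?t] by (simp only: length_map) blast
      then have "point ?k s c (xs ! i) = attach L R ?G ?e (?t ! i)" if "i < length xs" for i
        unfolding pt[OF that \<open>\<And>i. i < length xs \<Longrightarrow> ?t ! i \<in> verts ?G\<close>[OF that]]
        using that l ts cj[OF l] by (intro exI[of _ "ts ! i"]) (simp add: list_all2_conv_all_nth)
      then have "map (point ?k s c) xs = map (attach L R ?G ?e) ?t"
        using l by (intro nth_equalityI) auto
      then show "tuple_in L R s S xs j c" using t unfolding tuple_in_def by blast
    next
      assume "tuple_in L R s S xs j c"
      then obtain t where t: "t \<in> rel ?G S" "map (point ?k s c) xs = map (attach L R ?G ?e) t"
        unfolding tuple_in_def by blast
      have tV: "set t \<subseteq> verts ?G" using is_structD(1)[OF is_gadgetD(1)[OF G], of S] S t(1) by simp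
      have l: "length t = length xs" using arg_cong[OF t(2), of length] by simp
      have "\<forall>i\<in>{..<length xs}. \<exists>u. root_match ?k s j (xs ! i) u \<and> eval_trm ?G (gval c) u = t ! i \<and>
         sat (base c) (bval c) (root_fm j (xs ! i) u)"
      proof
        fix i assume i: "i \<in> {..<length xs}"
        then have "point ?k s c (xs ! i) = attach L R ?G ?e (t ! i)"
          using l arg_cong[OF t(2), of "\<lambda>l. l ! i"] by simp
        then show "\<exists>u. root_match ?k s j (xs ! i) u \<and> eval_trm ?G (gval c) u = t ! i \<and>
         sat (base c) (bval c) (root_fm j (xs ! i) u)"
          using pt[of i "t ! i"] i l subsetD[OF tV nth_mem[of i t]] by simp
      qed
      then obtain u where u: "\<forall>i\<in>{..<length xs}. root_match ?k s j (xs ! i) (u i) \<and>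
         eval_trm ?G (gval c) (u i) = t ! i \<and> sat (base c) (bval c) (root_fm j (xs ! i) (u i))"
        by (rule bchoice[THEN exE])
      let ?ts = "map u [0..<length xs]"
      have "map (eval_trm ?G (gval c)) ?ts = t" using u l by (intro nth_equalityI) auto
      then have "?Q ?ts c" using u t(1) cj[of ?ts] by (simp del: map_map)
      moreover have "?ts \<in> ?TS" using u by (simp add: list_all2_conv_all_nth)
      ultimately show "\<exists>ts\<in>?TS. ?Q ts c" by blast
    qed
  qed
qed

lemma point_in_verts:
  assumes c: "is_conf L R X J s c" and x: "x \<in> X"
  shows "point (arity L R) s c x \<in> verts (conf_glued L R c)"
  using assms by (auto simp: is_conf_def point_def conf_glued_def glued_def gadget_of_def split: option.splits)

lemma point_upd_edge:
  assumes "length e = k" "s x \<noteq> Some j"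
  shows "point k s (c\<lparr>bval := upd_edge (bval c) j e\<rparr>) x = point k s c x"
  using assms(2) by (auto simp: point_def edge_upd_edge[OF assms(1)] split: option.splits)

lemma fresh_edge_name:
  fixes s :: "nat \<Rightarrow> nat option"
  assumes "finite X" "finite J"
  shows "\<exists>j. j \<notin> J \<and> (\<forall>x\<in>X. s x \<noteq> Some j)"
proof -
  have "finite (J \<union> (\<lambda>x. the (s x)) ` X)" using assms by simp
  then obtain j where "j \<notin> J \<union> (\<lambda>x. the (s x)) ` X"
    using ex_new_if_finite[OF infinite_UNIV_nat] by metis
  then show ?thesis by force
qed

lemma bex_split_image:
  "f ` J \<subseteq> M \<Longrightarrow> (\<exists>e\<in>M. P e) \<longleftrightarrow> (\<exists>i\<in>J. P (f i)) \<or> (\<exists>e\<in>M - f ` J. P e)"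
  by blast

text \<open>A tuple comes from the base, from a named copy or from an unnamed one. In the last case
  all its entries are base vertices at the roots of that copy, but the copy has to receive a fresh
  name before its gadget can be consulted.\<close>

lemma decided_atom:
  fixes L :: "'l language"
  assumes S: "S \<in> rel_syms L" and xs: "set xs \<subseteq> X" "length xs = arity L S"
    and fin: "finite X" "finite J"
  shows "decided L R X J s (\<lambda>c :: ('l, 'a, 'b) conf. map (point (arity L R) s c) xs \<in> rel (conf_glued L R c) S)"
proof -
  let ?k = "arity L R"
  obtain j where j: "j \<notin> J" "\<And>x. x \<in> X \<Longrightarrow> s x \<noteq> Some j"
    using fresh_edge_name[OF fin] by blast
  let ?base = "\<lambda>c :: ('l, 'a, 'b) conf. (\<forall>x\<in>set xs. s x = None) \<and> sat (base c) (bval c) (Rel S (map (\<lambda>x. Var (base_var x)) xs))"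
  let ?old = "\<lambda>c :: ('l, 'a, 'b) conf. \<exists>i\<in>J. tuple_in L R s S xs i c"
  let ?new = "\<lambda>c :: ('l, 'a, 'b) conf. \<exists>e\<in>rel (base c) R - edge ?k (bval c) ` J.
      tuple_in L R s S xs j (c\<lparr>bval := upd_edge (bval c) j e\<rparr>)"
  have "decided L R X J s ?base"
  proof (cases "\<forall>x\<in>set xs. s x = None")
    case True
    then have "decided L R X J s (\<lambda>c. sat (base c) (bval c) (Rel S (map (\<lambda>x. Var (base_var x)) xs)))"
      using S xs by (intro decided_base) (auto simp: base_vars_def)
    then show ?thesis using True by simp
  next
    case False
    then have "?base = (\<lambda>_. False)" by blast
    then show ?thesis using decided_const[of L R X J s False] by simp
  qed
  moreover have "decided L R X J s ?old"
    using S xs fin by (intro decided_bex decided_tuple_in)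
  moreover have "decided L R X J s ?new"
    using S xs fin j by (intro decided_ex_edge decided_tuple_in) auto
  ultimately have "decided L R X J s (\<lambda>c. ?base c \<or> (?old c \<or> ?new c))"
    by (intro decided_disj)
  then show ?thesis
  proof (rule decided_cong)
    fix c :: "('l, 'a, 'b) conf" assume c: "is_conf L R X J s c"
    have base: "?base c \<longleftrightarrow> map (point ?k s c) xs \<in> map Inl ` rel (base c) S"
    proof
      assume b: "?base c"
      then have "map (point ?k s c) xs = map Inl (map (\<lambda>x. bval c (base_var x)) xs)"
        by (auto simp: point_def)
      moreover have "map (\<lambda>x. bval c (base_var x)) xs \<in> rel (base c) S" using b by (simp add: comp_def)
      ultimately show "map (point ?k s c) xs \<in> map Inl ` rel (base c) S" by blast
    next
      assume "map (point ?k s c) xs \<in> map Inl ` rel (base c) S"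
      then obtain t where t: "t \<in> rel (base c) S" "map (point ?k s c) xs = map Inl t" by blast
      have "s x = None" if "x \<in> set xs" for x
      proof (cases "s x")
        case (Some i)
        have "point ?k s c x \<in> set (map (point ?k s c) xs)" using that by simp
        then show ?thesis unfolding t(2) using Some by (auto simp: point_def)
      qed
      moreover from this have "map (point ?k s c) xs = map Inl (map (\<lambda>x. bval c (base_var x)) xs)"
        by (auto simp: point_def)
      then have "map Inl t = (map Inl (map (\<lambda>x. bval c (base_var x)) xs) :: ('a + 'a list \<times> 'b) list)"
        using t(2) by simp
      then have "t = map (\<lambda>x. bval c (base_var x)) xs" by (simp add: inj_map_eq_map del: map_map)
      ultimately show "?base c" using t(1) by (simp add: comp_def)
    qed
    let ?in = "\<lambda>e. map (point ?k s c) xs \<in> map (attach L R (gadgets c e) e) ` rel (gadgets c e) S"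
    have old: "?old c \<longleftrightarrow> (\<exists>e\<in>edge ?k (bval c) ` J. ?in e)"
      by (auto simp: tuple_in_def gadget_of_def)
    have new: "tuple_in L R s S xs j (c\<lparr>bval := upd_edge (bval c) j e\<rparr>) \<longleftrightarrow> ?in e"
      if e: "e \<in> rel (base c) R" for e
    proof -
      have l: "length e = ?k" using c is_structD(2)[of "base_language L R" "base c" R e] e by (auto simp: is_conf_def)
      have "map (point ?k s (c\<lparr>bval := upd_edge (bval c) j e\<rparr>)) xs = map (point ?k s c) xs"
        using xs(1) j(2) by (auto intro!: point_upd_edge[OF l])
      then show ?thesis unfolding tuple_in_def gadget_of_def by (simp only:) (simp add: edge_upd_edge[OF l])
    qed
    have sub: "edge ?k (bval c) ` J \<subseteq> rel (base c) R" using c by (auto simp: is_conf_def)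
    have "map (point ?k s c) xs \<in> rel (conf_glued L R c) S \<longleftrightarrow>
        map (point ?k s c) xs \<in> map Inl ` rel (base c) S \<or> (\<exists>e\<in>rel (base c) R. ?in e)"
      by (auto simp: conf_glued_def glued_def)
    also have "\<dots> \<longleftrightarrow> ?base c \<or> (?old c \<or> ?new c)"
      unfolding base old using new sub by blast
    finally show "?base c \<or> (?old c \<or> ?new c) \<longleftrightarrow> map (point ?k s c) xs \<in> rel (conf_glued L R c) S" by blast
  qed
qed

text \<open>The induction leaves \<open>X\<close>, \<open>J\<close> and \<open>s\<close> arbitrary
  because a quantifier changes them. Its witness is a base vertex, a non-root in a named copy, or a
  non-root in an unnamed copy; the last case combines a quantifier over edges with one inside the
  newly named gadget.\<close>

lemma decided_sat:
  fixes L :: "'l language"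
  assumes L: "const_syms L = {}" and "wf_fm L \<phi>" "finite X" "finite J" "fv \<phi> \<subseteq> X"
  shows "decided L R X J s (\<lambda>c :: ('l, 'a, 'b) conf. sat (conf_glued L R c) (point (arity L R) s c) \<phi>)"
  using assms(2-)
proof (induction \<phi> arbitrary: X J s)
  case (Rel S ts)
  have v: "\<exists>x. t = Var x" if "t \<in> set ts" for t using Rel.prems(1) that L by (cases t) auto
  define xs where "xs = map (\<lambda>t. case t of Var x \<Rightarrow> x | Cst _ \<Rightarrow> 0) ts"
  have ts: "ts = map Var xs" unfolding xs_def map_map
    using v by (intro map_idI[symmetric]) fastforce
  have "decided L R X J s (\<lambda>c :: ('l, 'a, 'b) conf. map (point (arity L R) s c) xs \<in> rel (conf_glued L R c) S)"
    using Rel.prems by (intro decided_atom) (auto simp: ts)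
  then show ?case by (simp add: ts comp_def)
next
  case (Eq t u)
  obtain x where x: "t = Var x" using Eq.prems L by (cases t) auto
  obtain y where y: "u = Var y" using Eq.prems L by (cases u) auto
  have X: "x \<in> X" "y \<in> X" using Eq.prems by (auto simp: x y)
  have "decided L R X J s (\<lambda>c :: ('l, 'a, 'b) conf. point (arity L R) s c x = point (arity L R) s c y)"
  proof (cases "s x")
    case None
    show ?thesis
    proof (cases "s y")
      case None' : None
      have "decided L R X J s (\<lambda>c. sat (base c) (bval c) (Eq (Var (base_var x)) (Var (base_var y))))"
        using None None' X by (intro decided_base) (auto simp: base_vars_def)
      then show ?thesis using None None' by (simp add: point_def)
    next
      case Some
      then show ?thesis using None decided_const[of L R X J s False] by (simp add: point_def)
    qed
  next
    case s: (Some i)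
    show ?thesis
    proof (cases "s y = Some i \<and> i \<in> J")
      case True
      then have "decided L R X J s (\<lambda>c. sat (gadget_of (arity L R) c i) (gval c) (Eq (Var x) (Var y)))"
        using s X by (intro decided_gadget) (auto simp: class_vars_def)
      then show ?thesis using s True by (simp add: point_def)
    next
      \<comment> \<open>Different names denote different edges, so the points differ; for a name
        outside \<open>J\<close> there is no configuration at all.\<close>
      case False
      show ?thesis using decided_const[of L R X J s False]
      proof (rule decided_cong)
        fix c :: "('l, 'a, 'b) conf" assume c: "is_conf L R X J s c"
        have i: "i \<in> J" using c X s by (force simp: is_conf_def)
        show "False = (point (arity L R) s c x = point (arity L R) s c y)"
        proof (cases "s y")
          case (Some i')
          then have "i' \<in> J" "i' \<noteq> i" using c X False i by (force simp: is_conf_def)+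
          then have "edge (arity L R) (bval c) i \<noteq> edge (arity L R) (bval c) i'"
            using c i by (auto simp: is_conf_def dest: inj_onD)
          then show ?thesis using s Some by (simp add: point_def)
        qed (use s in \<open>simp add: point_def\<close>)
      qed
    qed
  qed
  then show ?case by (simp add: x y)
next
  case (Neg \<phi>)
  then show ?case by (simp add: decided_not)
next
  case (Conj \<phi> \<psi>)
  then show ?case by (simp add: decided_conj)
next
  case (Exi x \<phi>)
  let ?k = "arity L R" and ?X = "insert x X"
  obtain j where j: "j \<notin> J" "\<And>x. x \<in> X \<Longrightarrow> s x \<noteq> Some j"
    using fresh_edge_name[OF Exi.prems(2,3)] by blast
  let ?Q = "\<lambda>t (c :: ('l, 'a, 'b) conf). sat (conf_glued L R c) (point ?k (s(x := t)) c) \<phi>"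
  let ?ex = "\<lambda>i c. \<exists>a\<in>verts (gadget_of ?k c i) - roots L R (gadget_of ?k c i). ?Q (Some i) (c\<lparr>gval := (gval c)(x := a)\<rparr>)"
  let ?base = "\<lambda>c :: ('l, 'a, 'b) conf. \<exists>a\<in>verts (base c). ?Q None (c\<lparr>bval := (bval c)(base_var x := a)\<rparr>)"
  let ?old = "\<lambda>c :: ('l, 'a, 'b) conf. \<exists>i\<in>J. ?ex i c"
  let ?new = "\<lambda>c :: ('l, 'a, 'b) conf. \<exists>e\<in>rel (base c) R - edge ?k (bval c) ` J. ?ex j (c\<lparr>bval := upd_edge (bval c) j e\<rparr>)"
  have IH: "decided L R ?X J' (s(x := t)) (?Q t)" if "finite J'" for J' t
    using Exi.prems that by (intro Exi.IH) auto
  have "decided L R X J s ?base" using Exi.prems by (intro decided_ex_base IH)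
  moreover have "decided L R X J s ?old"
    using Exi.prems by (intro decided_bex decided_ex_gadget IH)
  moreover have "decided L R X J s ?new"
    using Exi.prems j by (intro decided_ex_edge decided_ex_gadget IH) auto
  ultimately have "decided L R X J s (\<lambda>c. ?base c \<or> (?old c \<or> ?new c))"
    by (intro decided_disj)
  then show ?case
  proof (rule decided_cong)
    fix c :: "('l, 'a, 'b) conf" assume c: "is_conf L R X J s c"
    let ?u = "point ?k s c" and ?M = "conf_glued L R c"
    let ?in = "\<lambda>e. \<exists>a\<in>verts (gadgets c e) - roots L R (gadgets c e). sat ?M (?u(x := Inr (e, a))) \<phi>"
    have glued_upd: "conf_glued L R (c\<lparr>bval := v\<rparr>) = ?M" "conf_glued L R (c\<lparr>gval := w\<rparr>) = ?M"
      "conf_glued L R (c\<lparr>bval := v, gval := w\<rparr>) = ?M" for v w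
      by (simp_all add: conf_glued_def)
    have yX: "y \<in> X" if "y \<in> fv \<phi>" "y \<noteq> x" for y using Exi.prems that by auto
    have b: "?Q None (c\<lparr>bval := (bval c)(base_var x := a)\<rparr>) \<longleftrightarrow> sat ?M (?u(x := Inl a)) \<phi>" for a
      unfolding glued_upd by (intro sat_cong) (auto simp: point_def split: option.splits)
    have o: "?ex i c \<longleftrightarrow> ?in (edge ?k (bval c) i)" for i
    proof -
      have "?Q (Some i) (c\<lparr>gval := (gval c)(x := a)\<rparr>) \<longleftrightarrow> sat ?M (?u(x := Inr (edge ?k (bval c) i, a))) \<phi>" for a
        unfolding glued_upd by (intro sat_cong) (auto simp: point_def split: option.splits)
      then show ?thesis by (simp add: gadget_of_def)
    qed
    have n: "?ex j (c\<lparr>bval := upd_edge (bval c) j e\<rparr>) \<longleftrightarrow> ?in e" if e: "e \<in> rel (base c) R" for e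
    proof -
      have l: "length e = ?k" using c is_structD(2)[of "base_language L R" "base c" R e] e by (auto simp: is_conf_def)
      have "point ?k (s(x := Some j)) (c\<lparr>bval := upd_edge (bval c) j e, gval := (gval c)(x := a)\<rparr>) y =
          (?u(x := Inr (e, a))) y" if "y \<in> fv \<phi>" for y a
        using yX[OF that] j(2)[of y] by (auto simp: point_def edge_upd_edge[OF l] split: option.splits)
      then have "sat ?M (point ?k (s(x := Some j)) (c\<lparr>bval := upd_edge (bval c) j e, gval := (gval c)(x := a)\<rparr>)) \<phi>
          \<longleftrightarrow> sat ?M (?u(x := Inr (e, a))) \<phi>" for a
        by (rule sat_cong)
      then show ?thesis by (simp add: gadget_of_def edge_upd_edge[OF l] glued_upd)
    qed
    have sub: "edge ?k (bval c) ` J \<subseteq> rel (base c) R" using c by (auto simp: is_conf_def)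
    have "sat ?M ?u (Exi x \<phi>) \<longleftrightarrow> (\<exists>a\<in>verts (base c). sat ?M (?u(x := Inl a)) \<phi>) \<or> (\<exists>e\<in>rel (base c) R. ?in e)"
      unfolding sat.simps by (auto simp: conf_glued_def glued_def)
    also have "(\<exists>e\<in>rel (base c) R. ?in e) \<longleftrightarrow> (\<exists>i\<in>J. ?in (edge ?k (bval c) i)) \<or>
        (\<exists>e\<in>rel (base c) R - edge ?k (bval c) ` J. ?in e)"
      by (rule bex_split_image[OF sub])
    also have "(\<exists>e\<in>rel (base c) R - edge ?k (bval c) ` J. ?in e) \<longleftrightarrow> ?new c"
      by (rule bex_cong[OF refl]) (rule n[symmetric], simp)
    also have "(\<exists>i\<in>J. ?in (edge ?k (bval c) i)) \<longleftrightarrow> ?old c"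
      by (rule bex_cong[OF refl]) (rule o[symmetric])
    also have "(\<exists>a\<in>verts (base c). sat ?M (?u(x := Inl a)) \<phi>) \<longleftrightarrow> ?base c"
      by (rule bex_cong[OF refl]) (rule b[symmetric])
    finally show "?base c \<or> (?old c \<or> ?new c) \<longleftrightarrow> sat ?M ?u (Exi x \<phi>)" by blast
  qed
qed

subsection \<open>Localization\<close>

text \<open>Every tuple that leads from distance \<open>i\<close> to distance \<open>i + 1\<close>
  has all its entries within distance \<open>i + 1\<close>. As long as this is at most
  \<open>r\<close>, the tuple survives in the smaller structure.\<close>

lemma nbhd_of_large_part:
  assumes sub: "\<And>S. S \<in> rel_syms L \<Longrightarrow> rel B' S \<subseteq> rel B S"
    and near: "\<And>S t. S \<in> rel_syms L \<Longrightarrow> t \<in> rel B S \<Longrightarrow> set t \<subseteq> nbhd L B r U \<Longrightarrow> t \<in> rel B' S"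
  shows "nbhd L B' r U = nbhd L B r U"
    and "\<And>S. S \<in> rel_syms L \<Longrightarrow> rel B' S \<inter> lists (nbhd L B r U) = rel B S \<inter> lists (nbhd L B r U)"
proof -
  have "nbhd L B' i U = nbhd L B i U" if "i \<le> r" for i
    using that
  proof (induction i)
    case (Suc i)
    then have IH: "nbhd L B' i U = nbhd L B i U" by simp
    show ?case
    proof (intro equalityI subsetI)
      fix b assume "b \<in> nbhd L B' (Suc i) U"
      then show "b \<in> nbhd L B (Suc i) U" unfolding nbhd_Suc IH using sub by blast
    next
      fix b assume "b \<in> nbhd L B (Suc i) U"
      then consider "b \<in> nbhd L B i U" | a S t where "a \<in> nbhd L B i U" "S \<in> rel_syms L" "t \<in> rel B S"
        "a \<in> set t" "b \<in> set t"
        unfolding nbhd_Suc by blast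
      then show "b \<in> nbhd L B' (Suc i) U"
      proof cases
        case 1
        then show ?thesis by (simp add: nbhd_Suc IH)
      next
        case 2
        have "set t \<subseteq> nbhd L B (Suc i) U" using nbhd_Suc_tuple[OF 2(1-4)] by blast
        also have "\<dots> \<subseteq> nbhd L B r U" using Suc.prems by (rule nbhd_radius_mono)
        finally have "t \<in> rel B' S" by (rule near[OF 2(2,3)])
        then show ?thesis using 2 IH by (auto intro: nbhd_Suc_tuple)
      qed
    qed
  qed simp
  then show "nbhd L B' r U = nbhd L B r U" by simp
  show "rel B' S \<inter> lists (nbhd L B r U) = rel B S \<inter> lists (nbhd L B r U)" if "S \<in> rel_syms L" for S
    using sub[OF that] near[OF that] by auto
qed

lemma induced_struct:
  "is_struct L A \<Longrightarrow> N \<subseteq> verts A \<Longrightarrow> N \<noteq> {} \<Longrightarrow> cst A ` const_syms L \<subseteq> N \<Longrightarrow> is_struct L (induced A N)"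
  by (auto simp: is_struct_def induced_def intro: finite_subset)

lemma induced_simps [simp]:
  "verts (induced A N) = N" "rel (induced A N) S = rel A S \<inter> lists N" "cst (induced A N) = cst A"
  by (auto simp: induced_def)

lemma roots_induced [simp]: "roots L R (induced G N) = roots L R G"
  by (simp add: roots_def)

lemma attach_induced [simp]: "attach L R (induced G N) = attach L R G"
  by (auto simp: attach_def fun_eq_iff)

definition local_base :: "'l language \<Rightarrow> 'l \<Rightarrow> nat \<Rightarrow> nat set \<Rightarrow> nat set \<Rightarrow> (nat \<Rightarrow> nat option) \<Rightarrow>
    ('l, 'a) fo_struct \<Rightarrow> (nat \<Rightarrow> 'a) \<Rightarrow> ('l, 'a) fo_struct" where
  "local_base L R r X J s A v = induced A (nbhd (base_language L R) A r (v ` base_vars (arity L R) X J s))"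

definition local_gadget :: "'l language \<Rightarrow> 'l \<Rightarrow> nat \<Rightarrow> ('l, 'b) fo_struct \<Rightarrow> 'b set \<Rightarrow> ('l, 'b) fo_struct" where
  "local_gadget L R r G W = induced G (nbhd (gadget_language L R) G r (W \<union> roots L R G))"

text \<open>Gadgets are indexed by edges and the entries of the tuple by names, so the classes of
  all names of \<open>e\<close> are collected. Distinct names make this at most one class; for an
  unnamed edge it is empty, and the neighborhood of the roots remains, which is the default
  gadget.\<close>

definition local_conf :: "'l language \<Rightarrow> 'l \<Rightarrow> nat \<Rightarrow> nat set \<Rightarrow> nat set \<Rightarrow> (nat \<Rightarrow> nat option) \<Rightarrow>
    ('l, 'a) fo_struct \<Rightarrow> ('l, 'b) fo_struct \<Rightarrow> (nat \<Rightarrow> 'a) \<Rightarrow> (nat \<Rightarrow> 'b) \<Rightarrow> ('l, 'a, 'b) conf" where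
  "local_conf L R r X J s A G v w = \<lparr>base = local_base L R r X J s A v,
     gadgets = (\<lambda>e. local_gadget L R r G (w ` (\<Union>j\<in>{j \<in> J. edge (arity L R) v j = e}. class_vars X s j))),
     default = local_gadget L R r G {}, bval = v, gval = w\<rparr>"

definition const_conf :: "('l, 'a) fo_struct \<Rightarrow> ('l, 'b) fo_struct \<Rightarrow> (nat \<Rightarrow> 'a) \<Rightarrow> (nat \<Rightarrow> 'b) \<Rightarrow> ('l, 'a, 'b) conf" where
  "const_conf A G v w = \<lparr>base = A, gadgets = (\<lambda>_. G), default = G, bval = v, gval = w\<rparr>"

lemma local_gadget_gadget:
  assumes G: "is_gadget L R G" and W: "W \<subseteq> verts G" and k: "1 \<le> arity L R"
  shows "is_gadget L R (local_gadget L R r G W)"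
proof -
  have sub: "W \<union> roots L R G \<subseteq> verts G" using W is_gadgetD(3)[OF G] by blast
  have sup: "W \<union> roots L R G \<subseteq> nbhd (gadget_language L R) G r (W \<union> roots L R G)" by (rule nbhd_superset)
  have ne: "roots L R G \<noteq> {}" using k by (auto simp: roots_def)
  have "is_struct (gadget_language L R) (local_gadget L R r G W)"
    unfolding local_gadget_def
    using sup ne by (intro induced_struct is_gadgetD(1)[OF G] nbhd_verts[OF _ sub]) (auto simp: roots_def)
  then show ?thesis using is_gadgetD(2)[OF G] by (simp add: is_gadget_def local_gadget_def)
qed

lemma gadget_of_local_conf:
  assumes "inj_on (edge (arity L R) v) J" "j \<in> J"
  shows "gadget_of (arity L R) (local_conf L R r X J s A G v w) j = local_gadget L R r G (w ` class_vars X s j)"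
proof -
  have "{i \<in> J. edge (arity L R) v i = edge (arity L R) v j} = {j}" using assms by (auto dest: inj_onD)
  then show ?thesis by (simp add: gadget_of_def local_conf_def)
qed

text \<open>Centers always belong to their own neighborhoods, so the named edges, the roots and the
  entries of the tuple all survive. A nonempty tuple and a positive arity of \<open>R\<close>
  provide at least one center in the base and in each gadget.\<close>

lemma local_conf_is_conf:
  assumes L: "const_syms L = {}" and k: "1 \<le> arity L R" and X: "X \<noteq> {}" and c: "is_conf L R X J s (const_conf A G v w)"
  shows "is_conf L R X J s (local_conf L R r X J s A G v w)"
proof -
  let ?k = "arity L R" and ?c = "local_conf L R r X J s A G v w"
  have A: "is_struct (base_language L R) A" and G: "is_gadget L R G"
    using c by (auto simp: is_conf_def const_conf_def)
  have ed: "\<And>j. j \<in> J \<Longrightarrow> edge ?k v j \<in> rel A R" and inj: "inj_on (edge ?k v) J"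
    using c by (auto simp: is_conf_def const_conf_def)
  have x: "case s x of None \<Rightarrow> v (base_var x) \<in> verts A | Some j \<Rightarrow> j \<in> J \<and> w x \<in> verts G - roots L R G"
    if "x \<in> X" for x using c that by (auto simp: is_conf_def const_conf_def gadget_of_def split: option.splits)
  let ?Y = "v ` base_vars ?k X J s"
  have edY: "set (edge ?k v j) \<subseteq> ?Y" if "j \<in> J" for j
    using that by (auto simp: set_edge intro!: base_vars_memI imageI)
  have "v y \<in> verts A" if "y \<in> base_vars ?k X J s" for y
  proof -
    from that consider x where "x \<in> X" "s x = None" "y = base_var x" | i j where "j \<in> J" "i \<in> {1..?k}" "y = edge_var i j"
      unfolding base_vars_def by blast
    then show ?thesis
    proof cases
      case 1
      then show ?thesis using x[of x] by simp
    next
      case 2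
      then have "v y \<in> set (edge ?k v j)" by (simp add: set_edge)
      then show ?thesis using is_structD(1)[OF A _ ed[OF 2(1)]] by auto
    qed
  qed
  then have YA: "?Y \<subseteq> verts A" by blast
  obtain x0 where x0: "x0 \<in> X" using X by blast
  have "base_vars ?k X J s \<noteq> {}"
  proof (cases "s x0")
    case None
    then show ?thesis using base_vars_memI(1)[OF x0] by blast
  next
    case (Some j)
    then have "j \<in> J" using x[OF x0] by simp
    then show ?thesis using base_vars_memI(2)[of j J 1 ?k X s] k by auto
  qed
  then have Yne: "?Y \<noteq> {}" by blast
  have sup: "?Y \<subseteq> nbhd (base_language L R) A r ?Y" by (rule nbhd_superset)
  have base: "is_struct (base_language L R) (base ?c)"
    unfolding local_conf_def local_base_def conf.simps
    using sup Yne L by (intro induced_struct A nbhd_verts[OF A YA]) auto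
  have W: "w ` (\<Union>j\<in>K. class_vars X s j) \<subseteq> verts G" for K
    using x by (force simp: class_vars_def)
  have gad: "is_gadget L R (gadgets ?c e)" "is_gadget L R (default ?c)" for e
    using local_gadget_gadget[OF G W k] local_gadget_gadget[OF G _ k, of "{}"] by (simp_all add: local_conf_def)
  have ed': "edge ?k (bval ?c) j \<in> rel (base ?c) R" if "j \<in> J" for j
    using ed[OF that] edY[OF that] sup by (auto simp: local_conf_def local_base_def)
  have dflt: "gadgets ?c e = default ?c" if "e \<notin> edge ?k (bval ?c) ` J" for e
  proof -
    have "{j \<in> J. edge ?k v j = e} = {}" using that by (auto simp: local_conf_def)
    then show ?thesis by (simp only: local_conf_def conf.simps) simp
  qed
  have pts: "case s x of None \<Rightarrow> bval ?c (base_var x) \<in> verts (base ?c)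
      | Some j \<Rightarrow> j \<in> J \<and> gval ?c x \<in> verts (gadget_of ?k ?c j) - roots L R (gadget_of ?k ?c j)" if X: "x \<in> X" for x
  proof (cases "s x")
    case None
    then have "v (base_var x) \<in> ?Y" using base_vars_memI(1)[OF X] by blast
    then show ?thesis using sup None by (auto simp: local_conf_def local_base_def)
  next
    case (Some j)
    then have j: "j \<in> J" "w x \<notin> roots L R G" using x[OF X] by auto
    have "w x \<in> w ` class_vars X s j" using Some X by (simp add: class_vars_def)
    then have "w x \<in> nbhd (gadget_language L R) G r (w ` class_vars X s j \<union> roots L R G)"
      using nbhd_superset[of "w ` class_vars X s j \<union> roots L R G"] by blast
    then show ?thesis using Some j gadget_of_local_conf[OF inj j(1), of r X s A G w]
      by (simp add: local_gadget_def) (simp add: local_conf_def)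
  qed
  have inj': "inj_on (edge ?k (bval ?c)) J" using inj by (simp add: local_conf_def)
  show ?thesis unfolding is_conf_def using base gad ed' dflt pts inj' by blast
qed

text \<open>The neighborhoods of a tuple are the same in the whole structure and in the structure glued from
  the neighborhoods of its trace in the base and in the gadgets. The radius grows by one because a
  copy is present only if all entries of its edge are.\<close>

lemma sat_local_conf:
  assumes L: "finite_relational_language L" and k: "1 \<le> arity L R"
    and \<phi>: "wf_fm L \<phi>" "nbhd_determined L {} r \<phi>" and ne: "fv \<phi> \<noteq> {}"
    and c: "is_conf L R (fv \<phi>) J s (const_conf A G v w)"
  defines "c' \<equiv> local_conf L R (Suc r) (fv \<phi>) J s A G v w"
  shows "sat (conf_glued L R (const_conf A G v w)) (point (arity L R) s (const_conf A G v w)) \<phi> \<longleftrightarrow>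
    sat (conf_glued L R c') (point (arity L R) s c') \<phi>"
proof -
  let ?k = "arity L R" and ?c = "const_conf A G v w" and ?X = "fv \<phi>"
  let ?B = "conf_glued L R ?c" and ?B' = "conf_glued L R c'"
  let ?LA = "base_language L R" and ?LG = "gadget_language L R"
  have L0: "const_syms L = {}" and ar: "\<And>S. S \<in> rel_syms L \<Longrightarrow> 1 \<le> arity L S"
    using L by (auto simp: finite_relational_language_def)
  have c': "is_conf L R ?X J s c'" unfolding c'_def by (rule local_conf_is_conf[OF L0 k ne c])
  have A: "is_struct ?LA A" and G: "is_gadget L R G"
    using c by (auto simp: is_conf_def const_conf_def)
  define u where "u = point ?k s ?c"
  have u': "point ?k s c' = u" by (auto simp: u_def point_def c'_def local_conf_def const_conf_def split: option.splits)
  define Y where "Y = v ` base_vars ?k ?X J s"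
  define W where "W e = w ` (\<Union>j\<in>{j \<in> J. edge ?k v j = e}. class_vars ?X s j) \<union> roots L R G" for e
  \<comment> \<open>A bound for the ball of radius \<open>i\<close> in the glued structure. Passing
    from one root to another inside a copy costs at least one step, while in the base all entries of
    an edge are within one step of each other, since \<open>R\<close> belongs to the base language.
    Shortcuts through copies thus never beat the base distance.\<close>
  define Z where "Z i = {p. case p of Inl a \<Rightarrow> a \<in> nbhd ?LA A i Y
      | Inr (e, y) \<Rightarrow> y \<in> nbhd ?LG G i (W e) \<and> set e \<subseteq> nbhd ?LA A i Y}" for i
  have B: "verts ?B = verts (glued L R A (\<lambda>_. G))" "rel ?B S = map Inl ` rel A S \<union>
       {map (attach L R G e) t | e t. e \<in> rel A R \<and> t \<in> rel G S}" for S
    by (auto simp: conf_glued_def const_conf_def glued_def)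
  have B': "rel ?B' S = map Inl ` (rel A S \<inter> lists (nbhd ?LA A (Suc r) Y)) \<union>
       {map (attach L R G e) t | e t. e \<in> rel A R \<inter> lists (nbhd ?LA A (Suc r) Y) \<and>
          t \<in> rel G S \<inter> lists (nbhd ?LG G (Suc r) (W e))}" for S
    unfolding conf_glued_def c'_def local_conf_def glued_def local_base_def local_gadget_def Y_def W_def
      conf.simps fo_struct.simps induced_simps attach_induced ..
  \<comment> \<open>When a copy is entered through a root, only one entry of the edge is known to be
    within distance \<open>i\<close>; the others are one \<open>R\<close>-step further. This is the
    origin of the additional step in the base radius.\<close>
  have copy: "set e \<subseteq> nbhd ?LA A (Suc i) Y \<and> y \<in> nbhd ?LG G i (W e)"
    if e: "e \<in> rel A R" and p: "attach L R G e y \<in> Z i" for e y i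
  proof (rule attach_cases[OF G, of y e])
    fix l assume l: "l \<in> {1..?k}" "y = cst G l" "attach L R G e y = Inl (e ! (l - 1))"
    have "length e = ?k" using is_structD(2)[OF A _ e] by simp
    then have "e ! (l - 1) \<in> set e" using l(1) by (intro nth_mem) auto
    moreover have "e ! (l - 1) \<in> nbhd ?LA A i Y" using p l(3) by (simp add: Z_def)
    ultimately have "set e \<subseteq> nbhd ?LA A (Suc i) Y"
      using nbhd_Suc_tuple[of _ ?LA A i Y R e] e by auto
    moreover have "y \<in> W e" using l by (auto simp: W_def roots_def)
    ultimately show ?thesis using nbhd_superset[of "W e" ?LG G i] by blast
  next
    assume "attach L R G e y = Inr (e, y)"
    then show ?thesis using p nbhd_radius_mono[of i "Suc i" ?LA A Y] by (auto simp: Z_def)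
  qed
  have near: "nbhd L ?B i (u ` ?X) \<subseteq> Z i" for i
  proof (induction i)
    case 0
    have "u x \<in> Z 0" if x: "x \<in> ?X" for x
    proof (cases "s x")
      case None
      then show ?thesis using base_vars_memI(1)[of x ?X s ?k J, OF x None]
        by (simp add: u_def Z_def Y_def point_def const_conf_def)
    next
      case (Some j)
      have "j \<in> J" using c x Some by (force simp: is_conf_def)
      moreover have "x \<in> class_vars ?X s j" using x Some by (simp add: class_vars_def)
      moreover have "set (edge ?k v j) \<subseteq> Y"
        unfolding set_edge Y_def using base_vars_memI(2)[OF \<open>j \<in> J\<close>] by blast
      ultimately show ?thesis using Some
        by (auto simp: u_def Z_def W_def point_def const_conf_def)
    qed
    then show ?case by auto
  next
    case (Suc i)
    show ?case
    proof
      fix q assume "q \<in> nbhd L ?B (Suc i) (u ` ?X)"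
      then consider "q \<in> Z i" | p S t where "p \<in> Z i" "S \<in> rel_syms L" "t \<in> rel ?B S" "p \<in> set t" "q \<in> set t"
        unfolding nbhd_Suc using Suc by blast
      then show "q \<in> Z (Suc i)"
      proof cases
        case 1
        then show ?thesis using nbhd_radius_mono[of i "Suc i"] unfolding Z_def
          by (auto split: sum.splits intro: subsetD[OF nbhd_radius_mono[of i "Suc i"]])
      next
        case 2
        then consider t' where "t' \<in> rel A S" "t = map Inl t'"
          | e t' where "e \<in> rel A R" "t' \<in> rel G S" "t = map (attach L R G e) t'"
          unfolding B by blast
        then show ?thesis
        proof cases
          case t: 1
          then obtain a b where "p = Inl a" "a \<in> set t'" "q = Inl b" "b \<in> set t'" using 2 by auto
          then show ?thesis using nbhd_Suc_tuple[of a ?LA A i Y S t' b] 2(1,2) t(1) by (simp add: Z_def)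
        next
          case t: 2
          then obtain y z where y: "p = attach L R G e y" "y \<in> set t'" and z: "q = attach L R G e z" "z \<in> set t'"
            using 2 by auto
          have cp: "set e \<subseteq> nbhd ?LA A (Suc i) Y" "y \<in> nbhd ?LG G i (W e)"
            using copy[OF t(1)] 2(1) y(1) by auto
          have zG: "z \<in> nbhd ?LG G (Suc i) (W e)"
            using nbhd_Suc_tuple[OF cp(2) _ t(2) y(2) z(2)] 2(2) by simp
          show ?thesis
          proof (rule attach_cases[OF G, of z e])
            fix l assume l: "l \<in> {1..?k}" "attach L R G e z = Inl (e ! (l - 1))"
            have "length e = ?k" using is_structD(2)[OF A _ t(1)] by simp
            then have "e ! (l - 1) \<in> set e" using l(1) by (intro nth_mem) auto
            then show ?thesis using cp(1) l z(1) by (auto simp: Z_def)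
          next
            assume "attach L R G e z = Inr (e, z)"
            then show ?thesis using cp(1) zG z(1) by (simp add: Z_def)
          qed
        qed
      qed
    qed
  qed
  have sub: "rel ?B' S \<subseteq> rel ?B S" for S unfolding B B' by blast
  have large: "t \<in> rel ?B' S" if S: "S \<in> rel_syms L" and t: "t \<in> rel ?B S" and N: "set t \<subseteq> nbhd L ?B r (u ` ?X)" for S t
  proof -
    have Z: "set t \<subseteq> Z r" using N near[of r] by blast
    from t consider t' where "t' \<in> rel A S" "t = map Inl t'"
      | e t' where "e \<in> rel A R" "t' \<in> rel G S" "t = map (attach L R G e) t'"
      unfolding B by blast
    then show ?thesis
    proof cases
      case 1
      then have "set t' \<subseteq> nbhd ?LA A r Y" using Z by (auto simp: Z_def)
      also have "\<dots> \<subseteq> nbhd ?LA A (Suc r) Y" by (rule nbhd_radius_mono) simp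
      finally show ?thesis using 1 unfolding B' by auto
    next
      case 2
      have cp: "set e \<subseteq> nbhd ?LA A (Suc r) Y \<and> y \<in> nbhd ?LG G r (W e)" if "y \<in> set t'" for y
        using copy[OF 2(1)] that Z 2(3) by auto
      have "length t' = arity L S" using is_structD(2)[OF is_gadgetD(1)[OF G] _ 2(2)] S by simp
      \<comment> \<open>Positive arity gives the tuple an entry, and this entry shows that the edge
        itself lies in the base neighborhood.\<close>
      then have "t' \<noteq> []" using ar[OF S] by auto
      then have "e \<in> lists (nbhd ?LA A (Suc r) Y)" using cp[of "hd t'"] by auto
      moreover have "t' \<in> lists (nbhd ?LG G (Suc r) (W e))"
        using cp nbhd_radius_mono[of r "Suc r" ?LG G "W e"] by auto
      ultimately show ?thesis using 2 unfolding B' by blast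
    qed
  qed
  note N = nbhd_of_large_part[of L ?B' ?B r "u ` ?X", OF sub large]
  have "is_struct L ?B" "is_struct L ?B'"
    using c c' by (auto simp: conf_glued_def is_conf_def intro!: glued_struct[OF L0])
  moreover have "u ` ?X \<subseteq> verts ?B \<inter> verts ?B'"
    using point_in_verts[OF c] point_in_verts[OF c'] u' by (auto simp: u_def)
  ultimately have "sat ?B u \<phi> \<longleftrightarrow> sat ?B' u \<phi>"
    using N by (intro nbhd_determined_any_type[OF \<phi>(2,1) L0 _ _ _ refl]) auto
  then show ?thesis unfolding u' by (simp add: u_def)
qed

subsection \<open>Counting\<close>

lemma card_eq_sum_fibres:
  assumes "finite S" "finite I" "f ` S \<subseteq> I"
  shows "card S = (\<Sum>i\<in>I. card {x \<in> S. f x = i})"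
proof -
  have "card (\<Union>i\<in>I. {x \<in> S. f x = i}) = (\<Sum>i\<in>I. card {x \<in> S. f x = i})"
    using assms by (intro card_UN_disjoint) auto
  moreover have "(\<Union>i\<in>I. {x \<in> S. f x = i}) = S" using assms(3) by auto
  ultimately show ?thesis by simp
qed

lemma card_PiE_classes:
  fixes C :: "'i \<Rightarrow> 'x set" and V :: "'b set"
  assumes J: "finite J" and disj: "\<And>i j. i \<in> J \<Longrightarrow> j \<in> J \<Longrightarrow> i \<noteq> j \<Longrightarrow> C i \<inter> C j = {}"
    and P: "\<And>j w w'. j \<in> J \<Longrightarrow> (\<And>x. x \<in> C j \<Longrightarrow> w x = w' x) \<Longrightarrow> P j w \<longleftrightarrow> P j w'"
  shows "card {w \<in> (\<Union>j\<in>J. C j) \<rightarrow>\<^sub>E V. \<forall>j\<in>J. P j w} = (\<Prod>j\<in>J. card {w \<in> C j \<rightarrow>\<^sub>E V. P j w})"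
proof -
  let ?D = "\<Union>j\<in>J. C j" and ?r = "\<lambda>w. \<lambda>j\<in>J. restrict w (C j)"
  have "bij_betw ?r {w \<in> ?D \<rightarrow>\<^sub>E V. \<forall>j\<in>J. P j w} (\<Pi>\<^sub>E j\<in>J. {w \<in> C j \<rightarrow>\<^sub>E V. P j w})"
  proof (rule bij_betw_imageI)
    show "inj_on ?r {w \<in> ?D \<rightarrow>\<^sub>E V. \<forall>j\<in>J. P j w}"
    proof (rule inj_onI)
      fix w w' assume w: "w \<in> {w \<in> ?D \<rightarrow>\<^sub>E V. \<forall>j\<in>J. P j w}" and w': "w' \<in> {w \<in> ?D \<rightarrow>\<^sub>E V. \<forall>j\<in>J. P j w}"
        and eq: "?r w = ?r w'"
      have "w x = w' x" if x: "x \<in> ?D" for x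
      proof -
        obtain j where j: "j \<in> J" "x \<in> C j" using x by blast
        then have "?r w j x = ?r w' j x" using eq by simp
        then show ?thesis using j by simp
      qed
      then show "w = w'" using w w' PiE_ext[of w ?D "\<lambda>_. V" w'] by blast
    qed
    show "?r ` {w \<in> ?D \<rightarrow>\<^sub>E V. \<forall>j\<in>J. P j w} = (\<Pi>\<^sub>E j\<in>J. {w \<in> C j \<rightarrow>\<^sub>E V. P j w})"
    proof (intro equalityI subsetI)
      fix h assume "h \<in> ?r ` {w \<in> ?D \<rightarrow>\<^sub>E V. \<forall>j\<in>J. P j w}"
      then obtain w where w: "w \<in> ?D \<rightarrow>\<^sub>E V" "\<forall>j\<in>J. P j w" "h = ?r w" by blast
      have "restrict w (C j) \<in> {w \<in> C j \<rightarrow>\<^sub>E V. P j w}" if "j \<in> J" for j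
        using w that P[OF that, of "restrict w (C j)" w] by (auto simp: PiE_iff)
      then show "h \<in> (\<Pi>\<^sub>E j\<in>J. {w \<in> C j \<rightarrow>\<^sub>E V. P j w})" unfolding w(3) by (simp add: PiE_iff)
    next
      fix h assume h: "h \<in> (\<Pi>\<^sub>E j\<in>J. {w \<in> C j \<rightarrow>\<^sub>E V. P j w})"
      define w where "w = (\<lambda>x\<in>?D. h (THE j. j \<in> J \<and> x \<in> C j) x)"
      have the: "(THE i. i \<in> J \<and> x \<in> C i) = j" if "j \<in> J" "x \<in> C j" for j x
        using that disj by (intro the_equality) blast+
      have wj: "w x = h j x" if "j \<in> J" "x \<in> C j" for j x
        using that the[OF that] by (auto simp: w_def)
      have hj: "h j \<in> C j \<rightarrow>\<^sub>E V" "P j (h j)" if "j \<in> J" for j using h that by (auto simp: PiE_iff)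
      have "w \<in> ?D \<rightarrow>\<^sub>E V"
      proof (rule PiE_I)
        fix x assume "x \<in> ?D"
        then obtain j where "j \<in> J" "x \<in> C j" by blast
        then show "w x \<in> V" using wj hj(1) by (simp add: PiE_iff)
      qed (simp add: w_def)
      moreover have "\<forall>j\<in>J. P j w" using P hj(2) wj by metis
      moreover have "h = ?r w"
      proof
        fix j show "h j = ?r w j"
        proof (cases "j \<in> J")
          case True
          then have "h j x = restrict w (C j) x" for x
            using wj[OF True, of x] hj(1)[OF True] by (auto simp: PiE_iff extensional_def)
          then show ?thesis using True by auto
        qed (use h in \<open>simp add: PiE_iff extensional_def\<close>)
      qed
      ultimately show "h \<in> ?r ` {w \<in> ?D \<rightarrow>\<^sub>E V. \<forall>j\<in>J. P j w}" by blast
    qed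
  qed
  then show ?thesis using J by (simp add: bij_betw_same_card card_PiE)
qed

lemma card_PiE_reindex:
  assumes \<rho>: "bij_betw \<rho> C D" and P: "\<And>w w'. (\<And>x. x \<in> C \<Longrightarrow> w x = w' x) \<Longrightarrow> P w \<longleftrightarrow> P w'"
  shows "card {w \<in> D \<rightarrow>\<^sub>E V. P (w \<circ> \<rho>)} = card {w \<in> C \<rightarrow>\<^sub>E V. P w}"
proof -
  have im: "\<rho> ` C = D" and inj: "inj_on \<rho> C" using \<rho> by (auto simp: bij_betw_def)
  have "bij_betw (\<lambda>w. restrict (w \<circ> \<rho>) C) {w \<in> D \<rightarrow>\<^sub>E V. P (w \<circ> \<rho>)} {w \<in> C \<rightarrow>\<^sub>E V. P w}"
  proof (rule bij_betw_imageI)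
    show "inj_on (\<lambda>w. restrict (w \<circ> \<rho>) C) {w \<in> D \<rightarrow>\<^sub>E V. P (w \<circ> \<rho>)}"
    proof (rule inj_onI)
      fix w w' assume w: "w \<in> {w \<in> D \<rightarrow>\<^sub>E V. P (w \<circ> \<rho>)}" and w': "w' \<in> {w \<in> D \<rightarrow>\<^sub>E V. P (w \<circ> \<rho>)}"
        and eq: "restrict (w \<circ> \<rho>) C = restrict (w' \<circ> \<rho>) C"
      have "w y = w' y" if y: "y \<in> D" for y
      proof -
        obtain x where "x \<in> C" "y = \<rho> x" using y im by blast
        then show ?thesis using fun_cong[OF eq, of x] by simp
      qed
      then show "w = w'" using w w' PiE_ext[of w D "\<lambda>_. V" w'] by blast
    qed
    show "(\<lambda>w. restrict (w \<circ> \<rho>) C) ` {w \<in> D \<rightarrow>\<^sub>E V. P (w \<circ> \<rho>)} = {w \<in> C \<rightarrow>\<^sub>E V. P w}"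
    proof (intro equalityI subsetI)
      fix h assume "h \<in> (\<lambda>w. restrict (w \<circ> \<rho>) C) ` {w \<in> D \<rightarrow>\<^sub>E V. P (w \<circ> \<rho>)}"
      then obtain w where w: "w \<in> D \<rightarrow>\<^sub>E V" "P (w \<circ> \<rho>)" "h = restrict (w \<circ> \<rho>) C" by blast
      have "P h" using P[of h "w \<circ> \<rho>"] w by simp
      moreover have "h \<in> C \<rightarrow>\<^sub>E V" using w im by (auto simp: PiE_iff)
      ultimately show "h \<in> {w \<in> C \<rightarrow>\<^sub>E V. P w}" by blast
    next
      fix h assume h: "h \<in> {w \<in> C \<rightarrow>\<^sub>E V. P w}"
      define w where "w = (\<lambda>y\<in>D. h (inv_into C \<rho> y))"
      have wx: "w (\<rho> x) = h x" if "x \<in> C" for x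
        using that im inv_into_f_f[OF inj that] by (auto simp: w_def)
      have "w y \<in> V" if "y \<in> D" for y
        using that im wx h by (auto simp: PiE_iff)
      then have "w \<in> D \<rightarrow>\<^sub>E V" by (auto simp: w_def PiE_iff)
      moreover have "P (w \<circ> \<rho>)" using P[of "w \<circ> \<rho>" h] wx h by simp
      moreover have "h = restrict (w \<circ> \<rho>) C"
        using h wx by (auto simp: PiE_iff extensional_def fun_eq_iff)
      ultimately show "h \<in> (\<lambda>w. restrict (w \<circ> \<rho>) C) ` {w \<in> D \<rightarrow>\<^sub>E V. P (w \<circ> \<rho>)}" by blast
    qed
  qed
  then show ?thesis by (rule bij_betw_same_card)
qed

text \<open>The shape of a tuple \<open>u\<close> is encoded by the relation of lying in the same copy; a tuple entry is a
  base vertex iff it is not related to itself.\<close>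

definition same_copy :: "nat set \<Rightarrow> (nat \<Rightarrow> 'a + 'a list \<times> 'b) \<Rightarrow> (nat \<times> nat) set" where
  "same_copy X u = {(x, y) \<in> X \<times> X. \<exists>e a b. u x = Inr (e, a) \<and> u y = Inr (e, b)}"

definition copy_shape :: "(nat \<times> nat) set \<Rightarrow> nat \<Rightarrow> nat option" where
  "copy_shape K x = (if (x, x) \<in> K then Some (LEAST y. (x, y) \<in> K) else None)"

definition edge_names :: "nat set \<Rightarrow> (nat \<Rightarrow> nat option) \<Rightarrow> nat set" where
  "edge_names X s = {j. \<exists>x\<in>X. s x = Some j}"

definition base_count :: "'l language \<Rightarrow> 'l \<Rightarrow> nat \<Rightarrow> nat set \<Rightarrow> nat set \<Rightarrow> (nat \<Rightarrow> nat option) \<Rightarrow>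
    'l fm set \<Rightarrow> 'l fm set \<Rightarrow> ('l, 'a) fo_struct \<Rightarrow> nat" where
  "base_count L R r X J s F T A = card {v \<in> base_vars (arity L R) X J s \<rightarrow>\<^sub>E verts A.
     (\<forall>j\<in>J. edge (arity L R) v j \<in> rel A R) \<and> inj_on (edge (arity L R) v) J \<and>
     {\<alpha> \<in> F. sat (local_base L R r X J s A v) v \<alpha>} = T}"

definition class_count :: "'l language \<Rightarrow> 'l \<Rightarrow> nat \<Rightarrow> nat set \<Rightarrow> 'l fm set \<Rightarrow> 'l fm set \<Rightarrow>
    ('l, 'b) fo_struct \<Rightarrow> nat" where
  "class_count L R r C \<Delta> Q G = card {w \<in> C \<rightarrow>\<^sub>E verts G. (\<forall>x\<in>C. w x \<notin> roots L R G) \<and>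
     {\<gamma> \<in> \<Delta>. sat (local_gadget L R r G (w ` C)) w \<gamma>} = Q}"

definition default_type :: "'l language \<Rightarrow> 'l \<Rightarrow> nat \<Rightarrow> 'l fm set \<Rightarrow> ('l, 'b) fo_struct \<Rightarrow> 'l fm set" where
  "default_type L R r \<Delta> G = {\<gamma> \<in> \<Delta>. sat (local_gadget L R r G {}) (\<lambda>_. undefined) \<gamma>}"

text \<open>The relation of a tuple is a partial equivalence. Related entries have the same set of
  related entries and so the same least one, which serves as the name of their copy; conversely, two
  entries with the same name are both related to it.\<close>

lemma copy_shape_eq:
  assumes K: "same_copy X u = K" and x: "x \<in> X" and y: "y \<in> X"
  shows "copy_shape K x = None \<longleftrightarrow> isl (u x)"
    and "copy_shape K x \<noteq> None \<and> copy_shape K x = copy_shape K y \<longleftrightarrow> (x, y) \<in> K"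
proof -
  have refl: "(x, x) \<in> K \<longleftrightarrow> \<not> isl (u x)" if "x \<in> X" for x
    using that by (cases "u x") (auto simp: K[symmetric] same_copy_def)
  show "copy_shape K x = None \<longleftrightarrow> isl (u x)" using refl[OF x] by (simp add: copy_shape_def)
  have sym: "(x, y) \<in> K \<longleftrightarrow> (y, x) \<in> K" for x y by (auto simp: K[symmetric] same_copy_def)
  have trans: "(x, y) \<in> K \<Longrightarrow> (y, z) \<in> K \<Longrightarrow> (x, z) \<in> K" for x y z by (auto simp: K[symmetric] same_copy_def)
  show "copy_shape K x \<noteq> None \<and> copy_shape K x = copy_shape K y \<longleftrightarrow> (x, y) \<in> K"
  proof
    assume a: "copy_shape K x \<noteq> None \<and> copy_shape K x = copy_shape K y"
    then have xx: "(x, x) \<in> K" and yy: "(y, y) \<in> K" by (auto simp: copy_shape_def split: if_splits)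
    then have "(LEAST z. (x, z) \<in> K) = (LEAST z. (y, z) \<in> K)" using a by (simp add: copy_shape_def)
    moreover have "(x, LEAST z. (x, z) \<in> K) \<in> K" using xx by (rule LeastI)
    moreover have "(y, LEAST z. (y, z) \<in> K) \<in> K" using yy by (rule LeastI)
    ultimately show "(x, y) \<in> K" using sym trans by metis
  next
    assume xy: "(x, y) \<in> K"
    then have "(x, x) \<in> K" "(y, y) \<in> K" using sym trans by blast+
    moreover have "(x, z) \<in> K \<longleftrightarrow> (y, z) \<in> K" for z using xy sym trans by blast
    ultimately show "copy_shape K x \<noteq> None \<and> copy_shape K x = copy_shape K y"
      by (simp add: copy_shape_def)
  qed
qed

definition glued_confs :: "'l language \<Rightarrow> 'l \<Rightarrow> nat set \<Rightarrow> (nat \<Rightarrow> nat option) \<Rightarrow> ('l, 'a) fo_struct \<Rightarrow>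
    ('l, 'b) fo_struct \<Rightarrow> ((nat \<Rightarrow> 'a) \<times> (nat \<Rightarrow> 'b)) set" where
  "glued_confs L R X s A G = {(v, w). v \<in> base_vars (arity L R) X (edge_names X s) s \<rightarrow>\<^sub>E verts A \<and>
     w \<in> (\<Union>j\<in>edge_names X s. class_vars X s j) \<rightarrow>\<^sub>E verts G \<and>
     is_conf L R X (edge_names X s) s (const_conf A G v w)}"

lemma is_conf_const_conf:
  assumes "is_struct (base_language L R) A" "is_gadget L R G"
  shows "is_conf L R X J s (const_conf A G v w) \<longleftrightarrow> (\<forall>j\<in>J. edge (arity L R) v j \<in> rel A R) \<and>
    inj_on (edge (arity L R) v) J \<and> (\<forall>x\<in>X. case s x of None \<Rightarrow> v (base_var x) \<in> verts A
      | Some j \<Rightarrow> j \<in> J \<and> w x \<in> verts G - roots L R G)"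
  using assms by (auto simp: is_conf_def const_conf_def gadget_of_def split: option.splits)

text \<open>A tuple with copy relation \<open>K\<close> amounts to independent data: base vertices,
  distinct edges, one for each class, and non-roots for the entries in copies. The tuple
  \<open>u0\<close> guarantees that \<open>K\<close> is the relation of some tuple, hence a partial
  equivalence. For the inverse map, the edge of a class is read off any representative
  \<open>rep j\<close>.\<close>

lemma bij_glued_confs:
  fixes A :: "('l, 'a) fo_struct" and G :: "('l, 'b) fo_struct" and u0 :: "nat \<Rightarrow> 'a + 'a list \<times> 'b"
  assumes A: "is_struct (base_language L R) A" and G: "is_gadget L R G"
    and K: "same_copy X u0 = K"
  defines "s \<equiv> copy_shape K"
  shows "bij_betw (\<lambda>(v, w). restrict (point (arity L R) s (const_conf A G v w)) X) (glued_confs L R X s A G)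
    {u \<in> X \<rightarrow>\<^sub>E verts (glued L R A (\<lambda>_. G)). same_copy X u = K}"
proof (rule bij_betw_imageI)
  let ?k = "arity L R" and ?J = "edge_names X s"
  let ?f = "\<lambda>(v, w). restrict (point ?k s (const_conf A G v w)) X"
  have Ksub: "K \<subseteq> X \<times> X" by (auto simp: K[symmetric] same_copy_def)
  have Kiff: "(x, y) \<in> K \<longleftrightarrow> s x \<noteq> None \<and> s x = s y" if "x \<in> X" "y \<in> X" for x y
    unfolding s_def using copy_shape_eq(2)[OF K that] by blast
  have J: "s x = Some j \<Longrightarrow> x \<in> X \<Longrightarrow> j \<in> ?J" for x j by (auto simp: edge_names_def)
  have JE: "\<exists>x\<in>X. s x = Some j" if "j \<in> ?J" for j using that by (simp add: edge_names_def)
  have pt: "point ?k s (const_conf A G v w) x =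
      (case s x of None \<Rightarrow> Inl (v (base_var x)) | Some j \<Rightarrow> Inr (edge ?k v j, w x))" for v w x
    by (auto simp: point_def const_conf_def split: option.splits)
  show "inj_on ?f (glued_confs L R X s A G)"
  proof (rule inj_onI, clarify)
    fix v w v' w' assume vw: "(v, w) \<in> glued_confs L R X s A G" and vw': "(v', w') \<in> glued_confs L R X s A G"
      and eq: "restrict (point ?k s (const_conf A G v w)) X = restrict (point ?k s (const_conf A G v' w')) X"
    have eqx: "point ?k s (const_conf A G v w) x = point ?k s (const_conf A G v' w') x" if "x \<in> X" for x
      using fun_cong[OF eq, of x] that by simp
    have "v z = v' z" if z: "z \<in> base_vars ?k X ?J s" for z
    proof -
      from z consider x where "x \<in> X" "s x = None" "z = base_var x" | i j where "j \<in> ?J" "i \<in> {1..?k}" "z = edge_var i j"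
        unfolding base_vars_def by blast
      then show ?thesis
      proof cases
        case 1
        then show ?thesis using eqx[of x] by (simp add: pt)
      next
        case 2
        obtain x where "x \<in> X" "s x = Some j" using JE[OF 2(1)] by blast
        then have "edge ?k v j = edge ?k v' j" using eqx[of x] by (simp add: pt)
        then show ?thesis using 2 unfolding edge_eq_iff by blast
      qed
    qed
    then have "v = v'" using vw vw' PiE_ext[of v "base_vars ?k X ?J s" "\<lambda>_. verts A" v']
      unfolding glued_confs_def by blast
    moreover have "w x = w' x" if "x \<in> (\<Union>j\<in>?J. class_vars X s j)" for x
      using that eqx[of x] by (auto simp: class_vars_def pt)
    then have "w = w'" using vw vw' PiE_ext[of w "\<Union>j\<in>?J. class_vars X s j" "\<lambda>_. verts G" w']
      unfolding glued_confs_def by blast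
    ultimately show "v = v' \<and> w = w'" by blast
  qed
  show "?f ` glued_confs L R X s A G = {u \<in> X \<rightarrow>\<^sub>E verts (glued L R A (\<lambda>_. G)). same_copy X u = K}"
  proof (intro equalityI subsetI)
    fix u assume "u \<in> ?f ` glued_confs L R X s A G"
    then obtain v w where vw: "(v, w) \<in> glued_confs L R X s A G" and u: "u = restrict (point ?k s (const_conf A G v w)) X"
      by auto
    have c: "is_conf L R X ?J s (const_conf A G v w)" using vw by (simp add: glued_confs_def)
    have inj: "inj_on (edge ?k v) ?J" using c is_conf_const_conf[OF A G] by blast
    have "conf_glued L R (const_conf A G v w) = glued L R A (\<lambda>_. G)" by (simp add: conf_glued_def const_conf_def)
    then have "u \<in> X \<rightarrow>\<^sub>E verts (glued L R A (\<lambda>_. G))" using point_in_verts[OF c] by (simp add: u)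
    moreover have "(x, y) \<in> same_copy X u \<longleftrightarrow> (x, y) \<in> K" for x y
    proof (cases "x \<in> X \<and> y \<in> X")
      case True
      then have "(x, y) \<in> same_copy X u \<longleftrightarrow> (\<exists>i j. s x = Some i \<and> s y = Some j \<and> edge ?k v i = edge ?k v j)"
        by (auto simp: same_copy_def u pt split: option.splits)
      also have "\<dots> \<longleftrightarrow> s x \<noteq> None \<and> s x = s y"
        using True J inj_onD[OF inj] by (metis not_None_eq option.inject)
      finally show ?thesis using Kiff True by blast
    next
      case False
      then show ?thesis using Ksub by (auto simp: same_copy_def)
    qed
    then have "same_copy X u = K" by auto
    ultimately show "u \<in> {u \<in> X \<rightarrow>\<^sub>E verts (glued L R A (\<lambda>_. G)). same_copy X u = K}" by blast
  next
    fix u assume "u \<in> {u \<in> X \<rightarrow>\<^sub>E verts (glued L R A (\<lambda>_. G)). same_copy X u = K}"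
    then have u: "u \<in> X \<rightarrow>\<^sub>E verts (glued L R A (\<lambda>_. G))" and uK: "same_copy X u = K" by blast+
    define rep where "rep j = (SOME x. x \<in> X \<and> s x = Some j)" for j
    have rep: "rep j \<in> X" "s (rep j) = Some j" if "j \<in> ?J" for j
      using someI_ex[of "\<lambda>x. x \<in> X \<and> s x = Some j"] JE[OF that] by (auto simp: rep_def)
    define ed where "ed j = fst (projr (u (rep j)))" for j
    define v where "v = (\<lambda>z\<in>base_vars ?k X ?J s. case prod_decode z of (i, j) \<Rightarrow>
        if i = 0 then projl (u j) else ed j ! (i - 1))"
    define w where "w = (\<lambda>x\<in>\<Union>j\<in>?J. class_vars X s j. snd (projr (u x)))"
    have uV: "u x \<in> verts (glued L R A (\<lambda>_. G))" if "x \<in> X" for x using u that by (simp add: PiE_iff)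
    have uNone: "u x = Inl (v (base_var x))" "v (base_var x) \<in> verts A" if x: "x \<in> X" "s x = None" for x
    proof -
      have l: "isl (u x)" using copy_shape_eq(1)[OF uK x(1) x(1)] x(2) by (simp add: s_def)
      have "v (base_var x) = projl (u x)"
        using base_vars_memI(1)[of x X s ?k ?J, OF x] by (simp add: v_def base_var_def)
      then show "u x = Inl (v (base_var x))" using l by simp
      then show "v (base_var x) \<in> verts A" using uV[OF x(1)] by (auto simp: glued_def)
    qed
    have uSome: "u x = Inr (ed j, w x)" "ed j \<in> rel A R" "w x \<in> verts G - roots L R G"
      if x: "x \<in> X" "s x = Some j" for x j
    proof -
      have j: "j \<in> ?J" using J x by blast
      have "(x, rep j) \<in> same_copy X u" unfolding uK using Kiff rep[OF j] x by simp
      then obtain e a b where e: "u x = Inr (e, a)" "u (rep j) = Inr (e, b)"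
        by (auto simp: same_copy_def)
      have "x \<in> (\<Union>j\<in>?J. class_vars X s j)" using x j by (auto simp: class_vars_def)
      then have "w x = a" using e by (simp add: w_def)
      then show 1: "u x = Inr (ed j, w x)" using e by (simp add: ed_def)
      show "ed j \<in> rel A R" "w x \<in> verts G - roots L R G"
        using uV[OF x(1)] unfolding 1 by (auto simp: glued_def)
    qed
    have edge: "edge ?k v j = ed j" if j: "j \<in> ?J" for j
    proof (rule nth_equalityI)
      have "ed j \<in> rel A R" using uSome(2)[OF rep[OF j]] .
      then have l: "length (ed j) = ?k" using is_structD(2)[OF A] by simp
      then show "length (edge ?k v j) = length (ed j)" by simp
      fix i assume "i < length (edge ?k v j)"
      then have i: "Suc i \<in> {1..?k}" by simp
      have "edge ?k v j ! (Suc i - 1) = v (edge_var (Suc i) j)" using i by (rule edge_nth)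
      also have "\<dots> = ed j ! i"
        using base_vars_memI(2)[OF j i, of X s] by (simp add: v_def edge_var_def)
      finally show "edge ?k v j ! i = ed j ! i" by simp
    qed
    have "is_conf L R X ?J s (const_conf A G v w)"
      unfolding is_conf_const_conf[OF A G]
    proof (intro conjI ballI)
      show "edge ?k v j \<in> rel A R" if "j \<in> ?J" for j using edge[OF that] uSome(2)[OF rep[OF that]] by simp
      show "inj_on (edge ?k v) ?J"
      proof (rule inj_onI)
        fix i j assume i: "i \<in> ?J" and j: "j \<in> ?J" and "edge ?k v i = edge ?k v j"
        then have "(rep i, rep j) \<in> same_copy X u"
          using uSome(1)[OF rep[OF i]] uSome(1)[OF rep[OF j]] rep[OF i] rep[OF j] edge
          by (auto simp: same_copy_def)
        then show "i = j" unfolding uK using Kiff rep[OF i] rep[OF j] by simp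
      qed
      show "case s x of None \<Rightarrow> v (base_var x) \<in> verts A | Some j \<Rightarrow> j \<in> ?J \<and> w x \<in> verts G - roots L R G"
        if "x \<in> X" for x
        using uNone(2)[OF that] uSome(3)[OF that] J[OF _ that] by (auto split: option.splits)
    qed
    moreover have "v z \<in> verts A" if z: "z \<in> base_vars ?k X ?J s" for z
    proof -
      from z consider x where "x \<in> X" "s x = None" "z = base_var x" | i j where "j \<in> ?J" "i \<in> {1..?k}" "z = edge_var i j"
        unfolding base_vars_def by blast
      then show ?thesis
      proof cases
        case 1
        then show ?thesis using uNone(2) by blast
      next
        case 2
        then have "v z \<in> set (edge ?k v j)" by (simp add: set_edge)
        moreover have "ed j \<in> rel A R" using uSome(2)[OF rep[OF 2(1)]] .
        ultimately show ?thesis using is_structD(1)[OF A, of R "ed j"] edge[OF 2(1)] by auto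
      qed
    qed
    then have "v \<in> base_vars ?k X ?J s \<rightarrow>\<^sub>E verts A" by (auto simp: v_def)
    moreover have "w \<in> (\<Union>j\<in>?J. class_vars X s j) \<rightarrow>\<^sub>E verts G"
    proof (rule PiE_I)
      fix x assume "x \<in> (\<Union>j\<in>?J. class_vars X s j)"
      then obtain j where "x \<in> X" "s x = Some j" by (auto simp: class_vars_def)
      then show "w x \<in> verts G" using uSome(3) by blast
    qed (simp add: w_def)
    ultimately have "(v, w) \<in> glued_confs L R X s A G" by (simp add: glued_confs_def)
    moreover have "u = ?f (v, w)"
    proof
      fix x
      show "u x = ?f (v, w) x"
      proof (cases "x \<in> X")
        case True
        then show ?thesis using uNone(1)[OF True] uSome(1)[OF True] edge J[OF _ True]
          by (auto simp: pt split: option.splits)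
      next
        case False
        then show ?thesis using u by (simp add: PiE_iff extensional_def)
      qed
    qed
    ultimately show "u \<in> ?f ` glued_confs L R X s A G" by blast
  qed
qed

lemma bij_betw_restrict_pred:
  "bij_betw f S T \<Longrightarrow> (\<And>x. x \<in> S \<Longrightarrow> P x \<longleftrightarrow> Q (f x)) \<Longrightarrow> bij_betw f {x \<in> S. P x} {y \<in> T. Q y}"
  unfolding bij_betw_def inj_on_def by auto

lemma finite_edge_names: "finite X \<Longrightarrow> finite (edge_names X s)"
proof -
  assume "finite X"
  moreover have "edge_names X s \<subseteq> (\<lambda>x. the (s x)) ` X" by (force simp: edge_names_def)
  ultimately show ?thesis using finite_surj by blast
qed

lemma finite_base_vars: "finite X \<Longrightarrow> finite J \<Longrightarrow> finite (base_vars k X J s)"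
  by (simp add: base_vars_def)

lemma glued_confs_iff:
  assumes A: "is_struct (base_language L R) A" and G: "is_gadget L R G"
  shows "(v, w) \<in> glued_confs L R X s A G \<longleftrightarrow>
    (v \<in> base_vars (arity L R) X (edge_names X s) s \<rightarrow>\<^sub>E verts A \<and>
      (\<forall>j\<in>edge_names X s. edge (arity L R) v j \<in> rel A R) \<and> inj_on (edge (arity L R) v) (edge_names X s)) \<and>
    (w \<in> (\<Union>j\<in>edge_names X s. class_vars X s j) \<rightarrow>\<^sub>E verts G \<and>
      (\<forall>j\<in>edge_names X s. \<forall>x\<in>class_vars X s j. w x \<notin> roots L R G))"
proof -
  let ?J = "edge_names X s" and ?k = "arity L R"
  have "(\<forall>x\<in>X. case s x of None \<Rightarrow> v (base_var x) \<in> verts A | Some j \<Rightarrow> j \<in> ?J \<and> w x \<in> verts G - roots L R G) \<longleftrightarrow>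
      (\<forall>j\<in>?J. \<forall>x\<in>class_vars X s j. w x \<notin> roots L R G)"
    if v: "v \<in> base_vars ?k X ?J s \<rightarrow>\<^sub>E verts A" and w: "w \<in> (\<Union>j\<in>?J. class_vars X s j) \<rightarrow>\<^sub>E verts G"
  proof -
    have vx: "v (base_var x) \<in> verts A" if "x \<in> X" "s x = None" for x
      using PiE_mem[OF v] base_vars_memI(1)[of x X s] that by blast
    have j: "j \<in> ?J" "x \<in> class_vars X s j" if "x \<in> X" "s x = Some j" for x j
      using that by (auto simp: edge_names_def class_vars_def)
    have wx: "w x \<in> verts G" if "x \<in> X" "s x = Some j" for x j
      using PiE_mem[OF w] j[OF that] by blast
    have cl: "x \<in> X" "s x = Some j" if "x \<in> class_vars X s j" for x j using that by (auto simp: class_vars_def)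
    show ?thesis
    proof (intro iffI ballI)
      fix j x assume a: "\<forall>x\<in>X. case s x of None \<Rightarrow> v (base_var x) \<in> verts A
          | Some j \<Rightarrow> j \<in> ?J \<and> w x \<in> verts G - roots L R G" and x: "x \<in> class_vars X s j"
      show "w x \<notin> roots L R G" using bspec[OF a cl(1)[OF x]] cl(2)[OF x] by simp
    next
      fix x assume "\<forall>j\<in>?J. \<forall>x\<in>class_vars X s j. w x \<notin> roots L R G" "x \<in> X"
      then show "case s x of None \<Rightarrow> v (base_var x) \<in> verts A | Some j \<Rightarrow> j \<in> ?J \<and> w x \<in> verts G - roots L R G"
        using vx[of x] wx[of x] j[of x] by (auto split: option.splits)
    qed
  qed
  then show ?thesis unfolding glued_confs_def mem_Collect_eq prod.case is_conf_const_conf[OF A G] by blast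
qed

text \<open>\<open>\<Theta>\<close> asks whether some configuration with the given types has the
  property; the transfer property of \<open>decided\<close> makes the answer the same for all
  configurations with these types.\<close>

lemma decided_by_type:
  fixes P :: "('l, 'a, 'b) conf \<Rightarrow> bool"
  assumes "decided L R X J s P"
  obtains F \<Gamma> \<Gamma>0 \<Theta> where "deciding L R X J s F \<Gamma> \<Gamma>0"
    and "\<And>c. is_conf L R X J s c \<Longrightarrow> P c \<longleftrightarrow> \<Theta> {\<alpha> \<in> F. sat (base c) (bval c) \<alpha>}
      (\<lambda>j\<in>J. {\<gamma> \<in> \<Gamma> j. sat (gadget_of (arity L R) c j) (gval c) \<gamma>}) {\<gamma> \<in> \<Gamma>0. sat (default c) (gval c) \<gamma>}"
proof -
  obtain F \<Gamma> \<Gamma>0 where d: "deciding L R X J s F \<Gamma> \<Gamma>0"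
    and P: "\<And>c c'. is_conf L R X J s c \<Longrightarrow> is_conf L R X J s c' \<Longrightarrow>
      conf_agree (arity L R) J F \<Gamma> \<Gamma>0 c c' \<Longrightarrow> P c \<Longrightarrow> P c'"
    using assms unfolding decided_def by blast
  let ?F = "\<lambda>c :: ('l, 'a, 'b) conf. {\<alpha> \<in> F. sat (base c) (bval c) \<alpha>}"
  let ?\<Gamma> = "\<lambda>c :: ('l, 'a, 'b) conf. \<lambda>j\<in>J. {\<gamma> \<in> \<Gamma> j. sat (gadget_of (arity L R) c j) (gval c) \<gamma>}"
  let ?D0 = "\<lambda>c :: ('l, 'a, 'b) conf. {\<gamma> \<in> \<Gamma>0. sat (default c) (gval c) \<gamma>}"
  define \<Theta> where "\<Theta> T U D \<longleftrightarrow> (\<exists>c. is_conf L R X J s c \<and> ?F c = T \<and> ?\<Gamma> c = U \<and> ?D0 c = D \<and> P c)" for T U D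
  have "P c \<longleftrightarrow> \<Theta> (?F c) (?\<Gamma> c) (?D0 c)" if c: "is_conf L R X J s c" for c
  proof
    assume "P c"
    then show "\<Theta> (?F c) (?\<Gamma> c) (?D0 c)" unfolding \<Theta>_def using c by blast
  next
    assume "\<Theta> (?F c) (?\<Gamma> c) (?D0 c)"
    then obtain c' where c': "is_conf L R X J s c'" "?F c' = ?F c" "?\<Gamma> c' = ?\<Gamma> c" "?D0 c' = ?D0 c" "P c'"
      unfolding \<Theta>_def by blast
    have "{\<gamma> \<in> \<Gamma> j. sat (gadget_of (arity L R) c' j) (gval c') \<gamma>} = {\<gamma> \<in> \<Gamma> j. sat (gadget_of (arity L R) c j) (gval c) \<gamma>}"
      if "j \<in> J" for j using fun_cong[OF c'(3), of j] that by simp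
    then have "conf_agree (arity L R) J F \<Gamma> \<Gamma>0 c' c"
      using c'(2,4) unfolding conf_agree_def agree_def by blast
    then show "P c" using P[OF c'(1) c] c'(5) by blast
  qed
  then show thesis using d that by blast
qed

text \<open>By \<open>sat_local_conf\<close> and \<open>decided_sat\<close>, the truth of the
  formula is a function of the local types in the base, in each class and in the default gadget.
  Once all these types are fixed, the base valuation and the valuation of each class vary
  independently, so the count becomes a sum of products.\<close>

lemma copy_count:
  fixes L :: "'l language" and \<phi> :: "'l fm" and K :: "(nat \<times> nat) set"
  assumes L: "finite_relational_language L" and k: "1 \<le> arity L R"
    and \<phi>: "wf_fm L \<phi>" "nbhd_determined L {} r \<phi>" and ne: "fv \<phi> \<noteq> {}"
  defines "X \<equiv> fv \<phi>" and "s \<equiv> copy_shape K"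
  defines "J \<equiv> edge_names X s"
  obtains F \<Gamma> \<Gamma>0 \<Theta> where "deciding L R X J s F \<Gamma> \<Gamma>0"
    and "\<And>(A :: ('l, 'a) fo_struct) (G :: ('l, 'b) fo_struct).
      is_struct (base_language L R) A \<Longrightarrow> is_gadget L R G \<Longrightarrow>
      card {u \<in> X \<rightarrow>\<^sub>E verts (glued L R A (\<lambda>_. G)). same_copy X u = K \<and> sat (glued L R A (\<lambda>_. G)) u \<phi>} =
      (\<Sum>(T, U)\<in>Pow F \<times> (\<Pi>\<^sub>E j\<in>J. Pow (\<Gamma> j)). of_bool (\<Theta> T U (default_type L R (Suc r) \<Gamma>0 G)) *
         base_count L R (Suc r) X J s F T A * (\<Prod>j\<in>J. class_count L R (Suc r) (class_vars X s j) (\<Gamma> j) (U j) G))"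
proof (cases "\<exists>u0 :: nat \<Rightarrow> 'a + 'a list \<times> 'b. same_copy X u0 = K")
  case False
  \<comment> \<open>A relation that no tuple realizes contributes nothing; empty families with
    \<open>\<Theta>\<close> false give the value 0.\<close>
  then have e: "{u \<in> X \<rightarrow>\<^sub>E verts (glued L R A (\<lambda>_. G)). same_copy X u = K \<and> sat (glued L R A (\<lambda>_. G)) u \<phi>} = {}"
    for A :: "('l, 'a) fo_struct" and G :: "('l, 'b) fo_struct" by blast
  show ?thesis
    by (rule that[of "{}" "\<lambda>_. {}" "{}" "\<lambda>_ _ _. False"]) (simp add: deciding_def fms_over_def, simp only: e, simp)
next
  case True
  then obtain u0 :: "nat \<Rightarrow> 'a + 'a list \<times> 'b" where u0: "same_copy X u0 = K" by blast
  let ?k = "arity L R" and ?r = "Suc r"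
  have L0: "const_syms L = {}" using L by (simp add: finite_relational_language_def)
  have fin: "finite X" "finite J" by (simp_all add: X_def J_def finite_edge_names)
  have dec: "decided L R X J s (\<lambda>c :: ('l, 'a, 'b) conf. sat (conf_glued L R c) (point ?k s c) \<phi>)"
    using decided_sat[OF L0 \<phi>(1) fin] by (simp add: X_def)
  obtain F \<Gamma> \<Gamma>0 \<Theta> where d: "deciding L R X J s F \<Gamma> \<Gamma>0"
    and \<Theta>: "\<And>c :: ('l, 'a, 'b) conf. is_conf L R X J s c \<Longrightarrow> sat (conf_glued L R c) (point ?k s c) \<phi> \<longleftrightarrow>
      \<Theta> {\<alpha> \<in> F. sat (base c) (bval c) \<alpha>}
      (\<lambda>j\<in>J. {\<gamma> \<in> \<Gamma> j. sat (gadget_of ?k c j) (gval c) \<gamma>}) {\<gamma> \<in> \<Gamma>0. sat (default c) (gval c) \<gamma>}"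
    using decided_by_type[OF dec] by blast
  have "card {u \<in> X \<rightarrow>\<^sub>E verts (glued L R A (\<lambda>_. G)). same_copy X u = K \<and> sat (glued L R A (\<lambda>_. G)) u \<phi>} =
      (\<Sum>(T, U)\<in>Pow F \<times> (\<Pi>\<^sub>E j\<in>J. Pow (\<Gamma> j)). of_bool (\<Theta> T U (default_type L R ?r \<Gamma>0 G)) *
         base_count L R ?r X J s F T A * (\<Prod>j\<in>J. class_count L R ?r (class_vars X s j) (\<Gamma> j) (U j) G))"
    if A: "is_struct (base_language L R) A" and G: "is_gadget L R G"
    for A :: "('l, 'a) fo_struct" and G :: "('l, 'b) fo_struct"
  proof -
    let ?B = "glued L R A (\<lambda>_. G)" and ?S = "glued_confs L R X s A G"
    let ?C = "class_vars X s" and ?D = "default_type L R ?r \<Gamma>0 G"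
    define tA where "tA v = {\<alpha> \<in> F. sat (local_base L R ?r X J s A v) v \<alpha>}" for v
    define tG where "tG w j = {\<gamma> \<in> \<Gamma> j. sat (local_gadget L R ?r G (w ` ?C j)) w \<gamma>}" for w j
    have sat: "sat ?B (restrict (point ?k s (const_conf A G v w)) X) \<phi> \<longleftrightarrow> \<Theta> (tA v) (\<lambda>j\<in>J. tG w j) ?D"
      if vw: "(v, w) \<in> ?S" for v w
    proof -
      let ?c = "local_conf L R ?r X J s A G v w"
      have c: "is_conf L R X J s (const_conf A G v w)" using vw by (simp add: glued_confs_def J_def)
      then have inj: "inj_on (edge ?k v) J" using is_conf_const_conf[OF A G] by blast
      have c': "is_conf L R X J s ?c" using local_conf_is_conf[OF L0 k _ c] ne by (simp add: X_def)
      have "sat ?B (restrict (point ?k s (const_conf A G v w)) X) \<phi> \<longleftrightarrow> sat ?B (point ?k s (const_conf A G v w)) \<phi>"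
        by (intro sat_cong) (simp add: X_def)
      also have "\<dots> \<longleftrightarrow> sat (conf_glued L R ?c) (point ?k s ?c) \<phi>"
      proof -
        have "?B = conf_glued L R (const_conf A G v w)" by (simp add: conf_glued_def const_conf_def)
        then show ?thesis using sat_local_conf[OF L k \<phi> ne] c by (simp only: X_def)
      qed
      also have "\<dots> \<longleftrightarrow> \<Theta> {\<alpha> \<in> F. sat (base ?c) (bval ?c) \<alpha>}
          (\<lambda>j\<in>J. {\<gamma> \<in> \<Gamma> j. sat (gadget_of ?k ?c j) (gval ?c) \<gamma>}) {\<gamma> \<in> \<Gamma>0. sat (default ?c) (gval ?c) \<gamma>}"
        by (rule \<Theta>[OF c'])
      also have "{\<alpha> \<in> F. sat (base ?c) (bval ?c) \<alpha>} = tA v" by (simp add: tA_def local_conf_def)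
      also have "(\<lambda>j\<in>J. {\<gamma> \<in> \<Gamma> j. sat (gadget_of ?k ?c j) (gval ?c) \<gamma>}) = (\<lambda>j\<in>J. tG w j)"
      proof (rule restrict_ext)
        fix j assume "j \<in> J"
        moreover have "gval ?c = w" by (simp add: local_conf_def)
        ultimately show "{\<gamma> \<in> \<Gamma> j. sat (gadget_of ?k ?c j) (gval ?c) \<gamma>} = tG w j"
          by (simp add: tG_def gadget_of_local_conf[OF inj])
      qed
      also have "{\<gamma> \<in> \<Gamma>0. sat (default ?c) (gval ?c) \<gamma>} = ?D"
      proof -
        have "sat (local_gadget L R ?r G {}) w \<gamma> \<longleftrightarrow> sat (local_gadget L R ?r G {}) (\<lambda>_. undefined) \<gamma>" if "\<gamma> \<in> \<Gamma>0" for \<gamma>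
          using d that by (intro sat_cong) (auto simp: deciding_def fms_over_def)
        then show ?thesis by (auto simp: default_type_def local_conf_def)
      qed
      finally show ?thesis .
    qed
    have "bij_betw (\<lambda>(v, w). restrict (point ?k s (const_conf A G v w)) X)
        {(v, w) \<in> ?S. \<Theta> (tA v) (\<lambda>j\<in>J. tG w j) ?D}
        {u \<in> {u \<in> X \<rightarrow>\<^sub>E verts ?B. same_copy X u = K}. sat ?B u \<phi>}"
      using bij_betw_restrict_pred[OF bij_glued_confs[OF A G u0, folded s_def],
          of "\<lambda>(v, w). \<Theta> (tA v) (\<lambda>j\<in>J. tG w j) ?D" "\<lambda>u. sat ?B u \<phi>"] sat
      by (simp add: split_beta' del: restrict_apply)
    then have "card {(v, w) \<in> ?S. \<Theta> (tA v) (\<lambda>j\<in>J. tG w j) ?D} =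
        card {u \<in> {u \<in> X \<rightarrow>\<^sub>E verts ?B. same_copy X u = K}. sat ?B u \<phi>}"
      by (rule bij_betw_same_card)
    moreover have "{u \<in> X \<rightarrow>\<^sub>E verts ?B. same_copy X u = K \<and> sat ?B u \<phi>} =
        {u \<in> {u \<in> X \<rightarrow>\<^sub>E verts ?B. same_copy X u = K}. sat ?B u \<phi>}" by blast
    ultimately have "card {u \<in> X \<rightarrow>\<^sub>E verts ?B. same_copy X u = K \<and> sat ?B u \<phi>} =
        card {(v, w) \<in> ?S. \<Theta> (tA v) (\<lambda>j\<in>J. tG w j) ?D}" by (simp only:)
    also have "\<dots> = (\<Sum>i\<in>Pow F \<times> (\<Pi>\<^sub>E j\<in>J. Pow (\<Gamma> j)).
        card {x \<in> {(v, w) \<in> ?S. \<Theta> (tA v) (\<lambda>j\<in>J. tG w j) ?D}. (case x of (v, w) \<Rightarrow> (tA v, \<lambda>j\<in>J. tG w j)) = i})"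
    proof (rule card_eq_sum_fibres)
      have fA: "finite (verts A)" "finite (verts G)"
        using A is_gadgetD(1)[OF G] by (auto simp: is_struct_def)
      have "?S \<subseteq> (base_vars ?k X J s \<rightarrow>\<^sub>E verts A) \<times> ((\<Union>j\<in>J. ?C j) \<rightarrow>\<^sub>E verts G)"
        by (auto simp: glued_confs_def J_def)
      moreover have "finite (\<Union>j\<in>J. ?C j)" using fin by (simp add: class_vars_def)
      ultimately have "finite ?S"
        using fA fin by (meson finite_PiE finite_SigmaI finite_base_vars finite_subset)
      then show "finite {(v, w) \<in> ?S. \<Theta> (tA v) (\<lambda>j\<in>J. tG w j) ?D}" by (rule rev_finite_subset) blast
      show "finite (Pow F \<times> (\<Pi>\<^sub>E j\<in>J. Pow (\<Gamma> j)))"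
        using d fin by (auto simp: deciding_def fms_over_def intro!: finite_PiE)
      show "(\<lambda>(v, w). (tA v, \<lambda>j\<in>J. tG w j)) ` {(v, w) \<in> ?S. \<Theta> (tA v) (\<lambda>j\<in>J. tG w j) ?D}
          \<subseteq> Pow F \<times> (\<Pi>\<^sub>E j\<in>J. Pow (\<Gamma> j))"
        by (auto simp: tA_def tG_def)
    qed
    also have "\<dots> = (\<Sum>(T, U)\<in>Pow F \<times> (\<Pi>\<^sub>E j\<in>J. Pow (\<Gamma> j)). of_bool (\<Theta> T U ?D) *
         base_count L R ?r X J s F T A * (\<Prod>j\<in>J. class_count L R ?r (?C j) (\<Gamma> j) (U j) G))"
    proof (rule sum.cong[OF refl], clarify)
      fix T U assume U: "U \<in> (\<Pi>\<^sub>E j\<in>J. Pow (\<Gamma> j))"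
      let ?V = "{v \<in> base_vars ?k X J s \<rightarrow>\<^sub>E verts A. (\<forall>j\<in>J. edge ?k v j \<in> rel A R) \<and> inj_on (edge ?k v) J \<and> tA v = T}"
      let ?W = "{w \<in> (\<Union>j\<in>J. ?C j) \<rightarrow>\<^sub>E verts G. \<forall>j\<in>J. (\<forall>x\<in>?C j. w x \<notin> roots L R G) \<and> tG w j = U j}"
      have tU: "(\<lambda>j\<in>J. tG w j) = U \<longleftrightarrow> (\<forall>j\<in>J. tG w j = U j)" for w
      proof
        assume "\<forall>j\<in>J. tG w j = U j"
        then show "(\<lambda>j\<in>J. tG w j) = U"
          using U by (intro extensionalityI[of _ J]) (auto simp: PiE_iff)
      qed auto
      \<comment> \<open>The conditions separate into one on \<open>v\<close> and one on
        \<open>w\<close>, which makes the set a Cartesian product for each pair of types.\<close>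
      have mem: "(v, w) \<in> ?S \<and> tA v = T \<and> (\<lambda>j\<in>J. tG w j) = U \<longleftrightarrow> v \<in> ?V \<and> w \<in> ?W" for v w
        unfolding glued_confs_iff[OF A G] J_def[symmetric] tU by blast
      have eq: "{x \<in> {(v, w) \<in> ?S. \<Theta> (tA v) (\<lambda>j\<in>J. tG w j) ?D}. (case x of (v, w) \<Rightarrow> (tA v, \<lambda>j\<in>J. tG w j)) = (T, U)} =
          (if \<Theta> T U ?D then ?V \<times> ?W else {})" (is "?l = ?rhs")
      proof (rule set_eqI)
        fix x :: "(nat \<Rightarrow> 'a) \<times> (nat \<Rightarrow> 'b)"
        obtain v w where x: "x = (v, w)" by (cases x)
        have "x \<in> ?l \<longleftrightarrow> ((v, w) \<in> ?S \<and> tA v = T \<and> (\<lambda>j\<in>J. tG w j) = U) \<and> \<Theta> T U ?D"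
          unfolding x by auto
        also have "\<dots> \<longleftrightarrow> x \<in> ?rhs" unfolding mem x by simp
        finally show "x \<in> ?l \<longleftrightarrow> x \<in> ?rhs" .
      qed
      have cW: "card ?W = (\<Prod>j\<in>J. class_count L R ?r (?C j) (\<Gamma> j) (U j) G)"
        unfolding class_count_def tG_def
      proof (rule card_PiE_classes[OF fin(2)])
        show "?C i \<inter> ?C j = {}" if "i \<noteq> j" for i j using that by (auto simp: class_vars_def)
        fix j and w w' :: "nat \<Rightarrow> 'b" assume j: "j \<in> J" and ww: "\<And>x. x \<in> ?C j \<Longrightarrow> w x = w' x"
        have "w ` ?C j = w' ` ?C j" using ww by (rule image_cong[OF refl])
        moreover have "sat M w \<gamma> \<longleftrightarrow> sat M w' \<gamma>" if "\<gamma> \<in> \<Gamma> j" for \<gamma> and M :: "('l, 'b) fo_struct"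
        proof (rule sat_cong)
          have "fv \<gamma> \<subseteq> ?C j" using d that j unfolding deciding_def fms_over_def by blast
          then show "w x = w' x" if "x \<in> fv \<gamma>" for x using that ww by blast
        qed
        then have "{\<gamma> \<in> \<Gamma> j. sat M w \<gamma>} = {\<gamma> \<in> \<Gamma> j. sat M w' \<gamma>}" for M :: "('l, 'b) fo_struct" by blast
        ultimately show "(\<forall>x\<in>?C j. w x \<notin> roots L R G) \<and> {\<gamma> \<in> \<Gamma> j. sat (local_gadget L R ?r G (w ` ?C j)) w \<gamma>} = U j \<longleftrightarrow>
            (\<forall>x\<in>?C j. w' x \<notin> roots L R G) \<and> {\<gamma> \<in> \<Gamma> j. sat (local_gadget L R ?r G (w' ` ?C j)) w' \<gamma>} = U j"
          using ww by (simp cong: ball_cong)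
      qed
      have cV: "card ?V = base_count L R ?r X J s F T A" by (simp add: base_count_def tA_def)
      show "card {x \<in> {(v, w) \<in> ?S. \<Theta> (tA v) (\<lambda>j\<in>J. tG w j) ?D}. (case x of (v, w) \<Rightarrow> (tA v, \<lambda>j\<in>J. tG w j)) = (T, U)} =
          of_bool (\<Theta> T U ?D) * base_count L R ?r X J s F T A * (\<Prod>j\<in>J. class_count L R ?r (?C j) (\<Gamma> j) (U j) G)"
        unfolding eq by (simp add: card_cartesian_product cW cV)
    qed
    finally show ?thesis .
  qed
  then show ?thesis using that[OF d] by blast
qed

section \<open>Counts as Stone pairings\<close>

lemma stone_pairing_mult:
  assumes "is_struct L A"
  shows "stone_pairing \<phi> A * real (card (verts A)) ^ card (fv \<phi>) =
    real (card {v \<in> fv \<phi> \<rightarrow>\<^sub>E verts A. sat A v \<phi>})"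
  using assms by (simp add: stone_pairing_def is_struct_def)

lemma stone_pairing_bounds:
  assumes "is_struct L A"
  shows "0 \<le> stone_pairing \<phi> A" "stone_pairing \<phi> A \<le> 1"
proof -
  have fin: "finite (verts A)" "verts A \<noteq> {}" using assms by (auto simp: is_struct_def)
  show "0 \<le> stone_pairing \<phi> A" by (simp add: stone_pairing_def)
  have "card {v \<in> fv \<phi> \<rightarrow>\<^sub>E verts A. sat A v \<phi>} \<le> card (fv \<phi> \<rightarrow>\<^sub>E verts A)"
    using fin by (intro card_mono finite_PiE) auto
  also have "\<dots> = card (verts A) ^ card (fv \<phi>)" by (simp add: card_PiE)
  finally have "real (card {v \<in> fv \<phi> \<rightarrow>\<^sub>E verts A. sat A v \<phi>}) \<le> real (card (verts A)) ^ card (fv \<phi>)"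
    by (metis of_nat_le_iff of_nat_power)
  then show "stone_pairing \<phi> A \<le> 1" using fin by (simp add: stone_pairing_def field_simps card_gt_0_iff)
qed

lemma type_eq_iff_pattern:
  assumes "fms_over L W F" "T \<subseteq> F" "verts A \<noteq> {}"
  shows "{\<alpha> \<in> F. sat A v \<alpha>} = T \<longleftrightarrow> sat A v (pattern F T)"
  unfolding pattern(3)[OF assms(1,3)] using assms(2) by blast

text \<open>The type condition, the presence of the edges and their distinctness are put into one
  formula and evaluated in the ball around the tuple. Cutting down to the ball loses none of these
  edges, because their entries are centers.\<close>

lemma base_count_pairing:
  fixes L :: "'l language"
  assumes L: "finite_relational_language L" and fin: "finite X" "finite J"
    and F: "fms_over (base_language L R) (base_vars (arity L R) X J s) F" and T: "T \<subseteq> F"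
    and ne: "base_vars (arity L R) X J s \<noteq> {}"
  obtains \<alpha> where "\<alpha> \<in> local_fms (base_language L R)"
    and "\<And>A :: ('l, 'a) fo_struct. is_struct (base_language L R) A \<Longrightarrow>
      real (base_count L R r X J s F T A) = stone_pairing \<alpha> A * real (card (verts A)) ^ card (base_vars (arity L R) X J s)"
proof -
  let ?k = "arity L R" and ?Y = "base_vars (arity L R) X J s" and ?L = "base_language L R"
  let ?ys = "sorted_list_of_set ?Y" and ?js = "sorted_list_of_set J"
  define \<psi> where "\<psi> = Conj (pattern F T) (Conj (Conjs (map (is_edge_fm L R) ?js))
    (Conjs (map (\<lambda>(i, j). Neg (edges_eq_fm ?k i j)) (filter (\<lambda>(i, j). i \<noteq> j) (List.product ?js ?js)))))"
  define \<alpha> where "\<alpha> = ball_fm ?L r ?ys id \<psi>"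
  have ys: "set ?ys = ?Y" and js: "set ?js = J" using fin by (simp_all add: finite_base_vars)
  have fL: "finite (rel_syms ?L)" "finite (const_syms ?L)" and L0: "const_syms ?L = {}"
    using L by (auto simp: finite_relational_language_def)
  have edY: "(\<lambda>i. edge_var i j) ` {1..?k} \<subseteq> ?Y" if "j \<in> J" for j using that by (auto simp: base_vars_def)
  have wf: "wf_fm ?L \<psi>"
    using pattern(1)[OF F] fin by (auto simp: \<psi>_def is_edge_fm(1) edges_eq_fm(1))
  have "fv (edges_eq_fm ?k i j :: 'l fm) \<subseteq> ?Y" if "i \<in> J" "j \<in> J" for i j
    using edY that unfolding edges_eq_fm by blast
  moreover have "fv (is_edge_fm L R j) \<subseteq> ?Y" if "j \<in> J" for j using edY[OF that] unfolding is_edge_fm .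
  ultimately have fv\<psi>: "id ` fv \<psi> \<subseteq> set ?ys"
    using pattern(2)[OF F, of T] unfolding ys \<psi>_def by (fastforce simp: fin)
  have fv: "fv \<alpha> = ?Y" unfolding \<alpha>_def fv_ball_fm[OF fv\<psi>] ys ..
  have loc: "\<alpha> \<in> local_fms ?L"
    using ball_fm_constant_local[OF fL wf fv\<psi>, of r] L0 unfolding \<alpha>_def local_fms_def constant_local_fms_def by simp
  have "real (base_count L R r X J s F T A) = stone_pairing \<alpha> A * real (card (verts A)) ^ card ?Y"
    if A: "is_struct ?L A" for A :: "('l, 'a) fo_struct"
  proof -
    have "sat A v \<alpha> \<longleftrightarrow> (\<forall>j\<in>J. edge ?k v j \<in> rel A R) \<and> inj_on (edge ?k v) J \<and>
        {\<alpha> \<in> F. sat (local_base L R r X J s A v) v \<alpha>} = T" if v: "v \<in> ?Y \<rightarrow>\<^sub>E verts A" for v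
    proof -
      let ?M = "local_base L R r X J s A v"
      have vY: "v ` set ?ys \<subseteq> verts A" using v unfolding ys by auto
      have sup: "v ` ?Y \<subseteq> verts ?M" using nbhd_superset[of "v ` ?Y" ?L A r] by (simp add: local_base_def)
      have ne': "verts ?M \<noteq> {}" using sup ne by blast
      have "sat A v \<alpha> \<longleftrightarrow> sat ?M v \<psi>"
        unfolding \<alpha>_def sat_ball_fm[OF fL A wf fv\<psi> vY] ys L0 by (simp add: local_base_def)
      also have "\<dots> \<longleftrightarrow> sat ?M v (pattern F T) \<and> (\<forall>j\<in>J. edge ?k v j \<in> rel ?M R) \<and>
          (\<forall>i\<in>J. \<forall>j\<in>J. i \<noteq> j \<longrightarrow> edge ?k v i \<noteq> edge ?k v j)"
        by (auto simp: \<psi>_def sat_Conjs[OF ne'] is_edge_fm(3) edges_eq_fm(3)[OF ne'] fin)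
      also have "(\<forall>j\<in>J. edge ?k v j \<in> rel ?M R) \<longleftrightarrow> (\<forall>j\<in>J. edge ?k v j \<in> rel A R)"
      proof (rule ball_cong[OF refl])
        fix j assume "j \<in> J"
        then have "set (edge ?k v j) \<subseteq> verts ?M" using edY sup unfolding set_edge by blast
        then show "edge ?k v j \<in> rel ?M R \<longleftrightarrow> edge ?k v j \<in> rel A R" by (auto simp: local_base_def)
      qed
      also have "(\<forall>i\<in>J. \<forall>j\<in>J. i \<noteq> j \<longrightarrow> edge ?k v i \<noteq> edge ?k v j) \<longleftrightarrow> inj_on (edge ?k v) J"
        unfolding inj_on_def by blast
      finally show ?thesis unfolding type_eq_iff_pattern[OF F T ne'] by blast
    qed
    then have "{v \<in> ?Y \<rightarrow>\<^sub>E verts A. sat A v \<alpha>} = {v \<in> ?Y \<rightarrow>\<^sub>E verts A. (\<forall>j\<in>J. edge ?k v j \<in> rel A R) \<and>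
        inj_on (edge ?k v) J \<and> {\<alpha> \<in> F. sat (local_base L R r X J s A v) v \<alpha>} = T}" by blast
    then show ?thesis using stone_pairing_mult[OF A, of \<alpha>] unfolding fv base_count_def by simp
  qed
  then show thesis using loc that by blast
qed

text \<open>The variables of the class are renamed by \<open>\<rho>\<close> to
  \<open>{1..card C}\<close>, because membership in \<open>constant_local_fms_upto\<close> restricts
  the names of the free variables and not only their number.\<close>

lemma class_count_pairing:
  fixes L :: "'l language"
  assumes L: "finite_relational_language L" and k: "1 \<le> arity L R" and fin: "finite C"
    and \<Delta>: "fms_over (gadget_language L R) C \<Delta>" and Q: "Q \<subseteq> \<Delta>"
  obtains \<gamma> where "\<gamma> \<in> constant_local_fms_upto (gadget_language L R) (card C)"
    and "\<And>G :: ('l, 'b) fo_struct. is_gadget L R G \<Longrightarrow>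
      real (class_count L R r C \<Delta> Q G) = stone_pairing \<gamma> G * real (card (verts G)) ^ card C"
proof -
  let ?k = "arity L R" and ?m = "card C" and ?L = "gadget_language L R"
  obtain \<rho> where \<rho>: "bij_betw \<rho> C {1..?m}"
    using ex_bij_betw_nat_finite_1[OF fin] bij_betw_inv by blast
  let ?ys = "[1..<Suc ?m]"
  define \<psi> where "\<psi> = Conj (pattern \<Delta> Q) (Conjs (map (nonroot_fm ?k) (sorted_list_of_set C)))"
  define \<gamma> where "\<gamma> = ball_fm ?L r ?ys \<rho> \<psi>"
  have ys: "set ?ys = {1..?m}" by auto
  have fL: "finite (rel_syms ?L)" "finite (const_syms ?L)" and cL: "const_syms ?L = {1..?k}"
    using L by (auto simp: finite_relational_language_def)
  have wf: "wf_fm ?L \<psi>" using pattern(1)[OF \<Delta>] fin by (auto simp: \<psi>_def nonroot_fm(1))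
  have "fv \<psi> \<subseteq> C" using pattern(2)[OF \<Delta>, of Q] nonroot_fm(2)[of ?k] fin unfolding \<psi>_def by fastforce
  then have fv\<psi>: "\<rho> ` fv \<psi> \<subseteq> set ?ys" using \<rho> unfolding ys bij_betw_def by blast
  have fv: "fv \<gamma> = {1..?m}" unfolding \<gamma>_def fv_ball_fm[OF fv\<psi>] ys ..
  have loc: "\<gamma> \<in> constant_local_fms_upto ?L ?m"
    using ball_fm_constant_local[OF fL wf fv\<psi>, of r] fv unfolding \<gamma>_def constant_local_fms_upto_def by simp
  have "real (class_count L R r C \<Delta> Q G) = stone_pairing \<gamma> G * real (card (verts G)) ^ ?m"
    if G: "is_gadget L R G" for G :: "('l, 'b) fo_struct"
  proof -
    let ?P = "\<lambda>w. (\<forall>x\<in>C. w x \<notin> roots L R G) \<and> {\<gamma> \<in> \<Delta>. sat (local_gadget L R r G (w ` C)) w \<gamma>} = Q"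
    have "sat G w \<gamma> \<longleftrightarrow> ?P (w \<circ> \<rho>)" if w: "w \<in> {1..?m} \<rightarrow>\<^sub>E verts G" for w
    proof -
      let ?M = "local_gadget L R r G ((w \<circ> \<rho>) ` C)"
      have wY: "w ` set ?ys \<subseteq> verts G" using w unfolding ys by auto
      have im: "(w \<circ> \<rho>) ` C = w ` {1..?m}" using \<rho> unfolding bij_betw_def by (metis image_comp)
      have "roots L R G \<noteq> {}" using k by (auto simp: roots_def)
      then have ne: "verts ?M \<noteq> {}"
        using nbhd_superset[of "(w \<circ> \<rho>) ` C \<union> roots L R G" ?L G r] by (auto simp: local_gadget_def)
      have "sat G w \<gamma> \<longleftrightarrow> sat ?M (w \<circ> \<rho>) \<psi>"
        unfolding \<gamma>_def sat_ball_fm[OF fL is_gadgetD(1)[OF G] wf fv\<psi> wY] ys cL im local_gadget_def roots_def ..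
      also have "\<dots> \<longleftrightarrow> (\<forall>x\<in>C. (w \<circ> \<rho>) x \<notin> roots L R ?M) \<and> sat ?M (w \<circ> \<rho>) (pattern \<Delta> Q)"
        unfolding \<psi>_def sat.simps sat_Conjs[OF ne] set_map set_sorted_list_of_set[OF fin] ball_simps
          nonroot_fm(3)[OF ne] by blast
      also have "roots L R ?M = roots L R G" by (simp add: local_gadget_def)
      finally show ?thesis unfolding type_eq_iff_pattern[OF \<Delta> Q ne] .
    qed
    then have "{w \<in> {1..?m} \<rightarrow>\<^sub>E verts G. sat G w \<gamma>} = {w \<in> {1..?m} \<rightarrow>\<^sub>E verts G. ?P (w \<circ> \<rho>)}" by blast
    also have "card \<dots> = card {w \<in> C \<rightarrow>\<^sub>E verts G. ?P w}"
    proof (rule card_PiE_reindex[OF \<rho>])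
      fix w w' :: "nat \<Rightarrow> 'b" assume ww: "\<And>x. x \<in> C \<Longrightarrow> w x = w' x"
      have "w ` C = w' ` C" using ww by (rule image_cong[OF refl])
      moreover have "sat M w \<gamma> \<longleftrightarrow> sat M w' \<gamma>" if "\<gamma> \<in> \<Delta>" for \<gamma> and M :: "('l, 'b) fo_struct"
      proof (rule sat_cong)
        have "fv \<gamma> \<subseteq> C" using \<Delta> that unfolding fms_over_def by blast
        then show "w x = w' x" if "x \<in> fv \<gamma>" for x using that ww by blast
      qed
      then have "{\<gamma> \<in> \<Delta>. sat M w \<gamma>} = {\<gamma> \<in> \<Delta>. sat M w' \<gamma>}" for M :: "('l, 'b) fo_struct" by blast
      ultimately show "?P w \<longleftrightarrow> ?P w'" using ww by (simp cong: ball_cong)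
    qed
    finally show ?thesis using stone_pairing_mult[OF is_gadgetD(1)[OF G], of \<gamma>]
      unfolding fv class_count_def by simp
  qed
  then show thesis using loc that by blast
qed

lemma class_count_no_nonroots:
  assumes "verts G = roots L R G" "C \<noteq> {}"
  shows "class_count L R r C \<Delta> Q G = 0"
proof -
  obtain x where "x \<in> C" using assms(2) by blast
  then have "{w \<in> C \<rightarrow>\<^sub>E verts G. (\<forall>x\<in>C. w x \<notin> roots L R G) \<and>
     {\<gamma> \<in> \<Delta>. sat (local_gadget L R r G (w ` C)) w \<gamma>} = Q} = {}" using assms(1) by auto
  then show ?thesis unfolding class_count_def by (simp only: card.empty)
qed

lemma convergent_of_bool:
  assumes "convergent (\<lambda>n. if P n then 1 else 0 :: real)"
  shows "(\<forall>\<^sub>F n in sequentially. P n) \<or> (\<forall>\<^sub>F n in sequentially. \<not> P n)"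
proof -
  obtain l where l: "(\<lambda>n. if P n then 1 else 0 :: real) \<longlonglongrightarrow> l" using assms by (auto simp: convergent_def)
  show ?thesis
  proof (cases "0 < l")
    case True
    from order_tendstoD(1)[OF l this] show ?thesis by (auto elim: eventually_mono split: if_splits)
  next
    case False
    then have "l < 1" by simp
    from order_tendstoD(2)[OF l this] show ?thesis by (auto elim: eventually_mono split: if_splits)
  qed
qed

text \<open>Relativized to the neighborhood of the roots, the sentences about the default gadget
  become constant-local. As sentences they belong to every \<open>constant_local_fms_upto\<close>,
  so level 1 suffices, and a convergent sequence of zeros and ones is eventually constant.\<close>

lemma default_type_eventually_const:
  fixes L :: "'l language" and G :: "nat \<Rightarrow> ('l, 'b) fo_struct"
  assumes L: "finite_relational_language L" and G: "\<And>n. is_gadget L R (G n)"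
    and \<Delta>: "fms_over (gadget_language L R) {} \<Delta>"
    and conv: "fms_convergent (constant_local_fms_upto (gadget_language L R) 1) G"
  obtains D where "\<forall>\<^sub>F n in sequentially. default_type L R r \<Delta> (G n) = D"
proof -
  let ?L = "gadget_language L R"
  let ?P = "\<lambda>\<gamma> n. sat (local_gadget L R r (G n) {}) (\<lambda>_. undefined) \<gamma>"
  have fL: "finite (rel_syms ?L)" "finite (const_syms ?L)"
    using L by (auto simp: finite_relational_language_def)
  have "(\<forall>\<^sub>F n in sequentially. ?P \<gamma> n) \<or> (\<forall>\<^sub>F n in sequentially. \<not> ?P \<gamma> n)" if \<gamma>: "\<gamma> \<in> \<Delta>" for \<gamma>
  proof -
    have wf: "wf_fm ?L \<gamma>" and fv: "id ` fv \<gamma> \<subseteq> set []" using \<Delta> \<gamma> by (auto simp: fms_over_def)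
    let ?\<beta> = "ball_fm ?L r [] id \<gamma>"
    have fv': "fv ?\<beta> = {}" using fv_ball_fm[OF fv] by simp
    have "?\<beta> \<in> constant_local_fms_upto ?L 1"
      using ball_fm_constant_local[OF fL wf fv] fv' by (simp add: constant_local_fms_upto_def)
    then have "convergent (\<lambda>n. stone_pairing ?\<beta> (G n))" using conv by (simp add: fms_convergent_def)
    moreover have "stone_pairing ?\<beta> (G n) = (if ?P \<gamma> n then 1 else 0)" for n
      using stone_pairing_sentence[OF fv', of "G n" "\<lambda>_. undefined"]
        sat_ball_fm[OF fL is_gadgetD(1)[OF G] wf fv, of "\<lambda>_. undefined" n r]
      by (simp add: local_gadget_def roots_def)
    ultimately show ?thesis using convergent_of_bool[of "?P \<gamma>"] by simp
  qed
  then have "\<forall>\<^sub>F n in sequentially. ?P \<gamma> n \<longleftrightarrow> (\<forall>\<^sub>F n in sequentially. ?P \<gamma> n)" if "\<gamma> \<in> \<Delta>" for \<gamma>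
    using that by (cases "\<forall>\<^sub>F n in sequentially. ?P \<gamma> n") auto
  then have "\<forall>\<gamma>\<in>\<Delta>. \<forall>\<^sub>F n in sequentially. ?P \<gamma> n \<longleftrightarrow> (\<forall>\<^sub>F n in sequentially. ?P \<gamma> n)" by blast
  moreover have "finite \<Delta>" using \<Delta> by (simp add: fms_over_def)
  ultimately have "\<forall>\<^sub>F n in sequentially. \<forall>\<gamma>\<in>\<Delta>. ?P \<gamma> n \<longleftrightarrow> (\<forall>\<^sub>F n in sequentially. ?P \<gamma> n)"
    by (simp add: eventually_ball_finite)
  then have "\<forall>\<^sub>F n in sequentially. default_type L R r \<Delta> (G n) = {\<gamma> \<in> \<Delta>. \<forall>\<^sub>F n in sequentially. ?P \<gamma> n}"
    by (rule eventually_mono) (auto simp: default_type_def)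
  then show thesis by (rule that)
qed

lemma card_base_vars:
  assumes "finite X" "finite J"
  shows "card (base_vars k X J s) = card {x \<in> X. s x = None} + k * card J"
proof -
  have "(\<Union>j\<in>J. (\<lambda>i. edge_var i j) ` {1..k}) = (\<lambda>(i, j). edge_var i j) ` ({1..k} \<times> J)" by auto
  moreover have "inj_on (\<lambda>(i, j). edge_var i j) ({1..k} \<times> J)" by (auto simp: inj_on_def)
  ultimately have "card (\<Union>j\<in>J. (\<lambda>i. edge_var i j) ` {1..k}) = k * card J"
    using assms by (simp add: card_image card_cartesian_product)
  moreover have "card (base_var ` {x \<in> X. s x = None}) = card {x \<in> X. s x = None}"
    by (simp add: card_image inj_on_def)
  moreover have "base_var ` {x \<in> X. s x = None} \<inter> (\<Union>j\<in>J. (\<lambda>i. edge_var i j) ` {1..k}) = {}"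
    using base_var_neq_edge_var by fastforce
  ultimately show ?thesis unfolding base_vars_def using assms by (subst card_Un_disjoint) auto
qed

lemma card_eq_sum_classes:
  assumes X: "finite X"
  shows "card X = card {x \<in> X. s x = None} + (\<Sum>j\<in>edge_names X s. card (class_vars X s j))"
proof -
  let ?U = "\<Union>j\<in>edge_names X s. class_vars X s j"
  have U: "?U = {x \<in> X. s x \<noteq> None}" by (auto simp: edge_names_def class_vars_def)
  have "card ?U = (\<Sum>j\<in>edge_names X s. card (class_vars X s j))"
    using X by (intro card_UN_disjoint finite_edge_names) (auto simp: class_vars_def)
  moreover have "X = {x \<in> X. s x = None} \<union> ?U" unfolding U by auto
  then have "card X = card {x \<in> X. s x = None} + card ?U"
    using X unfolding U by (metis (no_types, lifting) Collect_disj_eq card_Un_disjoint disjoint_iff finite_Un mem_Collect_eq)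
  ultimately show ?thesis by simp
qed

subsection \<open>Passage to the limit\<close>

text \<open>With \<open>x = 1/a\<close>, \<open>y = 1/g\<close> and \<open>\<rho> = e/a^k\<close> the vertex count \<open>V\<close> satisfies
  \<open>V = a^k g (x^(k-1) y + \<rho> (1 - k y))\<close>, whose last factor has a positive limit unless \<open>g = k\<close> eventually.\<close>

lemma volume_limits:
  fixes a g e :: "nat \<Rightarrow> nat" and k :: nat and c :: real
  assumes k: "1 \<le> k" and a: "\<And>n. 1 \<le> a n" and g: "\<And>n. k \<le> g n"
    and x: "convergent (\<lambda>n. 1 / real (a n))" and y: "convergent (\<lambda>n. 1 / real (g n))"
    and \<rho>: "(\<lambda>n. real (e n) / real (a n) ^ k) \<longlonglongrightarrow> c" and c: "0 < c"
  defines "V \<equiv> \<lambda>n. a n + e n * (g n - k)"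
  shows "convergent (\<lambda>n. real (a n) / real (V n))"
    and "(\<forall>\<^sub>F n in sequentially. g n = k) \<or>
      (\<forall>m\<ge>1. convergent (\<lambda>n. real (a n) ^ k * real (g n) ^ m / real (V n) ^ m) \<and>
        (2 \<le> m \<longrightarrow> (\<lambda>n. 1 / real (a n)) \<longlonglongrightarrow> 0 \<longrightarrow>
          (\<lambda>n. real (a n) ^ k * real (g n) ^ m / real (V n) ^ m) \<longlonglongrightarrow> 0))"
proof -
  obtain l where l: "(\<lambda>n. 1 / real (a n)) \<longlonglongrightarrow> l" using x by (auto simp: convergent_def)
  obtain h where h: "(\<lambda>n. 1 / real (g n)) \<longlonglongrightarrow> h" using y by (auto simp: convergent_def)
  have a0: "real (a n) > 0" for n using a[of n] by linarith
  have g0: "real (g n) > 0" for n using g[of n] k by linarith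
  have V0: "real (V n) > 0" for n
  proof -
    have "0 < V n" unfolding V_def using a[of n] by linarith
    then show ?thesis by simp
  qed
  have l0: "0 \<le> l" using l a0 by (intro LIMSEQ_le_const) (auto intro!: exI[of _ 0] less_imp_le)
  have h0: "0 \<le> h" using h g0 by (intro LIMSEQ_le_const) (auto intro!: exI[of _ 0] less_imp_le)
  have "1 / real (g n) \<le> 1 / real k" for n using g[of n] k by (simp add: frac_le)
  then have hk: "h \<le> 1 / real k" using h by (intro LIMSEQ_le_const2) auto
  define D where "D n = (1 / real (a n)) ^ (k - 1) * (1 / real (g n)) +
      real (e n) / real (a n) ^ k * (1 - real k * (1 / real (g n)))" for n
  have ak: "real (a n) ^ k = real (a n) * real (a n) ^ (k - 1)" for n using k by (cases k) simp_all
  have VD: "real (V n) = real (a n) ^ k * real (g n) * D n" for n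
  proof -
    have "real (a n) ^ k * real (g n) * ((1 / real (a n)) ^ (k - 1) * (1 / real (g n))) = real (a n)"
      using ak[of n] a0[of n] g0[of n] by (simp add: field_simps power_divide)
    moreover have "real (a n) ^ k * real (g n) * (real (e n) / real (a n) ^ k * (1 - real k * (1 / real (g n)))) =
        real (e n) * (real (g n) - real k)"
      using a0[of n] g0[of n] by (simp add: field_simps)
    ultimately show ?thesis using g[of n] by (simp add: V_def D_def distrib_left of_nat_diff)
  qed
  have D0: "D n > 0" for n
  proof (rule zero_less_mult_pos)
    show "0 < real (a n) ^ k * real (g n) * D n" using V0[of n] unfolding VD .
    show "0 < real (a n) ^ k * real (g n)" using a0[of n] g0[of n] by simp
  qed
  let ?d = "l ^ (k - 1) * h + c * (1 - real k * h)"
  have Dlim: "D \<longlonglongrightarrow> ?d" unfolding D_def by (intro tendsto_intros l h \<rho>)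
  \<comment> \<open>The positive limit \<open>c\<close> enters here. If \<open>k * h < 1\<close>,
    the term with \<open>c\<close> makes \<open>?d\<close> positive; if \<open>h = 1 / k\<close>,
    the integers \<open>g n \<ge> k\<close> must eventually equal \<open>k\<close>, and the copies
    add no vertices.\<close>
  have dich: "(\<forall>\<^sub>F n in sequentially. g n = k) \<or> 0 < ?d"
  proof (cases "h = 1 / real k")
    case True
    have "1 / real (Suc k) < h" unfolding True using k by (simp add: frac_less2)
    from order_tendstoD(1)[OF h this] have "\<forall>\<^sub>F n in sequentially. g n = k"
    proof (rule eventually_mono)
      fix n assume "1 / real (Suc k) < 1 / real (g n)"
      then have "real (g n) < real (Suc k)" using g0[of n] by (simp add: field_simps)
      then show "g n = k" using g[of n] by simp
    qed
    then show ?thesis ..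
  next
    case False
    then have "real k * h < 1" using hk k by (simp add: field_simps)
    then have "0 < c * (1 - real k * h)" using c by simp
    moreover have "0 \<le> l ^ (k - 1) * h" using l0 h0 by simp
    ultimately show ?thesis by linarith
  qed
  show "convergent (\<lambda>n. real (a n) / real (V n))"
    using dich
  proof
    assume "\<forall>\<^sub>F n in sequentially. g n = k"
    then have "\<forall>\<^sub>F n in sequentially. real (a n) / real (V n) = 1"
      by (rule eventually_mono) (use a0 in \<open>auto simp: V_def\<close>)
    then have "(\<lambda>n. real (a n) / real (V n)) \<longlonglongrightarrow> 1" by (rule tendsto_eventually)
    then show ?thesis by (auto simp: convergent_def)
  next
    assume d: "0 < ?d"
    have "real (a n) / real (V n) = (1 / real (a n)) ^ (k - 1) * (1 / real (g n)) / D n" for n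
      unfolding VD using ak[of n] a0[of n] g0[of n] D0[of n] by (simp add: field_simps power_divide)
    moreover have "(\<lambda>n. (1 / real (a n)) ^ (k - 1) * (1 / real (g n)) / D n) \<longlonglongrightarrow> l ^ (k - 1) * h / ?d"
      using d by (intro tendsto_intros l h Dlim) simp
    ultimately show ?thesis by (auto simp: convergent_def)
  qed
  show "(\<forall>\<^sub>F n in sequentially. g n = k) \<or>
      (\<forall>m\<ge>1. convergent (\<lambda>n. real (a n) ^ k * real (g n) ^ m / real (V n) ^ m) \<and>
        (2 \<le> m \<longrightarrow> (\<lambda>n. 1 / real (a n)) \<longlonglongrightarrow> 0 \<longrightarrow>
          (\<lambda>n. real (a n) ^ k * real (g n) ^ m / real (V n) ^ m) \<longlonglongrightarrow> 0))"
    using dich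
  proof
    assume d: "0 < ?d"
    have "(\<lambda>n. real (a n) ^ k * real (g n) ^ m / real (V n) ^ m) \<longlonglongrightarrow> (1 / ?d) ^ m * (l ^ k) ^ (m - 1)"
      if m: "1 \<le> m" for m
    proof -
      \<comment> \<open>Since \<open>V\<close> is \<open>D\<close> times \<open>a^k * g\<close>, the
        power of \<open>g\<close> cancels completely, and of the \<open>m\<close> factors
        \<open>a^k\<close> in the denominator all but one remain.\<close>
      have "real (a n) ^ k * real (g n) ^ m / real (V n) ^ m = (1 / D n) ^ m * ((1 / real (a n)) ^ k) ^ (m - 1)" for n
      proof -
        have "(real (a n) ^ k) ^ m = real (a n) ^ k * (real (a n) ^ k) ^ (m - 1)"
          using m by (cases m) simp_all
        then show ?thesis unfolding VD using a0[of n] g0[of n] D0[of n]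
          by (simp add: field_simps power_divide power_mult_distrib)
      qed
      moreover have "(\<lambda>n. (1 / D n) ^ m * ((1 / real (a n)) ^ k) ^ (m - 1)) \<longlonglongrightarrow> (1 / ?d) ^ m * (l ^ k) ^ (m - 1)"
        using d by (intro tendsto_intros l Dlim) simp
      ultimately show ?thesis by simp
    qed
    note lim = this
    have "(\<lambda>n. real (a n) ^ k * real (g n) ^ m / real (V n) ^ m) \<longlonglongrightarrow> 0"
      if m: "2 \<le> m" and z: "(\<lambda>n. 1 / real (a n)) \<longlonglongrightarrow> 0" for m
    proof -
      have "l = 0" using l z LIMSEQ_unique by blast
      then have e: "(1 / ?d) ^ m * (l ^ k) ^ (m - 1) = 0" using k m by (simp add: power_0_left)
      have "1 \<le> m" using m by simp
      from lim[OF this] show ?thesis unfolding e .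
    qed
    then show ?thesis using lim by (auto simp: convergent_def)
  qed blast
qed

text \<open>Two random vertices coincide with probability \<open>1 / card\<close>, and equality of
  two variables is local.\<close>

lemma convergent_inverse_card:
  assumes A: "\<And>n. is_struct L (A n)" and conv: "local_convergent L A"
  shows "convergent (\<lambda>n. 1 / real (card (verts (A n))))"
proof -
  let ?\<phi> = "Eq (Var 1) (Var 2)"
  have "?\<phi> \<in> local_fms L" by (auto simp: local_fms_def nbhd_determined_def)
  then have "convergent (\<lambda>n. stone_pairing ?\<phi> (A n))"
    using conv by (simp add: local_convergent_def fms_convergent_def)
  moreover have "stone_pairing ?\<phi> (A n) = 1 / real (card (verts (A n)))" for n
  proof -
    have "bij_betw (\<lambda>a. \<lambda>x\<in>{1, 2 :: nat}. a) (verts (A n)) {v \<in> {1, 2} \<rightarrow>\<^sub>E verts (A n). v 1 = v 2}"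
    proof (rule bij_betw_imageI)
      show "inj_on (\<lambda>a. \<lambda>x\<in>{1, 2 :: nat}. a) (verts (A n))"
        by (rule inj_onI) (auto dest: fun_cong[of _ _ 1])
      show "(\<lambda>a. \<lambda>x\<in>{1, 2 :: nat}. a) ` verts (A n) = {v \<in> {1, 2} \<rightarrow>\<^sub>E verts (A n). v 1 = v 2}"
      proof (intro equalityI subsetI)
        fix v assume v: "v \<in> {v \<in> {1, 2 :: nat} \<rightarrow>\<^sub>E verts (A n). v 1 = v 2}"
        then have "v = (\<lambda>x\<in>{1, 2}. v 1)" by (intro extensionalityI[of _ "{1, 2}"]) (auto simp: PiE_iff)
        then show "v \<in> (\<lambda>a. \<lambda>x\<in>{1, 2 :: nat}. a) ` verts (A n)" using v by (auto simp: PiE_iff)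
      qed (auto split: if_splits)
    qed
    from bij_betw_same_card[OF this]
    have "card {v \<in> {1, 2 :: nat} \<rightarrow>\<^sub>E verts (A n). v 1 = v 2} = card (verts (A n))" by simp
    moreover have "{1} \<union> {2} = {1, 2 :: nat}" by auto
    moreover have "card (verts (A n)) > 0" using A[of n] by (auto simp: is_struct_def card_gt_0_iff)
    ultimately show ?thesis by (simp add: stone_pairing_def power2_eq_square)
  qed
  ultimately show ?thesis by simp
qed

text \<open>With a root available as a constant, one free variable is enough: a random vertex is the
  root 1 with probability \<open>1 / card\<close>. This keeps the lemma within reach of the weaker
  convergence assumption.\<close>

lemma convergent_inverse_card_gadget:
  assumes G: "\<And>n. is_gadget L R (G n)" and k: "1 \<le> arity L R"
    and conv: "fms_convergent (constant_local_fms_upto (gadget_language L R) 1) G"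
  shows "convergent (\<lambda>n. 1 / real (card (verts (G n))))"
proof -
  let ?\<phi> = "Eq (Var 1) (Cst 1)"
  have "nbhd_determined (gadget_language L R) {1..arity L R} 0 ?\<phi>"
    using k by (auto simp: nbhd_determined_def same_struct_def induced_def)
  then have "?\<phi> \<in> constant_local_fms_upto (gadget_language L R) 1"
    using k by (auto simp: constant_local_fms_upto_def constant_local_fms_def)
  then have "convergent (\<lambda>n. stone_pairing ?\<phi> (G n))" using conv by (simp add: fms_convergent_def)
  moreover have "stone_pairing ?\<phi> (G n) = 1 / real (card (verts (G n)))" for n
  proof -
    have "cst (G n) 1 \<in> verts (G n)" using is_gadgetD(3)[OF G[of n]] k by (auto simp: roots_def)
    then have "{v \<in> {1 :: nat} \<rightarrow>\<^sub>E verts (G n). v 1 = cst (G n) 1} = {\<lambda>x\<in>{1}. cst (G n) 1}"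
      by (auto simp: PiE_iff intro!: extensionalityI[of _ "{1}"])
    then show ?thesis by (simp add: stone_pairing_def)
  qed
  ultimately show ?thesis by simp
qed

lemma convergent_mult_bounded_null:
  fixes f h :: "nat \<Rightarrow> real"
  assumes "\<And>n. 0 \<le> f n" "\<And>n. f n \<le> 1" "h \<longlonglongrightarrow> 0"
  shows "convergent (\<lambda>n. f n * h n)"
proof -
  have "(\<lambda>n. f n * h n) \<longlonglongrightarrow> 0"
  proof (rule tendsto_rabs_zero_cancel, rule tendsto_sandwich[of "\<lambda>_. 0" _ _ "\<lambda>n. \<bar>h n\<bar>"])
    show "(\<lambda>n. \<bar>h n\<bar>) \<longlonglongrightarrow> 0" using assms(3) by (rule tendsto_rabs_zero)
    have "\<bar>f n\<bar> * \<bar>h n\<bar> \<le> \<bar>h n\<bar>" for n using assms(1,2)[of n] by (intro mult_left_le_one_le) auto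
    then show "\<forall>\<^sub>F n in sequentially. \<bar>f n * h n\<bar> \<le> \<bar>h n\<bar>" by (simp add: abs_mult)
  qed auto
  then show ?thesis by (auto simp: convergent_def)
qed

lemma convergent_prod_finite:
  fixes f :: "'i \<Rightarrow> nat \<Rightarrow> real"
  assumes "\<And>i. i \<in> I \<Longrightarrow> convergent (f i)"
  shows "convergent (\<lambda>n. \<Prod>i\<in>I. f i n)"
proof -
  have "\<forall>i\<in>I. \<exists>l. f i \<longlonglongrightarrow> l" using assms by (auto simp: convergent_def)
  then obtain l where "\<forall>i\<in>I. f i \<longlonglongrightarrow> l i" by (rule bchoice[THEN exE])
  then have "(\<lambda>n. \<Prod>i\<in>I. f i n) \<longlonglongrightarrow> (\<Prod>i\<in>I. l i)" by (intro tendsto_prod) auto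
  then show ?thesis by (auto simp: convergent_def)
qed

text \<open>Without free variables and constants the neighborhood is empty, so all structures look
  alike to the sentence. The only tuple over the empty set is the empty one, and positive arities
  exclude it from every relation.\<close>

lemma local_sentence_const:
  assumes L: "finite_relational_language L" and \<phi>: "wf_fm L \<phi>" "nbhd_determined L {} r \<phi>" "fv \<phi> = {}"
    and A: "is_struct L A" "is_struct L B"
  shows "sat A v \<phi> \<longleftrightarrow> sat B v \<phi>"
proof (rule nbhd_determined_any_type[OF \<phi>(2,1) _ A])
  show "const_syms L = {}" using L by (simp add: finite_relational_language_def)
  show "nbhd L A r (v ` fv \<phi>) = {}" "nbhd L B r (v ` fv \<phi>) = {}" by (simp_all add: \<phi>(3) nbhd_def)
  have "[] \<notin> rel M S" if "is_struct L M" "S \<in> rel_syms L" for M S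
    using is_structD(2)[OF that, of "[]"] L that(2) by (force simp: finite_relational_language_def)
  then show "rel A S \<inter> lists {} = rel B S \<inter> lists {}" if "S \<in> rel_syms L" for S
    using A that by auto
qed (simp add: \<phi>(3))

text \<open>The disjunction \<open>conv\<close> treats both claims of the theorem together.
  Convergence at level 1 controls the classes with one entry, the size of the gadget and the default
  type; for a larger class, either its Stone pairing converges or its volume factor tends to
  0.\<close>

lemma glued_pairing_convergent:
  fixes L :: "'l language" and A :: "nat \<Rightarrow> ('l, 'a) fo_struct" and G :: "nat \<Rightarrow> ('l, 'b) fo_struct"
  assumes L: "finite_relational_language L" and k: "1 \<le> arity L R"
    and A: "\<And>n. is_struct (base_language L R) (A n)" and convA: "local_convergent (base_language L R) A"
    and c: "(\<lambda>n. stone_pairing (rel_atom L R) (A n)) \<longlonglongrightarrow> c" "0 < c"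
    and G: "\<And>n. is_gadget L R (G n)"
    and conv1: "fms_convergent (constant_local_fms_upto (gadget_language L R) 1) G"
    and conv: "(\<forall>m. fms_convergent (constant_local_fms_upto (gadget_language L R) m) G) \<or>
      (\<lambda>n. 1 / real (card (verts (A n)))) \<longlonglongrightarrow> 0"
    and \<phi>: "\<phi> \<in> local_fms L"
  shows "convergent (\<lambda>n. stone_pairing \<phi> (glued L R (A n) (\<lambda>_. G n)))"
proof -
  let ?k = "arity L R" and ?X = "fv \<phi>" and ?LA = "base_language L R" and ?LG = "gadget_language L R"
  let ?B = "\<lambda>n. glued L R (A n) (\<lambda>_. G n)"
  obtain r where wf: "wf_fm L \<phi>" and r: "nbhd_determined L {} r \<phi>" using \<phi> by (auto simp: local_fms_def)
  have L0: "const_syms L = {}" using L by (simp add: finite_relational_language_def)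
  have B: "is_struct L (?B n)" for n using L0 A G by (intro glued_struct)
  show ?thesis
  proof (cases "?X = {}")
    case True
    have "stone_pairing \<phi> (?B n) = stone_pairing \<phi> (?B 0)" for n
      using local_sentence_const[OF L wf r True B[of n] B[of 0]]
      by (simp add: stone_pairing_sentence[OF True, where v = undefined])
    then have "(\<lambda>n. stone_pairing \<phi> (?B n)) = (\<lambda>n. stone_pairing \<phi> (?B 0))" by (rule ext)
    then show ?thesis by (simp only: convergent_const)
  next
    case ne: False
    define a g e V where "a n = card (verts (A n))" and "g n = card (verts (G n))"
      and "e n = card (rel (A n) R)" and "V n = card (verts (?B n))" for n
    have a1: "1 \<le> a n" for n using A[of n] by (simp add: a_def is_struct_def Suc_le_eq card_gt_0_iff)
    have rk: "card (roots L R (G n)) = ?k" for n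
      using card_image[OF is_gadgetD(2)[OF G[of n]]] by (simp add: roots_def)
    have finG: "finite (verts (G n))" for n using is_gadgetD(1)[OF G[of n]] by (simp add: is_struct_def)
    have gk: "?k \<le> g n" for n
      using card_mono[OF finG is_gadgetD(3)[OF G[of n]]] rk[of n] by (simp add: g_def)
    have V: "V = (\<lambda>n. a n + e n * (g n - ?k))"
      using card_glued[OF A G] by (auto simp: V_def a_def e_def g_def)
    have a0: "real (a n) > 0" for n using a1[of n] by linarith
    have V0: "real (V n) > 0" for n
    proof -
      have "0 < V n" unfolding V using a1[of n] by linarith
      then show ?thesis by simp
    qed
    have x: "convergent (\<lambda>n. 1 / real (a n))"
      using convergent_inverse_card[OF A convA] by (simp add: a_def)
    have y: "convergent (\<lambda>n. 1 / real (g n))"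
      using convergent_inverse_card_gadget[OF G k conv1] by (simp add: g_def)
    have "stone_pairing (rel_atom L R) (A n) = real (e n) / real (a n) ^ ?k" for n
      using stone_pairing_rel_atom[OF A, of R n] by (simp add: rel_atom_def e_def a_def)
    then have \<rho>: "(\<lambda>n. real (e n) / real (a n) ^ ?k) \<longlonglongrightarrow> c" using c(1) by simp
    have Vn: "a n + e n * (g n - ?k) = V n" for n unfolding V ..
    note vol = volume_limits[OF k a1 gk x y \<rho> c(2), unfolded Vn]
    \<comment> \<open>Normalization per class: each named edge contributes \<open>k\<close> base
      variables, hence its own factor \<open>a^k\<close>, and the entries of the class take their
      share \<open>V^card C\<close> of the denominator.\<close>
    have class_factor: "convergent (\<lambda>n. real (class_count L R (Suc r) C \<Delta> Q (G n)) * real (a n) ^ ?k / real (V n) ^ card C)"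
      if C: "finite C" "C \<noteq> {}" and \<Delta>: "fms_over ?LG C \<Delta>" "Q \<subseteq> \<Delta>" for C \<Delta> Q
      using vol(2)
    proof
      assume "\<forall>\<^sub>F n in sequentially. g n = ?k"
      then have "\<forall>\<^sub>F n in sequentially. real (class_count L R (Suc r) C \<Delta> Q (G n)) * real (a n) ^ ?k / real (V n) ^ card C = 0"
      proof (rule eventually_mono)
        fix n assume "g n = ?k"
        then have "roots L R (G n) = verts (G n)"
          using card_subset_eq[OF finG is_gadgetD(3)[OF G[of n]]] rk[of n] by (simp add: g_def)
        then show "real (class_count L R (Suc r) C \<Delta> Q (G n)) * real (a n) ^ ?k / real (V n) ^ card C = 0"
          using class_count_no_nonroots[of "G n" L R C] C(2) by simp
      qed
      then show ?thesis unfolding convergent_def by (intro exI[of _ 0] tendsto_eventually)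
    next
      assume *: "\<forall>m\<ge>1. convergent (\<lambda>n. real (a n) ^ ?k * real (g n) ^ m / real (V n) ^ m) \<and>
        (2 \<le> m \<longrightarrow> (\<lambda>n. 1 / real (a n)) \<longlonglongrightarrow> 0 \<longrightarrow>
          (\<lambda>n. real (a n) ^ ?k * real (g n) ^ m / real (V n) ^ m) \<longlonglongrightarrow> 0)"
      obtain \<gamma> where \<gamma>: "\<gamma> \<in> constant_local_fms_upto ?LG (card C)"
        and cnt: "\<And>H :: ('l, 'b) fo_struct. is_gadget L R H \<Longrightarrow>
          real (class_count L R (Suc r) C \<Delta> Q H) = stone_pairing \<gamma> H * real (card (verts H)) ^ card C"
        using class_count_pairing[OF L k C(1) \<Delta>] by blast
      let ?q = "\<lambda>n. real (a n) ^ ?k * real (g n) ^ card C / real (V n) ^ card C"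
      have eq: "real (class_count L R (Suc r) C \<Delta> Q (G n)) * real (a n) ^ ?k / real (V n) ^ card C =
          stone_pairing \<gamma> (G n) * ?q n" for n
        unfolding cnt[OF G] g_def by (simp add: mult_ac)
      have m: "1 \<le> card C" using C by (simp add: Suc_le_eq card_gt_0_iff)
      have "convergent (\<lambda>n. stone_pairing \<gamma> (G n) * ?q n)"
      proof (cases "(\<forall>m. fms_convergent (constant_local_fms_upto ?LG m) G) \<or> card C = 1")
        case True
        then have "convergent (\<lambda>n. stone_pairing \<gamma> (G n))"
          using \<gamma> conv1 by (auto simp: fms_convergent_def)
        then show ?thesis using * m by (intro convergent_mult) blast+
      next
        \<comment> \<open>Here the class has at least two entries and the base grows. The Stone
          pairing may fail to converge, but it is bounded and meets a factor that tends to
          0.\<close>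
        case False
        then have "?q \<longlonglongrightarrow> 0" using * m conv unfolding a_def[symmetric] by force
        then show ?thesis
          using stone_pairing_bounds[OF is_gadgetD(1)[OF G]] by (intro convergent_mult_bounded_null)
      qed
      then show ?thesis unfolding eq .
    qed
    let ?N = "\<lambda>K n. real (card {u \<in> ?X \<rightarrow>\<^sub>E verts (?B n). same_copy ?X u = K \<and> sat (?B n) u \<phi>})"
    have "convergent (\<lambda>n. ?N K n / real (V n) ^ card ?X)" for K
    proof -
      define s J where "s = copy_shape K" and "J = edge_names ?X s"
      let ?C = "class_vars ?X s" and ?Y = "base_vars ?k ?X J s" and ?r = "Suc r"
      show ?thesis
      proof (rule copy_count[OF L k wf r ne, of K, folded s_def, folded J_def])
        fix F \<Gamma> \<Gamma>0 \<Theta> assume d: "deciding L R ?X J s F \<Gamma> \<Gamma>0"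
          and cnt: "\<And>(A :: ('l, 'a) fo_struct) (G :: ('l, 'b) fo_struct).
            is_struct ?LA A \<Longrightarrow> is_gadget L R G \<Longrightarrow>
            card {u \<in> ?X \<rightarrow>\<^sub>E verts (glued L R A (\<lambda>_. G)). same_copy ?X u = K \<and> sat (glued L R A (\<lambda>_. G)) u \<phi>} =
            (\<Sum>(T, U)\<in>Pow F \<times> (\<Pi>\<^sub>E j\<in>J. Pow (\<Gamma> j)). of_bool (\<Theta> T U (default_type L R ?r \<Gamma>0 G)) *
               base_count L R ?r ?X J s F T A * (\<Prod>j\<in>J. class_count L R ?r (?C j) (\<Gamma> j) (U j) G))"
        have F: "fms_over ?LA ?Y F" and \<Gamma>: "\<And>j. j \<in> J \<Longrightarrow> fms_over ?LG (?C j) (\<Gamma> j)"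
          and \<Gamma>0: "fms_over ?LG {} \<Gamma>0" using d by (auto simp: deciding_def)
        have fJ: "finite J" by (simp add: J_def finite_edge_names)
        have Cne: "?C j \<noteq> {}" "finite (?C j)" if "j \<in> J" for j
          using that by (auto simp: J_def edge_names_def class_vars_def)
        have Yne: "?Y \<noteq> {}"
        proof -
          obtain x0 where x0: "x0 \<in> ?X" using ne by blast
          show ?thesis
          proof (cases "s x0")
            case None
            then show ?thesis using base_vars_memI(1)[of x0 ?X s ?k J] x0 by blast
          next
            case (Some j)
            then have "j \<in> J" using x0 by (auto simp: J_def edge_names_def)
            then show ?thesis using base_vars_memI(2)[of j J 1 ?k ?X s] k by auto
          qed
        qed
        obtain D where D: "\<forall>\<^sub>F n in sequentially. default_type L R ?r \<Gamma>0 (G n) = D"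
          using default_type_eventually_const[OF L G \<Gamma>0 conv1] by blast
        let ?m0 = "card {x \<in> ?X. s x = None}"
        let ?t = "\<lambda>T U n. of_bool (\<Theta> T U (default_type L R ?r \<Gamma>0 (G n))) *
            (real (base_count L R ?r ?X J s F T (A n)) * (\<Prod>j\<in>J. real (class_count L R ?r (?C j) (\<Gamma> j) (U j) (G n))) / real (V n) ^ card ?X)"
        have "convergent (?t T U)" if T: "T \<subseteq> F" and U: "U \<in> (\<Pi>\<^sub>E j\<in>J. Pow (\<Gamma> j))" for T U
        proof (rule convergent_mult)
          have "\<forall>\<^sub>F n in sequentially. of_bool (\<Theta> T U (default_type L R ?r \<Gamma>0 (G n))) = (of_bool (\<Theta> T U D) :: real)"
            using D by (rule eventually_mono) simp
          then show "convergent (\<lambda>n. of_bool (\<Theta> T U (default_type L R ?r \<Gamma>0 (G n))) :: real)"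
            unfolding convergent_def by (intro exI[of _ "of_bool (\<Theta> T U D)"] tendsto_eventually)
          obtain \<alpha> where \<alpha>: "\<alpha> \<in> local_fms ?LA" and bc: "\<And>A :: ('l, 'a) fo_struct. is_struct ?LA A \<Longrightarrow>
              real (base_count L R ?r ?X J s F T A) = stone_pairing \<alpha> A * real (card (verts A)) ^ card ?Y"
            using base_count_pairing[OF L finite_fv fJ F T Yne] by blast
          \<comment> \<open>The exponent of \<open>a\<close> in the base count is the number of base
            entries plus \<open>k\<close> for each class, and the exponent of \<open>V\<close> is
            the number of base entries plus the class sizes. Both powers therefore distribute over
            the base entries and the classes.\<close>
          let ?f = "\<lambda>j n. real (class_count L R ?r (?C j) (\<Gamma> j) (U j) (G n)) * real (a n) ^ ?k / real (V n) ^ card (?C j)"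
          have "real (base_count L R ?r ?X J s F T (A n)) * (\<Prod>j\<in>J. real (class_count L R ?r (?C j) (\<Gamma> j) (U j) (G n))) / real (V n) ^ card ?X =
              stone_pairing \<alpha> (A n) * (real (a n) / real (V n)) ^ ?m0 * (\<Prod>j\<in>J. ?f j n)" for n
          proof -
            have "(\<Prod>j\<in>J. ?f j n) = (\<Prod>j\<in>J. real (class_count L R ?r (?C j) (\<Gamma> j) (U j) (G n))) *
                real (a n) ^ (?k * card J) / real (V n) ^ (\<Sum>j\<in>J. card (?C j))"
              by (simp add: prod_dividef prod.distrib power_sum power_mult)
            moreover have "real (base_count L R ?r ?X J s F T (A n)) =
                stone_pairing \<alpha> (A n) * (real (a n) ^ ?m0 * real (a n) ^ (?k * card J))"
              unfolding bc[OF A] card_base_vars[OF finite_fv fJ] power_add a_def ..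
            moreover have "real (V n) ^ card ?X = real (V n) ^ ?m0 * real (V n) ^ (\<Sum>j\<in>J. card (?C j))"
              unfolding J_def power_add[symmetric] card_eq_sum_classes[OF finite_fv, of \<phi> s, symmetric] ..
            ultimately show ?thesis by (simp add: power_divide mult_ac)
          qed
          moreover have "convergent (\<lambda>n. stone_pairing \<alpha> (A n) * (real (a n) / real (V n)) ^ ?m0 * (\<Prod>j\<in>J. ?f j n))"
          proof (intro convergent_mult convergent_prod_finite)
            show "convergent (\<lambda>n. stone_pairing \<alpha> (A n))"
              using convA \<alpha> by (simp add: local_convergent_def fms_convergent_def)
            obtain l where "(\<lambda>n. real (a n) / real (V n)) \<longlonglongrightarrow> l" using vol(1) by (auto simp: convergent_def)
            from tendsto_power[OF this, of ?m0] show "convergent (\<lambda>n. (real (a n) / real (V n)) ^ ?m0)"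
              by (auto simp: convergent_def)
            show "convergent (?f j)" if "j \<in> J" for j
              using class_factor[OF Cne(2,1)[OF that] \<Gamma>[OF that]] U that by (auto simp: PiE_iff)
          qed
          ultimately show "convergent (\<lambda>n. real (base_count L R ?r ?X J s F T (A n)) *
              (\<Prod>j\<in>J. real (class_count L R ?r (?C j) (\<Gamma> j) (U j) (G n))) / real (V n) ^ card ?X)" by simp
        qed
        then have "convergent (\<lambda>n. \<Sum>(T, U)\<in>Pow F \<times> (\<Pi>\<^sub>E j\<in>J. Pow (\<Gamma> j)). ?t T U n)"
          by (intro convergent_sum) auto
        moreover have "?N K n / real (V n) ^ card ?X = (\<Sum>(T, U)\<in>Pow F \<times> (\<Pi>\<^sub>E j\<in>J. Pow (\<Gamma> j)). ?t T U n)" for n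
          unfolding cnt[OF A G] of_nat_sum sum_divide_distrib
          by (rule sum.cong[OF refl]) (auto simp: split_beta mult.assoc)
        ultimately show ?thesis by simp
      qed
    qed
    \<comment> \<open>The tuples are sorted by their copy relation \<open>K\<close>; the range of
      the sum is finite and does not depend on \<open>n\<close>.\<close>
    then have "convergent (\<lambda>n. \<Sum>K\<in>Pow (?X \<times> ?X). ?N K n / real (V n) ^ card ?X)"
      by (intro convergent_sum) auto
    moreover have "stone_pairing \<phi> (?B n) = (\<Sum>K\<in>Pow (?X \<times> ?X). ?N K n / real (V n) ^ card ?X)" for n
    proof -
      have "card {u \<in> ?X \<rightarrow>\<^sub>E verts (?B n). sat (?B n) u \<phi>} = (\<Sum>K\<in>Pow (?X \<times> ?X).
          card {u \<in> {u \<in> ?X \<rightarrow>\<^sub>E verts (?B n). sat (?B n) u \<phi>}. same_copy ?X u = K})"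
      proof (rule card_eq_sum_fibres)
        have "finite (?X \<rightarrow>\<^sub>E verts (?B n))" using B[of n] by (intro finite_PiE) (auto simp: is_struct_def)
        then show "finite {u \<in> ?X \<rightarrow>\<^sub>E verts (?B n). sat (?B n) u \<phi>}" by simp
        show "same_copy ?X ` {u \<in> ?X \<rightarrow>\<^sub>E verts (?B n). sat (?B n) u \<phi>} \<subseteq> Pow (?X \<times> ?X)"
          by (auto simp: same_copy_def)
      qed simp
      also have "\<dots> = (\<Sum>K\<in>Pow (?X \<times> ?X). card {u \<in> ?X \<rightarrow>\<^sub>E verts (?B n). same_copy ?X u = K \<and> sat (?B n) u \<phi>})"
        by (intro sum.cong refl arg_cong[of _ _ card]) blast
      finally show ?thesis by (simp add: stone_pairing_def V_def sum_divide_distrib)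
    qed
    ultimately show ?thesis by simp
  qed
qed

theorem corollary5p5:
  fixes L :: "'l language" and R :: 'l
    and A :: "nat \<Rightarrow> ('l, 'a) fo_struct" and G :: "nat \<Rightarrow> ('l, 'b) fo_struct"
    and c :: real
  assumes "finite_relational_language L"
    and "R \<notin> rel_syms L" and "1 \<le> arity L R"
    and "\<And>n. is_struct (base_language L R) (A n)"
    and "local_convergent (base_language L R) A"
    and "(\<lambda>n. stone_pairing (rel_atom L R) (A n)) \<longlonglongrightarrow> c" and "c > 0"
    and "\<And>n. is_gadget L R (G n)"
  shows "(constant_local_convergent (gadget_language L R) G \<longrightarrow>
           local_convergent L (\<lambda>n. gadget_construction L R (A n) (G n))) \<and>
         (filterlim (\<lambda>n. card (verts (A n))) at_top sequentially \<longrightarrow>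
           fms_convergent (constant_local_fms_upto (gadget_language L R) 1) G \<longrightarrow>
           local_convergent L (\<lambda>n. gadget_construction L R (A n) (G n)))"
proof -
  have L0: "const_syms L = {}" using assms(1) by (simp add: finite_relational_language_def)
  let ?LG = "gadget_language L R"
  have main: "local_convergent L (\<lambda>n. gadget_construction L R (A n) (G n))"
    if conv1: "fms_convergent (constant_local_fms_upto ?LG 1) G"
      and conv: "(\<forall>m. fms_convergent (constant_local_fms_upto ?LG m) G) \<or>
        (\<lambda>n. 1 / real (card (verts (A n)))) \<longlonglongrightarrow> 0"
    unfolding local_convergent_def fms_convergent_def
  proof
    fix \<phi> assume \<phi>: "\<phi> \<in> local_fms L"
    then have wf: "wf_fm L \<phi>" by (simp add: local_fms_def)
    have "stone_pairing \<phi> (gadget_construction L R (A n) (G n)) =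
        stone_pairing \<phi> (glued L R (A n) (\<lambda>_. G n))" for n
      using L0 assms(4,8) by (intro stone_pairing_iso[OF _ glued_iso wf] glued_struct)
    then show "convergent (\<lambda>n. stone_pairing \<phi> (gadget_construction L R (A n) (G n)))"
      using glued_pairing_convergent[OF assms(1,3,4,5,6,7,8) conv1 conv \<phi>] by simp
  qed
  show ?thesis
  proof (intro conjI impI)
    assume "constant_local_convergent ?LG G"
    then have "fms_convergent (constant_local_fms_upto ?LG m) G" for m
      by (simp add: constant_local_convergent_def fms_convergent_def constant_local_fms_upto_def)
    then show "local_convergent L (\<lambda>n. gadget_construction L R (A n) (G n))" by (intro main) auto
  next
    assume "filterlim (\<lambda>n. card (verts (A n))) at_top sequentially"
      and conv1: "fms_convergent (constant_local_fms_upto ?LG 1) G"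
    then have "filterlim (\<lambda>n. real (card (verts (A n)))) at_top sequentially"
      using filterlim_compose[OF filterlim_real_sequentially] by blast
    then have "(\<lambda>n. 1 / real (card (verts (A n)))) \<longlonglongrightarrow> 0"
      by (simp add: tendsto_inverse_0_at_top divide_inverse)
    then show "local_convergent L (\<lambda>n. gadget_construction L R (A n) (G n))" using conv1 by (intro main) auto
  qed
qed

end
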